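(* Let $X$ be a smooth manifold of dimension $n\ge d$. Let $L=V_0+\sum_{i=1}^dV_i^2$ be a Hörmander's type operator on $X$, where the $V_i$'s are smooth vector fields. Assume that $L$ is essentially self-adjoint on $C_0^\infty(X)$ in $L^2(X,\mu)$ for some Radon measure $\mu$ on $X$. Consider the Dirichlet space $(X,\mu,\mathcal E,\mathcal F)$ obtained by closing the pre-Dirichlet form $$\mathcal E(f,g)=\int_X\Gamma(f,g)\,d\mu,\qquad f,g\in C_0^\infty(X),$$ where $\Gamma(f,g)=\frac12\left(L(fg)-fLg-gLf\right)=\sum_{i=1}^d(V_if)(V_ig)$. Assume that the associated semigroup $P_t$ is conservative. Then, for every $p\ge1$, $$C_0^\infty(X)\subset\mathbf B^{p,1/2}(X),$$ and for every $f\in C_0^\infty(X)$ and every open set $A\subset X$, $$\lim_{t\to0}t^{-1/2}\left(\int_AP_t(|f-f(x)|^p)(x)\,d\mu(x)\right)^{1/p}=2\left(\frac{\Gamma_{\mathrm{Eul}}\left(\frac{1+p}{2}\right)}{\sqrt\pi}\right)^{1/p}\left(\int_A\Gamma(f,f)(x)^{p/2}\,d\mu(x)\right)^{1/p},$$ where $\Gamma_{\mathrm{Eul}}$ denotes Euler's gamma function.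
   Context: $C_0^\infty(X)$ is the space of smooth compactly supported functions on $X$. $P_t$ is the heat semigroup (self-adjoint Markovian semigroup on $L^2(X,\mu)$, extended to a contraction semigroup on all $L^p(X,\mu)$) associated with the Dirichlet form $(\mathcal E,\mathcal F)$, i.e. the semigroup generated by the self-adjoint closure of $L$. Conservative means $P_t1=1$ for all $t\ge 0$; then there are probability kernels $p_t(x,dy)$ with $P_tf(x)=\int_Xf(y)\,p_t(x,dy)$ for bounded or non-negative measurable $f$, and $P_t(|f-f(x)|^p)(x)=\int_X|f(y)-f(x)|^p\,p_t(x,dy)$. For $p\ge1$, $\alpha\ge0$, $f\in L^p(X,\mu)$, $$\|f\|_{p,\alpha}=\sup_{t>0}t^{-\alpha}\left(\int_XP_t(|f-f(y)|^p)(y)\,d\mu(y)\right)^{1/p},$$ and $\mathbf B^{p,\alpha}(X)=\{f\in L^p(X,\mu):\|f\|_{p,\alpha}<+\infty\}$. Here "Hörmander's type operator" refers to an operator of the displayed form $V_0+\sum_{i=1}^dV_i^2$ with smooth vector fields $V_0,\dots,V_d$; the paper states no further condition on the vector fields. *)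

theory Defs
  imports "HOL-Probability.Probability"
begin

section \<open>Smooth manifolds, smooth functions and vector fields\<close>

text \<open>\<open>C\<^sup>k\<close> and smooth maps on a set \<open>S\<close> that is meant to be open.\<close>

primrec Ck_on :: "nat \<Rightarrow> 'a::euclidean_space set \<Rightarrow> ('a \<Rightarrow> 'b::real_normed_vector) \<Rightarrow> bool" where
  "Ck_on 0 S f \<longleftrightarrow> continuous_on S f"
| "Ck_on (Suc k) S f \<longleftrightarrow>
     (\<forall>x\<in>S. f differentiable (at x)) \<and> (\<forall>v. Ck_on k S (\<lambda>x. frechet_derivative f (at x) v))"

definition smooth_on :: "'a::euclidean_space set \<Rightarrow> ('a \<Rightarrow> 'b::real_normed_vector) \<Rightarrow> bool" where
  "smooth_on S f \<longleftrightarrow> (\<forall>k. Ck_on k S f)"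

text \<open>
  The manifold is the whole type \<open>'a\<close>; being Hausdorff and second countable will be imposed by type
  classes, and its dimension is \<open>DIM('e)\<close>. A chart is a pair \<open>(U, \<phi>)\<close> of its domain and its
  coordinate map, the values of \<open>\<phi>\<close> outside \<open>U\<close> being irrelevant.
\<close>

type_synonym ('a, 'e) chart = "'a set \<times> ('a \<Rightarrow> 'e)"

definition smooth_atlas ::
    "('a::topological_space, 'e::euclidean_space) chart set \<Rightarrow> bool" where
  "smooth_atlas \<A> \<longleftrightarrow>
     (\<forall>(U, \<phi>)\<in>\<A>. open U \<and> open (\<phi> ` U) \<and> homeomorphism U (\<phi> ` U) \<phi> (inv_into U \<phi>)) \<and>
     (\<Union>(U, \<phi>)\<in>\<A>. U) = UNIV \<and>
     (\<forall>(U, \<phi>)\<in>\<A>. \<forall>(W, \<psi>)\<in>\<A>. smooth_on (\<phi> ` (U \<inter> W)) (\<psi> \<circ> inv_into U \<phi>))"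

definition smooth_fun ::
    "('a::topological_space, 'e::euclidean_space) chart set \<Rightarrow> ('a \<Rightarrow> real) \<Rightarrow> bool" where
  "smooth_fun \<A> f \<longleftrightarrow> (\<forall>(U, \<phi>)\<in>\<A>. smooth_on (\<phi> ` U) (f \<circ> inv_into U \<phi>))"

definition test_functions ::
    "('a::topological_space, 'e::euclidean_space) chart set \<Rightarrow> ('a \<Rightarrow> real) set" where
  "test_functions \<A> = {f. smooth_fun \<A> f \<and> compact (closure {x. f x \<noteq> 0})}"

text \<open>
  A smooth vector field, seen as a first-order differential operator: in every chart it is
  \<open>\<Sum>\<^sub>j a\<^sub>j \<partial>\<^sub>j\<close> with smooth coefficients, i.e. the derivative in the direction of a smooth map
  \<open>a\<close>. Values of \<open>V\<close> on functions that are not smooth are irrelevant.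
\<close>

definition smooth_vector_field ::
    "('a::topological_space, 'e::euclidean_space) chart set \<Rightarrow> (('a \<Rightarrow> real) \<Rightarrow> 'a \<Rightarrow> real) \<Rightarrow> bool"
  where
  "smooth_vector_field \<A> V \<longleftrightarrow>
     (\<forall>(U, \<phi>)\<in>\<A>. \<exists>a :: 'e \<Rightarrow> 'e. smooth_on (\<phi> ` U) a \<and>
        (\<forall>f. smooth_fun \<A> f \<longrightarrow>
           (\<forall>x\<in>U. V f x = frechet_derivative (f \<circ> inv_into U \<phi>) (at (\<phi> x)) (a (\<phi> x)))))"

definition hormander_operator ::
    "nat \<Rightarrow> (nat \<Rightarrow> ('a \<Rightarrow> real) \<Rightarrow> 'a \<Rightarrow> real) \<Rightarrow> ('a \<Rightarrow> real) \<Rightarrow> 'a \<Rightarrow> real" where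
  "hormander_operator d V f = (\<lambda>x. V 0 f x + (\<Sum>i\<in>{1..d}. V i (V i f) x))"

definition carre_du_champ ::
    "(('a \<Rightarrow> real) \<Rightarrow> 'a \<Rightarrow> real) \<Rightarrow> ('a \<Rightarrow> real) \<Rightarrow> ('a \<Rightarrow> real) \<Rightarrow> 'a \<Rightarrow> real" where
  "carre_du_champ L f g =
     (\<lambda>x. (L (\<lambda>y. f y * g y) x - f x * L g x - g x * L f x) / 2)"

text \<open>
  The remainder of this section shows \<open>\<Gamma>(f, g) = \<Sum>\<^sub>i (V\<^sub>i f) (V\<^sub>i g)\<close> for smooth \<open>f, g\<close>
  (lemma \<open>carre_du_champ_hormander_operator\<close>).
\<close>

lemma Ck_on_cong:
  assumes "open S" "Ck_on k S f" "\<And>x. x \<in> S \<Longrightarrow> f x = g x"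
  shows "Ck_on k S g"
  using assms(2,3)
proof (induction k arbitrary: f g)
  case 0
  then show ?case using continuous_on_cong[of S S f g] by simp
next
  case (Suc k)
  have D: "(g has_derivative frechet_derivative f (at x)) (at x)" if "x \<in> S" for x
  proof (rule has_derivative_transform_within_open[OF _ assms(1) that])
    show "(f has_derivative frechet_derivative f (at x)) (at x)"
      using Suc.prems(1) that by (simp add: frechet_derivative_works[symmetric])
  qed (rule Suc.prems(2))
  have E: "frechet_derivative f (at x) = frechet_derivative g (at x)" if "x \<in> S" for x
    by (rule frechet_derivative_at[OF D[OF that]])
  have "Ck_on k S (\<lambda>x. frechet_derivative g (at x) v)" for v
    by (rule Suc.IH[of "\<lambda>x. frechet_derivative f (at x) v"]) (use Suc.prems(1) E in auto)
  then show ?case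
    using D by (auto simp: differentiable_def)
qed

lemma Ck_on_SucD: "Ck_on (Suc k) S f \<Longrightarrow> Ck_on k S f"
proof (induction k arbitrary: f)
  case 0
  then show ?case
    by (simp add: continuous_at_imp_continuous_on differentiable_imp_continuous_within)
next
  case (Suc k)
  then show ?case by (metis Ck_on.simps(2))
qed

lemma Ck_on_const: "Ck_on k S (\<lambda>_. c)"
  by (induction k arbitrary: c) auto

lemma Ck_on_add:
  assumes "open S" "Ck_on k S f" "Ck_on k S g"
  shows "Ck_on k S (\<lambda>x. f x + g x)"
  using assms(2,3)
proof (induction k arbitrary: f g)
  case 0
  then show ?case by (auto intro: continuous_intros)
next
  case (Suc k)
  have D: "((\<lambda>x. f x + g x) has_derivative
      (\<lambda>v. frechet_derivative f (at x) v + frechet_derivative g (at x) v)) (at x)" if "x \<in> S" for x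
    using Suc.prems that
    by (auto intro!: has_derivative_add simp: frechet_derivative_works[symmetric])
  have E: "frechet_derivative f (at x) v + frechet_derivative g (at x) v =
      frechet_derivative (\<lambda>x. f x + g x) (at x) v" if "x \<in> S" for x v
    using frechet_derivative_at[OF D[OF that]] by metis
  have "Ck_on k S (\<lambda>x. frechet_derivative (\<lambda>x. f x + g x) (at x) v)" for v
    by (rule Ck_on_cong[OF assms(1) Suc.IH E]) (use Suc.prems in auto)
  then show ?case using D by (auto simp: differentiable_def)
qed

lemma Ck_on_mult:
  fixes f g :: "'a::euclidean_space \<Rightarrow> real"
  assumes "open S" "Ck_on k S f" "Ck_on k S g"
  shows "Ck_on k S (\<lambda>x. f x * g x)"
  using assms(2,3)
proof (induction k arbitrary: f g)
  case 0
  then show ?case by (auto intro: continuous_intros)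
next
  case (Suc k)
  have D: "((\<lambda>x. f x * g x) has_derivative
      (\<lambda>v. f x * frechet_derivative g (at x) v + frechet_derivative f (at x) v * g x)) (at x)"
    if "x \<in> S" for x
    using Suc.prems that
    by (auto intro!: has_derivative_mult simp: frechet_derivative_works[symmetric])
  have E: "f x * frechet_derivative g (at x) v + frechet_derivative f (at x) v * g x =
      frechet_derivative (\<lambda>x. f x * g x) (at x) v" if "x \<in> S" for x v
    using frechet_derivative_at[OF D[OF that]] by metis
  have "Ck_on k S (\<lambda>x. frechet_derivative (\<lambda>x. f x * g x) (at x) v)" for v
    by (rule Ck_on_cong[OF assms(1) Ck_on_add[OF assms(1) Suc.IH Suc.IH] E])
      (use Suc.prems Ck_on_SucD in auto)
  then show ?case using D by (auto simp: differentiable_def)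
qed

lemma Ck_on_sum:
  assumes "open S" "finite I" "\<And>i. i \<in> I \<Longrightarrow> Ck_on k S (f i)"
  shows "Ck_on k S (\<lambda>x. \<Sum>i\<in>I. f i x)"
  using assms(2,3)
  by (induction I rule: finite_induct) (auto intro: Ck_on_const Ck_on_add[OF assms(1)])

lemma Ck_on_inner:
  fixes f :: "'a::euclidean_space \<Rightarrow> 'b::euclidean_space"
  assumes "open S" "Ck_on k S f"
  shows "Ck_on k S (\<lambda>x. f x \<bullet> b)"
  using assms(2)
proof (induction k arbitrary: f)
  case 0
  then show ?case by (auto intro: continuous_intros)
next
  case (Suc k)
  have D: "((\<lambda>x. f x \<bullet> b) has_derivative (\<lambda>v. frechet_derivative f (at x) v \<bullet> b)) (at x)"
    if "x \<in> S" for x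
    using Suc.prems that
    by (auto intro!: has_derivative_inner_left simp: frechet_derivative_works[symmetric])
  have E: "frechet_derivative f (at x) v \<bullet> b = frechet_derivative (\<lambda>x. f x \<bullet> b) (at x) v"
    if "x \<in> S" for x v
    using frechet_derivative_at[OF D[OF that]] by metis
  have "Ck_on k S (\<lambda>x. frechet_derivative (\<lambda>x. f x \<bullet> b) (at x) v)" for v
    by (rule Ck_on_cong[OF assms(1) Suc.IH E]) (use Suc.prems in auto)
  then show ?case using D by (auto simp: differentiable_def)
qed

lemma smooth_on_directional_derivative:
  fixes f :: "'a::euclidean_space \<Rightarrow> real"
  assumes "open S" "smooth_on S f" "smooth_on S a"
  shows "smooth_on S (\<lambda>x. frechet_derivative f (at x) (a x))"
  unfolding smooth_on_def
proof
  fix k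
  have *: "Ck_on k S (\<lambda>x. \<Sum>b\<in>Basis. (a x \<bullet> b) * frechet_derivative f (at x) b)"
    using assms by (intro Ck_on_sum Ck_on_mult Ck_on_inner)
      (auto simp: smooth_on_def dest: spec[of _ "Suc k"])
  have "(\<Sum>b\<in>Basis. (a x \<bullet> b) * frechet_derivative f (at x) b) = frechet_derivative f (at x) (a x)"
    if "x \<in> S" for x
  proof -
    have "f differentiable (at x)"
      using assms(2) that by (auto simp: smooth_on_def dest: spec[of _ "Suc 0"])
    then have l: "linear (frechet_derivative f (at x))"
      by (rule linear_frechet_derivative)
    have "frechet_derivative f (at x) (a x) =
        frechet_derivative f (at x) (\<Sum>b\<in>Basis. (a x \<bullet> b) *\<^sub>R b)"
      by (simp add: euclidean_representation)
    then show ?thesis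
      by (simp add: linear_sum[OF l] linear_cmul[OF l])
  qed
  then show "Ck_on k S (\<lambda>x. frechet_derivative f (at x) (a x))"
    by (rule Ck_on_cong[OF assms(1) *])
qed

lemma smooth_fun_vector_field:
  assumes "smooth_atlas \<A>" "smooth_vector_field \<A> V" "smooth_fun \<A> f"
  shows "smooth_fun \<A> (V f)"
  unfolding smooth_fun_def
proof safe
  fix U \<phi> assume c: "(U, \<phi>) \<in> \<A>"
  then have o: "open (\<phi> ` U)" and h: "homeomorphism U (\<phi> ` U) \<phi> (inv_into U \<phi>)"
    using assms(1) by (auto simp: smooth_atlas_def)
  obtain a where a: "smooth_on (\<phi> ` U) a"
    "\<And>x. x \<in> U \<Longrightarrow> V f x = frechet_derivative (f \<circ> inv_into U \<phi>) (at (\<phi> x)) (a (\<phi> x))"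
    using assms(2,3) c unfolding smooth_vector_field_def by fast
  have s: "smooth_on (\<phi> ` U) (f \<circ> inv_into U \<phi>)"
    using assms(3) c by (auto simp: smooth_fun_def)
  have "frechet_derivative (f \<circ> inv_into U \<phi>) (at y) (a y) = (V f \<circ> inv_into U \<phi>) y"
    if "y \<in> \<phi> ` U" for y
    using that h a(2) by (auto simp: homeomorphism_def)
  then show "smooth_on (\<phi> ` U) (V f \<circ> inv_into U \<phi>)"
    using smooth_on_directional_derivative[OF o s a(1)] Ck_on_cong[OF o]
    unfolding smooth_on_def by blast
qed

lemma smooth_fun_add:
  assumes "smooth_atlas \<A>" "smooth_fun \<A> f" "smooth_fun \<A> g"
  shows "smooth_fun \<A> (\<lambda>x. f x + g x)"
  using assms unfolding smooth_fun_def smooth_atlas_def smooth_on_def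
  by (auto simp: o_def intro!: Ck_on_add)

lemma smooth_fun_mult:
  assumes "smooth_atlas \<A>" "smooth_fun \<A> f" "smooth_fun \<A> g"
  shows "smooth_fun \<A> (\<lambda>x. f x * g x)"
  using assms unfolding smooth_fun_def smooth_atlas_def smooth_on_def
  by (auto simp: o_def intro!: Ck_on_mult)

lemma
  assumes "smooth_atlas \<A>" "smooth_vector_field \<A> V" "smooth_fun \<A> f" "smooth_fun \<A> g"
  shows vector_field_add: "V (\<lambda>x. f x + g x) = (\<lambda>x. V f x + V g x)"
    and vector_field_mult: "V (\<lambda>x. f x * g x) = (\<lambda>x. f x * V g x + g x * V f x)"
proof -
  have "V (\<lambda>x. f x + g x) x = V f x + V g x \<and> V (\<lambda>x. f x * g x) x = f x * V g x + g x * V f x" for x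
  proof -
    have "x \<in> (\<Union>(U, \<phi>)\<in>\<A>. U)"
      using assms(1) by (simp add: smooth_atlas_def)
    then obtain U \<phi> where c: "(U, \<phi>) \<in> \<A>" "x \<in> U"
      by auto
    have h: "homeomorphism U (\<phi> ` U) \<phi> (inv_into U \<phi>)"
      using assms(1) c by (auto simp: smooth_atlas_def)
    obtain a where a: "\<And>f. smooth_fun \<A> f \<Longrightarrow>
        V f x = frechet_derivative (f \<circ> inv_into U \<phi>) (at (\<phi> x)) (a (\<phi> x))"
      using assms(2) c unfolding smooth_vector_field_def by fast
    have d: "(h \<circ> inv_into U \<phi> has_derivative frechet_derivative (h \<circ> inv_into U \<phi>) (at (\<phi> x)))
        (at (\<phi> x))" if "smooth_fun \<A> h" for h
    proof -
      have "Ck_on (Suc 0) (\<phi> ` U) (h \<circ> inv_into U \<phi>)"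
        using that c(1) unfolding smooth_fun_def smooth_on_def by blast
      then show ?thesis
        using c(2) by (auto simp: frechet_derivative_works[symmetric])
    qed
    note df = d[OF assms(3)] and dg = d[OF assms(4)]
    have i: "inv_into U \<phi> (\<phi> x) = x"
      using h c(2) by (auto simp: homeomorphism_def)
    have 1: "frechet_derivative ((\<lambda>x. f x + g x) \<circ> inv_into U \<phi>) (at (\<phi> x)) (a (\<phi> x)) =
       frechet_derivative (f \<circ> inv_into U \<phi>) (at (\<phi> x)) (a (\<phi> x)) +
       frechet_derivative (g \<circ> inv_into U \<phi>) (at (\<phi> x)) (a (\<phi> x))"
      using fun_cong[OF frechet_derivative_at[OF has_derivative_add[OF df dg]], of "a (\<phi> x)"]
      by (simp add: o_def)
    have 2: "frechet_derivative ((\<lambda>x. f x * g x) \<circ> inv_into U \<phi>) (at (\<phi> x)) (a (\<phi> x)) =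
       f x * frechet_derivative (g \<circ> inv_into U \<phi>) (at (\<phi> x)) (a (\<phi> x)) +
       frechet_derivative (f \<circ> inv_into U \<phi>) (at (\<phi> x)) (a (\<phi> x)) * g x"
      using fun_cong[OF frechet_derivative_at[OF has_derivative_mult[OF df dg]], of "a (\<phi> x)"] i
      by (simp add: o_def)
    show ?thesis
      using 1 2 by (simp add: a assms smooth_fun_add smooth_fun_mult)
  qed
  then show "V (\<lambda>x. f x + g x) = (\<lambda>x. V f x + V g x)"
    and "V (\<lambda>x. f x * g x) = (\<lambda>x. f x * V g x + g x * V f x)"
    by auto
qed

lemma carre_du_champ_hormander_operator:
  assumes \<A>: "smooth_atlas \<A>"
    and V: "\<And>i. i \<le> d \<Longrightarrow> smooth_vector_field \<A> (V i)"
    and f: "smooth_fun \<A> f" and g: "smooth_fun \<A> g"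
  shows "carre_du_champ (hormander_operator d V) f g x = (\<Sum>i\<in>{1..d}. V i f x * V i g x)"
proof -
  have 2: "V i (V i (\<lambda>x. f x * g x)) x =
      f x * V i (V i g) x + g x * V i (V i f) x + 2 * (V i f x * V i g x)" if "i \<in> {1..d}" for i
  proof -
    have Vi: "smooth_vector_field \<A> (V i)" using V that by auto
    note s = smooth_fun_vector_field[OF \<A> Vi]
    show ?thesis
      unfolding vector_field_mult[OF \<A> Vi f g]
        vector_field_add[OF \<A> Vi smooth_fun_mult[OF \<A> f s[OF g]] smooth_fun_mult[OF \<A> g s[OF f]]]
        vector_field_mult[OF \<A> Vi f s[OF g]] vector_field_mult[OF \<A> Vi g s[OF f]]
      by (simp only: mult.commute)
  qed
  have "(\<Sum>i\<in>{1..d}. V i (V i (\<lambda>x. f x * g x)) x) =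
      f x * (\<Sum>i\<in>{1..d}. V i (V i g) x) + g x * (\<Sum>i\<in>{1..d}. V i (V i f) x) +
      2 * (\<Sum>i\<in>{1..d}. V i f x * V i g x)"
    unfolding sum_distrib_left sum.distrib[symmetric] by (rule sum.cong) (use 2 in auto)
  moreover have "V 0 (\<lambda>x. f x * g x) x = f x * V 0 g x + g x * V 0 f x"
    by (simp only: vector_field_mult[OF \<A> V[of 0] f g])
  ultimately show ?thesis
    unfolding carre_du_champ_def hormander_operator_def by (simp only: ring_distribs) simp
qed


section \<open>Function spaces and unbounded operators on \<open>L\<^sup>2\<close>\<close>

definition radon_measure :: "'a::topological_space measure \<Rightarrow> bool" where
  "radon_measure M \<longleftrightarrow> sets M = sets borel \<and>
     (\<forall>K. compact K \<longrightarrow> emeasure M K < \<infinity>) \<and>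
     (\<forall>B\<in>sets M. emeasure M B = (SUP K \<in> {K. K \<subseteq> B \<and> compact K}. emeasure M K))"

text \<open>
  Elements of \<open>L\<^sup>p\<close> are represented by functions; identification almost everywhere is made explicit
  where it matters.
\<close>

definition Lp :: "real \<Rightarrow> 'a measure \<Rightarrow> ('a \<Rightarrow> real) set" where
  "Lp p M = {f \<in> borel_measurable M. integrable M (\<lambda>x. \<bar>f x\<bar> powr p)}"

definition L2_tendsto ::
    "'a measure \<Rightarrow> ('i \<Rightarrow> 'a \<Rightarrow> real) \<Rightarrow> ('a \<Rightarrow> real) \<Rightarrow> 'i filter \<Rightarrow> bool" where
  "L2_tendsto M u f F \<longleftrightarrow> ((\<lambda>i. \<integral>x. (u i x - f x)\<^sup>2 \<partial>M) \<longlongrightarrow> 0) F"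

text \<open>Unbounded operators are identified with their graphs.\<close>

definition op_graph :: "('a \<Rightarrow> real) set \<Rightarrow> (('a \<Rightarrow> real) \<Rightarrow> 'a \<Rightarrow> real) \<Rightarrow>
    (('a \<Rightarrow> real) \<times> ('a \<Rightarrow> real)) set" where
  "op_graph D T = {(f, T f) | f. f \<in> D}"

definition closure_graph :: "'a measure \<Rightarrow> (('a \<Rightarrow> real) \<times> ('a \<Rightarrow> real)) set \<Rightarrow>
    (('a \<Rightarrow> real) \<times> ('a \<Rightarrow> real)) set" where
  "closure_graph M G = {(u, g). u \<in> Lp 2 M \<and> g \<in> Lp 2 M \<and>
     (\<exists>s. (\<forall>n::nat. s n \<in> G) \<and> L2_tendsto M (\<lambda>n. fst (s n)) u sequentially \<and>
          L2_tendsto M (\<lambda>n. snd (s n)) g sequentially)}"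

definition adjoint_graph :: "'a measure \<Rightarrow> (('a \<Rightarrow> real) \<times> ('a \<Rightarrow> real)) set \<Rightarrow>
    (('a \<Rightarrow> real) \<times> ('a \<Rightarrow> real)) set" where
  "adjoint_graph M G = {(u, g). u \<in> Lp 2 M \<and> g \<in> Lp 2 M \<and>
     (\<forall>(f, h)\<in>G. (\<integral>x. u x * h x \<partial>M) = (\<integral>x. g x * f x \<partial>M))}"

definition essentially_self_adjoint ::
    "'a measure \<Rightarrow> ('a \<Rightarrow> real) set \<Rightarrow> (('a \<Rightarrow> real) \<Rightarrow> 'a \<Rightarrow> real) \<Rightarrow> bool" where
  "essentially_self_adjoint M D T \<longleftrightarrow>
     D \<subseteq> Lp 2 M \<and> T ` D \<subseteq> Lp 2 M \<and>
     (\<forall>u\<in>Lp 2 M. \<exists>s. (\<forall>n::nat. s n \<in> D) \<and> L2_tendsto M s u sequentially) \<and>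
     closure_graph M (op_graph D T) = adjoint_graph M (closure_graph M (op_graph D T))"


section \<open>Dirichlet forms and their semigroups\<close>

definition pre_dirichlet_form ::
    "'a measure \<Rightarrow> (('a \<Rightarrow> real) \<Rightarrow> 'a \<Rightarrow> real) \<Rightarrow> ('a \<Rightarrow> real) \<Rightarrow> ('a \<Rightarrow> real) \<Rightarrow> real" where
  "pre_dirichlet_form M L f g = (\<integral>x. carre_du_champ L f g x \<partial>M)"

definition form_approximates :: "'a measure \<Rightarrow> ('a \<Rightarrow> real) set \<Rightarrow>
    (('a \<Rightarrow> real) \<Rightarrow> ('a \<Rightarrow> real) \<Rightarrow> real) \<Rightarrow> (nat \<Rightarrow> 'a \<Rightarrow> real) \<Rightarrow> ('a \<Rightarrow> real) \<Rightarrow> bool" where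
  "form_approximates M D E s u \<longleftrightarrow>
     (\<forall>n. s n \<in> D) \<and> L2_tendsto M s u sequentially \<and>
     (\<forall>e>0. \<exists>N. \<forall>m\<ge>N. \<forall>n\<ge>N.
        E (\<lambda>x. s m x - s n x) (\<lambda>x. s m x - s n x) < e)"

definition closed_form_domain :: "'a measure \<Rightarrow> ('a \<Rightarrow> real) set \<Rightarrow>
    (('a \<Rightarrow> real) \<Rightarrow> ('a \<Rightarrow> real) \<Rightarrow> real) \<Rightarrow> ('a \<Rightarrow> real) set" where
  "closed_form_domain M D E = {u \<in> Lp 2 M. \<exists>s. form_approximates M D E s u}"

definition closed_form :: "'a measure \<Rightarrow> ('a \<Rightarrow> real) set \<Rightarrow>
    (('a \<Rightarrow> real) \<Rightarrow> ('a \<Rightarrow> real) \<Rightarrow> real) \<Rightarrow> ('a \<Rightarrow> real) \<Rightarrow> ('a \<Rightarrow> real) \<Rightarrow> real" where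
  "closed_form M D E u v = (THE e. \<forall>s r. form_approximates M D E s u \<longrightarrow>
     form_approximates M D E r v \<longrightarrow> (\<lambda>n. E (s n) (r n)) \<longlonglongrightarrow> e)"

text \<open>
  The self-adjoint operator \<open>A\<close> of the closed form: \<open>\<E>(u, v) = - \<langle>A u, v\<rangle>\<close> for all \<open>v\<close> in the
  form domain.
\<close>

definition form_generator :: "'a measure \<Rightarrow> ('a \<Rightarrow> real) set \<Rightarrow>
    (('a \<Rightarrow> real) \<Rightarrow> ('a \<Rightarrow> real) \<Rightarrow> real) \<Rightarrow> (('a \<Rightarrow> real) \<times> ('a \<Rightarrow> real)) set" where
  "form_generator M D E = {(u, g). u \<in> closed_form_domain M D E \<and> g \<in> Lp 2 M \<and>
     (\<forall>v\<in>closed_form_domain M D E. closed_form M D E u v = - (\<integral>x. g x * v x \<partial>M))}"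

text \<open>
  Markovian is meant in the sense of Dirichlet form theory (\<open>0 \<le> f \<le> 1\<close> implies
  \<open>0 \<le> P\<^sub>t f \<le> 1\<close>), which does not include \<open>P\<^sub>t 1 = 1\<close>.
\<close>

definition symmetric_markov_semigroup ::
    "'a measure \<Rightarrow> (real \<Rightarrow> ('a \<Rightarrow> real) \<Rightarrow> 'a \<Rightarrow> real) \<Rightarrow> bool" where
  "symmetric_markov_semigroup M P \<longleftrightarrow>
     (\<forall>t\<ge>0. \<forall>f\<in>Lp 2 M. P t f \<in> Lp 2 M) \<and>
     (\<forall>t\<ge>0. \<forall>f\<in>Lp 2 M. \<forall>g\<in>Lp 2 M. \<forall>a b.
        AE x in M. P t (\<lambda>y. a * f y + b * g y) x = a * P t f x + b * P t g x) \<and>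
     (\<forall>t\<ge>0. \<forall>f\<in>Lp 2 M. (\<integral>x. (P t f x)\<^sup>2 \<partial>M) \<le> (\<integral>x. (f x)\<^sup>2 \<partial>M)) \<and>
     (\<forall>t\<ge>0. \<forall>f\<in>Lp 2 M. \<forall>g\<in>Lp 2 M. (\<integral>x. P t f x * g x \<partial>M) = (\<integral>x. f x * P t g x \<partial>M)) \<and>
     (\<forall>t\<ge>0. \<forall>f\<in>Lp 2 M. (AE x in M. 0 \<le> f x \<and> f x \<le> 1) \<longrightarrow>
        (AE x in M. 0 \<le> P t f x \<and> P t f x \<le> 1)) \<and>
     (\<forall>f\<in>Lp 2 M. AE x in M. P 0 f x = f x) \<and>
     (\<forall>s\<ge>0. \<forall>t\<ge>0. \<forall>f\<in>Lp 2 M. AE x in M. P (s + t) f x = P s (P t f) x) \<and>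
     (\<forall>f\<in>Lp 2 M. L2_tendsto M (\<lambda>t. P t f) f (at_right 0))"

definition semigroup_generator :: "'a measure \<Rightarrow> (real \<Rightarrow> ('a \<Rightarrow> real) \<Rightarrow> 'a \<Rightarrow> real) \<Rightarrow>
    (('a \<Rightarrow> real) \<times> ('a \<Rightarrow> real)) set" where
  "semigroup_generator M P = {(u, g). u \<in> Lp 2 M \<and> g \<in> Lp 2 M \<and>
     L2_tendsto M (\<lambda>t x. (P t u x - u x) / t) g (at_right 0)}"

text \<open>\<open>P\<close> is the semigroup of the Dirichlet form obtained by closing \<open>(E, D)\<close>.\<close>

definition heat_semigroup :: "'a measure \<Rightarrow> ('a \<Rightarrow> real) set \<Rightarrow>
    (('a \<Rightarrow> real) \<Rightarrow> ('a \<Rightarrow> real) \<Rightarrow> real) \<Rightarrow> (real \<Rightarrow> ('a \<Rightarrow> real) \<Rightarrow> 'a \<Rightarrow> real) \<Rightarrow> bool" where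
  "heat_semigroup M D E P \<longleftrightarrow>
     symmetric_markov_semigroup M P \<and> semigroup_generator M P = form_generator M D E"

text \<open>
  \<open>P\<^sub>t 1 = 1\<close>, where \<open>P\<^sub>t\<close> is extended from \<open>L\<^sup>2\<close> to bounded functions by monotone limits.
\<close>

definition conservative ::
    "'a measure \<Rightarrow> (real \<Rightarrow> ('a \<Rightarrow> real) \<Rightarrow> 'a \<Rightarrow> real) \<Rightarrow> bool" where
  "conservative M P \<longleftrightarrow> (\<forall>t\<ge>0. \<forall>u :: nat \<Rightarrow> 'a \<Rightarrow> real. (\<forall>n. u n \<in> Lp 2 M) \<longrightarrow>
     (AE x in M. (\<forall>n. 0 \<le> u n x) \<and> incseq (\<lambda>n. u n x) \<and> (\<lambda>n. u n x) \<longlonglongrightarrow> 1) \<longrightarrow>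
     (AE x in M. (\<lambda>n. P t (u n) x) \<longlonglongrightarrow> 1))"

text \<open>Probability kernels \<open>p\<^sub>t(x, dy)\<close> representing \<open>P\<^sub>t\<close>; they are unique up to \<open>M\<close>-null sets of \<open>x\<close>.\<close>

definition heat_kernel :: "'a::topological_space measure \<Rightarrow>
    (real \<Rightarrow> ('a \<Rightarrow> real) \<Rightarrow> 'a \<Rightarrow> real) \<Rightarrow> (real \<Rightarrow> 'a \<Rightarrow> 'a measure) \<Rightarrow> bool" where
  "heat_kernel M P k \<longleftrightarrow>
     (\<forall>t>0. k t \<in> borel \<rightarrow>\<^sub>M prob_algebra borel) \<and>
     (\<forall>t>0. \<forall>f\<in>Lp 2 M. AE x in M. integrable (k t x) f \<and> P t f x = (\<integral>y. f y \<partial>k t x))"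


section \<open>Heat semigroup based Besov classes\<close>

definition ennreal_root :: "real \<Rightarrow> ennreal \<Rightarrow> ennreal" where
  "ennreal_root p a = (if a = \<infinity> then \<infinity> else ennreal (enn2real a powr (1 / p)))"

text \<open>\<open>(\<integral>\<^sub>A P\<^sub>t(|f - f(x)|\<^sup>p)(x) d\<mu>(x))\<^sup>1\<^sup>/\<^sup>p\<close>, possibly infinite.\<close>

definition heat_increment :: "'a measure \<Rightarrow> (real \<Rightarrow> 'a \<Rightarrow> 'a measure) \<Rightarrow> real \<Rightarrow> real \<Rightarrow>
    'a set \<Rightarrow> ('a \<Rightarrow> real) \<Rightarrow> ennreal" where
  "heat_increment M k p t A f =
     ennreal_root p (\<integral>\<^sup>+x\<in>A. (\<integral>\<^sup>+y. ennreal (\<bar>f y - f x\<bar> powr p) \<partial>k t x) \<partial>M)"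

definition besov_seminorm :: "'a measure \<Rightarrow> (real \<Rightarrow> 'a \<Rightarrow> 'a measure) \<Rightarrow> real \<Rightarrow> real \<Rightarrow>
    ('a \<Rightarrow> real) \<Rightarrow> ennreal" where
  "besov_seminorm M k p \<alpha> f =
     (SUP t\<in>{0<..}. ennreal (t powr (- \<alpha>)) * heat_increment M k p t UNIV f)"

definition besov_space :: "'a measure \<Rightarrow> (real \<Rightarrow> 'a \<Rightarrow> 'a measure) \<Rightarrow> real \<Rightarrow> real \<Rightarrow>
    ('a \<Rightarrow> real) set" where
  "besov_space M k p \<alpha> = {f \<in> Lp p M. besov_seminorm M k p \<alpha> f < \<infinity>}"

end

theory Submission
  imports Defs
begin

text \<open>
  For \<open>X\<close> the diffusion generated by \<open>L\<close> and \<open>\<lambda> = \<xi> / \<surd>t\<close>, Dynkin's formula gives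
  \<open>d/ds E\<^sub>x cos(\<lambda>(f(X\<^sub>s) - f(x))) \<approx> - \<lambda>\<^sup>2 \<Gamma>(f,f)(x) E\<^sub>x cos(\<lambda>(f(X\<^sub>s) - f(x)))\<close> for \<open>s \<le> t\<close>, up to an error that is
  \<open>O(\<surd>t)\<close> after integration over \<open>[0,t]\<close> and over a set of finite measure. Hence the law of the increment
  \<open>(f(X\<^sub>t) - f(X\<^sub>0)) / \<surd>t\<close>, with \<open>X\<^sub>0\<close> uniform on a set of finite measure, converges to a mixture of the centred
  normal laws with variance \<open>2 \<Gamma>(f,f)(x)\<close>. The even moments of the normalised increments are bounded, again by Dynkin's formula,
  so absolute moments converge too. Outside the support of \<open>f\<close> the symmetry of the semigroup moves the integral
  back to the support, where it is controlled by the probability of leaving it.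
\<close>

section \<open>Real analysis preliminaries\<close>

text \<open>No process is constructed: everything is read off the joint law \<open>J s\<close> of a
  starting point and its image under the heat kernel. The obstacle is that \<open>P\<close> acts on
  L^2 and is linear and a semigroup only almost everywhere, so it directly controls only integrals
  of products a(x) g(y). Hence the test quantities are finite sums of such products in f(x) and
  f(y): binomial expansion for powers, addition formula for the cosine. Dynkin's formula becomes an
  estimate on short forward steps, uniform in the time and in a bounded weight w(x); this uniformity
  permits a weight that moves with time, namely the integrating factor cancelling the main term. The
  factor 2 in the limit is a product of two square roots of 2: \<open>L\<close> is built from the
  squares of the V_i without the usual 1/2, so the limiting variance is 2 \<Gamma>, and the p-th
  absolute moment of the standard normal law carries another 2^(p/2). Essential self-adjointness
  supplies integration by parts, and through it the inclusion of \<open>L\<close> on test functions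
  in the generator of the closed form, which is that of the semigroup.\<close>

text \<open>A mean value inequality for a function not known to be continuous: one \<delta> serves
  all s, so [0,t] is cut into equal pieces of length at most \<delta>, the increments are summed,
  and \<epsilon> is sent to 0 at the end.\<close>

lemma telescoping_bound:
  fixes H :: "real \<Rightarrow> real"
  assumes t: "t \<ge> 0"
    and step: "\<And>\<epsilon>. \<epsilon> > 0 \<Longrightarrow> \<exists>\<delta>>0. \<forall>s h. 0 \<le> s \<longrightarrow> 0 < h \<longrightarrow> h \<le> \<delta> \<longrightarrow> s + h \<le> t \<longrightarrow>
      H (s + h) - H s \<le> h * (B + \<epsilon>)"
  shows "H t - H 0 \<le> t * B"
proof (cases "t = 0")
  case False
  have "H t - H 0 \<le> t * B + t * \<epsilon>" if \<epsilon>: "\<epsilon> > 0" for \<epsilon>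
  proof -
    obtain \<delta> where d: "\<delta> > 0" "\<And>s h. 0 \<le> s \<Longrightarrow> 0 < h \<Longrightarrow> h \<le> \<delta> \<Longrightarrow> s + h \<le> t \<Longrightarrow>
      H (s + h) - H s \<le> h * (B + \<epsilon>)"
      using step[OF \<epsilon>] by meson
    obtain N :: nat where N: "t / \<delta> < real N"
      using reals_Archimedean2 by blast
    have N0: "N > 0"
      using N t d(1) by (metis divide_nonneg_pos gr0I of_nat_0 not_le)
    define h where "h = t / real N"
    have h: "h > 0" "h \<le> \<delta>" "real N * h = t"
      using N N0 d(1) False t by (auto simp: h_def field_simps)
    have "i \<le> N \<Longrightarrow> H (real i * h) - H 0 \<le> real i * h * (B + \<epsilon>)" for i
    proof (induction i)
      case (Suc i)
      have "real (Suc i) * h \<le> real N * h"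
        using Suc.prems h(1) by (intro mult_right_mono) auto
      then have "real i * h + h \<le> t"
        using h(3) by (simp add: algebra_simps)
      then have "H (real i * h + h) - H (real i * h) \<le> h * (B + \<epsilon>)"
        using h by (intro d(2)) auto
      then show ?case
        using Suc by (simp add: algebra_simps)
    qed simp
    from this[of N] show ?thesis
      using h(3) by (simp add: algebra_simps)
  qed
  note * = this
  have "H t - H 0 \<le> t * B + \<epsilon>" if "\<epsilon> > 0" for \<epsilon>
    using *[of "\<epsilon> / t"] that False t by simp
  then show ?thesis
    using field_le_epsilon by blast
qed auto

text \<open>The upper bound on exp(-u) comes from exp(-u) (1 + u) \<le> 1 \<le> 1 + u^3 = (1 - u +
  u^2) (1 + u). It controls the change of the integrating factor over a short time step.\<close>

lemma exp_minus_bounds: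
  fixes u :: real assumes "u \<ge> 0"
  shows "\<bar>1 - exp (- u) - u\<bar> \<le> u\<^sup>2"
proof -
  have 1: "1 - u \<le> exp (- u)" using exp_ge_add_one_self[of "- u"] by simp
  have "exp (- u) * (1 + u) \<le> exp (- u) * exp u"
    by (intro mult_left_mono) (use exp_ge_add_one_self[of u] in auto)
  then have "exp (- u) * (1 + u) \<le> 1" by (simp add: exp_minus)
  moreover have "1 \<le> (1 - u + u\<^sup>2) * (1 + u)"
    using assms by (simp add: power2_eq_square algebra_simps)
  ultimately have "exp (- u) * (1 + u) \<le> (1 - u + u\<^sup>2) * (1 + u)" by linarith
  then have "exp (- u) \<le> 1 - u + u\<^sup>2"
    using assms by (simp add: mult_le_cancel_right)
  with 1 show ?thesis by (simp add: abs_le_iff)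
qed

text \<open>The substitution x = sqrt(2u) turns the integral over the positive half-line into
  Euler's integral for Gamma; evenness of the integrand doubles it.\<close>

lemma std_normal_abs_moment:
  fixes p :: real
  assumes p: "p \<ge> 0"
  shows "has_bochner_integral std_normal_distribution (\<lambda>x. \<bar>x\<bar> powr p)
    (2 powr (p / 2) * (Gamma ((1 + p) / 2) / sqrt pi))"
proof -
  define G where "G = Gamma ((1 + p) / 2)"
  let ?f = "\<lambda>x. \<bar>x\<bar> powr p * std_normal_density x"
  let ?g = "\<lambda>u. sqrt (2 * u)" and ?g' = "\<lambda>u. 1 / sqrt (2 * u)"
  \<comment> \<open>\<open>?c\<close> collects the constants of (2u)^(p/2) from |x|^p, of
    (2u)^(-1/2) from the Jacobian and of 1/sqrt(2 pi) from the density.\<close>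
  let ?c = "2 powr (p / 2) / (2 * sqrt pi)"
  let ?r = "\<lambda>u::real. ?c * (u powr ((1 + p) / 2 - 1) / exp u)"
  have hi: "((\<lambda>u. u powr ((1 + p) / 2 - 1) / exp u) has_integral G) {0..}"
    unfolding G_def by (rule Gamma_integral_real) (use p in auto)
  have nn: "(\<integral>\<^sup>+u. ennreal (indicator {0..} u * (u powr ((1 + p) / 2 - 1) / exp u)) \<partial>lborel) = ennreal G"
    by (subst nn_integral_has_integral_lebesgue'[OF _ hi, symmetric])
      (auto intro!: nn_integral_cong split: split_indicator)
  have G0: "G > 0"
    unfolding G_def by (rule Gamma_real_pos) (use p in auto)
  have "has_bochner_integral lborel (\<lambda>u. indicator {0..} u * (u powr ((1 + p) / 2 - 1) / exp u)) G"
    by (rule has_bochner_integral_nn_integral) (use nn G0 in auto)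
  then have "has_bochner_integral lborel (\<lambda>u. ?c * (indicator {0..} u * (u powr ((1 + p) / 2 - 1) / exp u))) (?c * G)"
    by (rule has_bochner_integral_mult_right)
  \<comment> \<open>Euler's integral is taken over the closed half-line, the substitution over the
    open one; they differ in the null set {0}.\<close>
  moreover have "AE u in lborel. ?c * (indicator {0..} u * (u powr ((1 + p) / 2 - 1) / exp u)) = indicator {0<..} u *\<^sub>R ?r u"
    by (rule AE_I[where N="{0}"]) (auto split: split_indicator)
  ultimately have hl: "has_bochner_integral lborel (\<lambda>u. indicator {0<..} u *\<^sub>R ?r u) (?c * G)"
    by (subst (asm) has_bochner_integral_cong_AE) auto
  have eq: "?f (?g u) * ?g' u = ?r u" if u: "u > 0" for u
  proof -
    have a: "?g u powr p = (2 * u) powr (p / 2)"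
      using u by (simp add: powr_half_sqrt[symmetric] powr_powr del: real_sqrt_mult)
    have "?f (?g u) * ?g' u = (2 * u) powr (p / 2) * exp (- u) / (sqrt (2 * pi) * sqrt (2 * u))"
      unfolding std_normal_density_def abs_of_nonneg[OF real_sqrt_ge_zero[of "2 * u"], OF less_imp_le] a
      using u by (simp add: a del: real_sqrt_mult)
    also have "\<dots> = (2 * u) powr (p / 2) * (2 * u) powr (- (1 / 2)) / exp u / sqrt (2 * pi)"
      using u by (simp add: powr_minus_divide powr_half_sqrt exp_minus inverse_eq_divide)
    also have "\<dots> = (2 * u) powr ((1 + p) / 2 - 1) / exp u / sqrt (2 * pi)"
      by (simp add: powr_add[symmetric] field_simps)
    also have "\<dots> = ?r u"
    proof -
      have "2 powr ((1 + p) / 2 - 1) = 2 powr (p / 2) / 2 powr (1 / 2)"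
        by (simp add: powr_diff[symmetric] field_simps)
      then show ?thesis
        using u by (simp add: powr_mult powr_half_sqrt real_sqrt_mult)
    qed
    finally show ?thesis .
  qed
  have eqi: "(\<lambda>u. indicator {0<..} u *\<^sub>R (?f (?g u) * ?g' u)) = (\<lambda>u. indicator {0<..} u *\<^sub>R ?r u)"
  proof
    fix u
    show "indicator {0<..} u *\<^sub>R (?f (?g u) * ?g' u) = indicator {0<..} u *\<^sub>R ?r u"
    proof (cases "u > 0")
      case True
      then show ?thesis by (simp only: eq)
    qed simp
  qed
  have e0: "einterval 0 \<infinity> = {0<..}" by (auto simp: einterval_def)
  have gt: "((ereal \<circ> ?g \<circ> real_of_ereal) \<longlongrightarrow> 0) (at_right 0)" "((ereal \<circ> ?g \<circ> real_of_ereal) \<longlongrightarrow> \<infinity>) (at_left \<infinity>)"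
  proof -
    have "(?g \<longlongrightarrow> 0) (at_right 0)"
      by (auto intro!: tendsto_eq_intros)
    then show "((ereal \<circ> ?g \<circ> real_of_ereal) \<longlongrightarrow> 0) (at_right 0)"
      by (simp only: zero_ereal_def ereal_tendsto_simps)
    have "filterlim ?g at_top at_top"
      by (intro filterlim_compose[OF sqrt_at_top] filterlim_tendsto_pos_mult_at_top[OF tendsto_const _ filterlim_ident]) simp
    then show "((ereal \<circ> ?g \<circ> real_of_ereal) \<longlongrightarrow> \<infinity>) (at_left \<infinity>)"
      by (simp only: ereal_tendsto_simps)
  qed
  have sub: "set_integrable lborel (einterval 0 \<infinity>) ?f"
     "(LBINT x=0..\<infinity>. ?f x) = (LBINT x=0..\<infinity>. ?f (?g x) * ?g' x)"
  proof -
    have si: "set_integrable lborel (einterval 0 \<infinity>) (\<lambda>u. ?f (?g u) * ?g' u)"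
      unfolding set_integrable_def e0 eqi using hl by (simp only: has_bochner_integral_iff)
    note * = interval_integral_substitution_nonneg[of 0 \<infinity> ?g ?g' ?f, OF _ _ _ _ _ _ gt si]
    show "set_integrable lborel (einterval 0 \<infinity>) ?f"
      by (rule *(1); auto intro!: derivative_eq_intros continuous_intros simp: std_normal_density_def[abs_def] inverse_eq_divide)
    show "(LBINT x=0..\<infinity>. ?f x) = (LBINT x=0..\<infinity>. ?f (?g x) * ?g' x)"
      by (rule *(2); auto intro!: derivative_eq_intros continuous_intros simp: std_normal_density_def[abs_def] inverse_eq_divide)
  qed
  have "(LBINT x=0..\<infinity>. ?f (?g x) * ?g' x) = ?c * G"
    using hl unfolding interval_lebesgue_integral_def set_lebesgue_integral_def e0 eqi
    by (simp only: has_bochner_integral_iff) simp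
  then have "has_bochner_integral lborel (\<lambda>x. indicator {0<..} x *\<^sub>R ?f x) (?c * G)"
    using sub unfolding has_bochner_integral_iff interval_lebesgue_integral_def set_lebesgue_integral_def e0 set_integrable_def
    by simp
  moreover have "AE x in lborel. indicator {0<..} x *\<^sub>R ?f x = indicator {0..} x *\<^sub>R ?f x"
    by (rule AE_I[where N="{0}"]) (auto split: split_indicator)
  ultimately have "has_bochner_integral lborel (\<lambda>x. indicator {0..} x *\<^sub>R ?f x) (?c * G)"
    by (subst (asm) has_bochner_integral_cong_AE) auto
  then have "has_bochner_integral lborel ?f (2 *\<^sub>R (?c * G))"
    by (rule has_bochner_integral_even_function) (simp add: std_normal_density_def)
  then show ?thesis
    by (subst has_bochner_integral_density) (auto simp: G_def mult.commute)
qed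

text \<open>Levy's continuity theorem gives convergence for bounded continuous integrands. The
  unbounded |x|^p is cut at height R, which costs at most the moment of order 2p divided by R,
  uniformly in n.\<close>

lemma abs_moment_tendsto:
  fixes \<nu> :: "nat \<Rightarrow> real measure" and p :: real
  assumes \<nu>: "\<And>n. real_distribution (\<nu> n)" and \<nu>': "real_distribution \<nu>'"
    and char: "\<And>\<xi>. (\<lambda>n. char (\<nu> n) \<xi>) \<longlonglongrightarrow> char \<nu>' \<xi>"
    and p: "p > 0"
    and i: "\<And>n. integrable (\<nu> n) (\<lambda>x. \<bar>x\<bar> powr (2 * p))"
    and b: "\<And>n. (LINT x|\<nu> n. \<bar>x\<bar> powr (2 * p)) \<le> C"
    and i': "integrable \<nu>' (\<lambda>x. \<bar>x\<bar> powr (2 * p))"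
  shows "(\<lambda>n. LINT x|\<nu> n. \<bar>x\<bar> powr p) \<longlonglongrightarrow> (LINT x|\<nu>'. \<bar>x\<bar> powr p)"
proof -
  have trunc: "\<bar>(LINT x|N. \<bar>x\<bar> powr p) - (LINT x|N. min (\<bar>x\<bar> powr p) R)\<bar> \<le> (LINT x|N. \<bar>x\<bar> powr (2 * p)) / R"
    if N: "real_distribution N" and iN: "integrable N (\<lambda>x. \<bar>x\<bar> powr (2 * p))" and R: "R > 0" for N R
  proof -
    interpret real_distribution N by fact
    have le: "a \<le> 1 + a\<^sup>2" for a :: real
      using zero_le_power2[of "a - 1/2"] by (simp add: power2_eq_square algebra_simps)
    have sq: "(\<bar>x\<bar> powr p)\<^sup>2 = \<bar>x\<bar> powr (2 * p)" for x :: real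
      by (simp add: power2_eq_square flip: powr_add)
    have i1: "integrable N (\<lambda>x. \<bar>x\<bar> powr p)"
      by (rule Bochner_Integration.integrable_bound[of _ "\<lambda>x. 1 + \<bar>x\<bar> powr (2 * p)"])
        (use iN le[of "\<bar>_\<bar> powr p"] in \<open>auto simp: sq\<close>)
    have i2: "integrable N (\<lambda>x. min (\<bar>x\<bar> powr p) R)"
      by (rule integrable_const_bound[of _ R]) (use R in auto)
    have "(LINT x|N. \<bar>x\<bar> powr p) - (LINT x|N. min (\<bar>x\<bar> powr p) R) =
        (LINT x|N. \<bar>x\<bar> powr p - min (\<bar>x\<bar> powr p) R)"
      using i1 i2 by simp
    moreover have "(LINT x|N. \<bar>x\<bar> powr p - min (\<bar>x\<bar> powr p) R) \<ge> 0"
      by (rule integral_nonneg_AE) auto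
    moreover have "(LINT x|N. \<bar>x\<bar> powr p - min (\<bar>x\<bar> powr p) R) \<le> (LINT x|N. \<bar>x\<bar> powr (2 * p) / R)"
    proof (rule integral_mono)
      fix x
      \<comment> \<open>Only a > R matters, and there a - R \<le> a \<le> a^2 / R.\<close>
      have "a - min a R \<le> a\<^sup>2 / R" if "a \<ge> 0" for a
      proof (cases "a \<le> R")
        case False
        then have "(a - R) * R \<le> a * a" using that R by (intro mult_mono) auto
        then show ?thesis using False R by (simp add: min_def pos_le_divide_eq power2_eq_square)
      qed (use R in auto)
      from this[of "\<bar>x\<bar> powr p"] show "\<bar>x\<bar> powr p - min (\<bar>x\<bar> powr p) R \<le> \<bar>x\<bar> powr (2 * p) / R"
        by (simp add: sq)
    qed (use i1 i2 iN in auto)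
    ultimately show ?thesis by simp
  qed
  have wc: "weak_conv_m \<nu> \<nu>'"
    by (rule levy_continuity[OF \<nu> \<nu>' char])
  have tr: "(\<lambda>n. LINT x|\<nu> n. min (\<bar>x\<bar> powr p) R) \<longlonglongrightarrow> (LINT x|\<nu>'. min (\<bar>x\<bar> powr p) R)" if "R > 0" for R
    by (rule weak_conv_imp_integral_bdd_continuous_conv[OF \<nu> \<nu>' wc, of _ R])
      (use that p in \<open>auto intro!: continuous_intros\<close>)
  define K where "K = max C (LINT x|\<nu>'. \<bar>x\<bar> powr (2 * p))"
  have K0: "K \<ge> 0"
    unfolding K_def by (simp add: integral_nonneg_AE le_max_iff_disj)
  show ?thesis
  proof (rule LIMSEQ_I)
    fix r :: real assume r: "r > 0"
    \<comment> \<open>Both truncation errors are at most K / R, which this choice makes smaller than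
      r / 3; the last third is left for the bounded integrand.\<close>
    define R where "R = (3 * K + 1) / r"
    have R: "R > 0" "K / R < r / 3"
      using r K0 by (auto simp: R_def field_simps)
    obtain n0 where n0: "\<And>n. n \<ge> n0 \<Longrightarrow>
        \<bar>(LINT x|\<nu> n. min (\<bar>x\<bar> powr p) R) - (LINT x|\<nu>'. min (\<bar>x\<bar> powr p) R)\<bar> < r / 3"
      using LIMSEQ_D[OF tr[OF R(1)], of "r / 3"] r by auto
    have "norm ((LINT x|\<nu> n. \<bar>x\<bar> powr p) - (LINT x|\<nu>'. \<bar>x\<bar> powr p)) < r" if "n \<ge> n0" for n
    proof -
      have "(LINT x|\<nu> n. \<bar>x\<bar> powr (2 * p)) / R \<le> K / R" "(LINT x|\<nu>'. \<bar>x\<bar> powr (2 * p)) / R \<le> K / R"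
        using b[of n] R(1) by (auto simp: K_def intro!: divide_right_mono)
      with trunc[OF \<nu> i R(1), of n] trunc[OF \<nu>' i' R(1)] n0[OF that] R(2)
      show ?thesis unfolding real_norm_def by linarith
    qed
    then show "\<exists>no. \<forall>n\<ge>no. norm ((LINT x|\<nu> n. \<bar>x\<bar> powr p) - (LINT x|\<nu>'. \<bar>x\<bar> powr p)) < r"
      by blast
  qed
qed

section \<open>Smooth functions on manifolds and cutoffs\<close>

lemma smooth_on_cong:
  assumes "open S" "smooth_on S f" "\<And>x. x \<in> S \<Longrightarrow> f x = g x"
  shows "smooth_on S g"
  using assms Ck_on_cong unfolding smooth_on_def by blast

lemma Ck_on_Un:
  assumes "open S" "open T" "Ck_on k S f" "Ck_on k T f"
  shows "Ck_on k (S \<union> T) f"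
  using assms(3,4) by (induction k arbitrary: f) (auto intro: continuous_on_open_Un assms(1,2))

lemma smooth_on_Un: "open S \<Longrightarrow> open T \<Longrightarrow> smooth_on S f \<Longrightarrow> smooth_on T f \<Longrightarrow> smooth_on (S \<union> T) f"
  by (simp add: smooth_on_def Ck_on_Un)

lemma smooth_on_real_deriv:
  fixes \<psi> \<psi>' :: "real \<Rightarrow> real"
  assumes "smooth_on UNIV \<psi>" "\<And>x. (\<psi> has_real_derivative \<psi>' x) (at x)"
  shows "smooth_on UNIV \<psi>'"
proof -
  have "Ck_on k UNIV \<psi>'" for k
  proof (rule Ck_on_cong[of UNIV k "\<lambda>x. frechet_derivative \<psi> (at x) 1"])
    show "Ck_on k UNIV (\<lambda>x. frechet_derivative \<psi> (at x) 1)"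
      using assms(1)[unfolded smooth_on_def, rule_format, of "Suc k"] by simp
    show "frechet_derivative \<psi> (at x) 1 = \<psi>' x" for x
      using frechet_derivative_at[of \<psi> "(*) (\<psi>' x)" x] assms(2)[of x]
      by (simp add: has_field_derivative_def) (metis mult.right_neutral)
  qed simp
  then show ?thesis by (simp add: smooth_on_def)
qed

text \<open>Smoothness by closure under differentiation: the induction gains one order for all
  members at once, so it suffices to embed a function in a family whose derivatives are built from
  its own members.\<close>

lemma Ck_on_family:
  fixes F :: "'i \<Rightarrow> real \<Rightarrow> real"
  assumes "\<And>i x. (F i has_real_derivative F' i x) (at x)"
    and "\<And>k i. (\<And>j. Ck_on k UNIV (F j)) \<Longrightarrow> Ck_on k UNIV (F' i)"
  shows "Ck_on k UNIV (F i)"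
proof (induction k arbitrary: i)
  case 0
  show ?case
    using assms(1) by (auto intro!: continuous_at_imp_continuous_on DERIV_isCont)
next
  case (Suc k)
  have D: "(F i has_derivative (*) (F' i x)) (at x)" for x
    using assms(1)[of i x] by (simp add: has_field_derivative_def)
  have E: "frechet_derivative (F i) (at x) v = F' i x * v" for x v
    using frechet_derivative_at[OF D] by metis
  show ?case
    using D assms(2)[OF Suc, of i] unfolding Ck_on.simps E
    by (auto simp: differentiable_def intro!: Ck_on_mult Ck_on_const)
qed

text \<open>The chain rule replaces \<psi> by its derivative in front of the derivative of g, hence
  the induction generalises over \<psi>, which stays smooth, while g is kept fixed and used with one
  order less.\<close>

lemma Ck_on_compose:
  fixes \<psi> :: "real \<Rightarrow> real" and g :: "'a::euclidean_space \<Rightarrow> real"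
  assumes "open S" "smooth_on UNIV \<psi>" "Ck_on k S g"
  shows "Ck_on k S (\<lambda>x. \<psi> (g x))"
  using assms(2,3)
proof (induction k arbitrary: \<psi>)
  case 0
  have "Ck_on 0 UNIV \<psi>" using 0 by (auto simp: smooth_on_def simp del: Ck_on.simps)
  then show ?case
    using 0 by (auto intro: continuous_on_compose2)
next
  case (Suc k)
  have "Ck_on (Suc 0) UNIV \<psi>" using Suc.prems(1) by (auto simp: smooth_on_def simp del: Ck_on.simps)
  then have d: "(\<psi> has_real_derivative deriv \<psi> x) (at x)" for x
    by (auto simp: DERIV_deriv_iff_real_differentiable)
  have sd: "smooth_on UNIV (deriv \<psi>)"
    by (rule smooth_on_real_deriv[OF Suc.prems(1) d])
  have g: "(g has_derivative frechet_derivative g (at x)) (at x)" if "x \<in> S" for x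
    using Suc.prems(2) that by (simp add: frechet_derivative_works[symmetric])
  have D: "((\<lambda>x. \<psi> (g x)) has_derivative (\<lambda>v. deriv \<psi> (g x) * frechet_derivative g (at x) v)) (at x)"
    if "x \<in> S" for x
    by (rule has_derivative_compose[OF g[OF that] d[unfolded has_field_derivative_def]])
  have E: "deriv \<psi> (g x) * frechet_derivative g (at x) v = frechet_derivative (\<lambda>x. \<psi> (g x)) (at x) v"
    if "x \<in> S" for x v
    using frechet_derivative_at[OF D[OF that]] by metis
  have "Ck_on k S (\<lambda>x. frechet_derivative (\<lambda>x. \<psi> (g x)) (at x) v)" for v
    by (rule Ck_on_cong[OF assms(1) _ E])
      (use Suc sd Ck_on_SucD in \<open>auto intro!: Ck_on_mult assms(1)\<close>)
  then show ?case using D by (auto simp: differentiable_def)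
qed

lemma smooth_on_const: "smooth_on S (\<lambda>_. c)"
  by (simp add: smooth_on_def Ck_on_const)

lemma smooth_on_add: "open S \<Longrightarrow> smooth_on S f \<Longrightarrow> smooth_on S g \<Longrightarrow> smooth_on S (\<lambda>x. f x + g x)"
  by (simp add: smooth_on_def Ck_on_add)

lemma smooth_on_mult:
  fixes f g :: "'a::euclidean_space \<Rightarrow> real"
  shows "open S \<Longrightarrow> smooth_on S f \<Longrightarrow> smooth_on S g \<Longrightarrow> smooth_on S (\<lambda>x. f x * g x)"
  by (simp add: smooth_on_def Ck_on_mult)

lemma smooth_on_id: "smooth_on UNIV (\<lambda>x::real. x)"
proof -
  \<comment> \<open>The two-member family of x and 1 suffices: the derivative of the first is the
    second.\<close>
  have "Ck_on k UNIV ((\<lambda>b::bool. \<lambda>x::real. if b then x else 1) True)" for k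
    by (rule Ck_on_family[where F' = "\<lambda>b x. if b then 1 else 0"])
      (auto intro!: derivative_eq_intros Ck_on_const simp: if_distrib)
  then show ?thesis by (simp add: smooth_on_def)
qed

lemma smooth_on_power: "smooth_on UNIV (\<lambda>x::real. x ^ n)"
  by (induction n) (auto intro: smooth_on_const smooth_on_mult smooth_on_id)

text \<open>Differentiation multiplies the amplitude by a and shifts the phase by pi/2, so amplitude
  and phase index a family closed under it. The free phase b makes the lemma cover the sine
  too.\<close>

lemma smooth_on_cos: "smooth_on UNIV (\<lambda>x::real. cos (a * x + b))"
proof -
  have "Ck_on k UNIV ((\<lambda>(c::real, b). \<lambda>x::real. c * cos (a * x + b)) (1, b))" for k
  proof (rule Ck_on_family[where F' = "\<lambda>(c, b) x. (c * a) * cos (a * x + (b + pi / 2))"])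
    show "((\<lambda>(c::real, b). \<lambda>x::real. c * cos (a * x + b)) i has_real_derivative
       (case i of (c, b) \<Rightarrow> \<lambda>x. (c * a) * cos (a * x + (b + pi / 2))) x) (at x)" for i x
    proof (cases i)
      case (Pair c b)
      have "cos (a * x + (b + pi / 2)) = - sin (a * x + b)"
        by (simp add: cos_add sin_add)
      then show ?thesis unfolding Pair by (auto intro!: derivative_eq_intros)
    qed
    show "Ck_on k UNIV ((\<lambda>(c, b) x. (c * a) * cos (a * x + (b + pi / 2))) i)"
      if "\<And>j. Ck_on k UNIV ((\<lambda>(c::real, b). \<lambda>x::real. c * cos (a * x + b)) j)" for k i
      using that[of "(fst i * a, snd i + pi / 2)"] by (simp add: split_beta)
  qed
  then show ?thesis by (simp add: smooth_on_def)
qed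

text \<open>The classical flat function exp(-1/x) is the case m = 0. The powers of 1/x are carried
  along because differentiation produces them, so that the family in m is closed under
  differentiation up to linear combinations.\<close>

definition flat_exp :: "nat \<Rightarrow> real \<Rightarrow> real" where
  "flat_exp m x = (if x > 0 then inverse x ^ m * exp (- inverse x) else 0)"

lemma flat_exp_has_derivative:
  "(flat_exp m has_real_derivative flat_exp (m + 2) x - real m * flat_exp (m + 1) x) (at x)"
proof -
  consider "x > 0" | "x < 0" | "x = 0" by linarith
  then show ?thesis
  proof cases
    case 1
    have i: "(inverse has_real_derivative - (inverse x ^ Suc (Suc 0))) (at x)"
      using 1 by (intro DERIV_inverse) simp
    have "real m * (- (inverse x ^ Suc (Suc 0)) * inverse x ^ (m - Suc 0)) = - (real m * inverse x ^ (m + 1))"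
      by (cases m) auto
    then have 2: "((\<lambda>x. inverse x ^ m) has_real_derivative - (real m * inverse x ^ (m + 1))) (at x)"
      by (rule DERIV_cong[OF DERIV_power[OF i]])
    have 3: "((\<lambda>x. exp (- inverse x)) has_real_derivative exp (- inverse x) * inverse x ^ 2) (at x)"
      using DERIV_fun_exp[OF DERIV_minus[OF i]] by (simp add: power2_eq_square)
    have "((\<lambda>x. inverse x ^ m * exp (- inverse x)) has_real_derivative
        flat_exp (m + 2) x - real m * flat_exp (m + 1) x) (at x)"
      by (rule DERIV_cong[OF DERIV_mult[OF 2 3]])
        (use 1 in \<open>simp add: flat_exp_def power_add power2_eq_square algebra_simps\<close>)
    then show ?thesis
      by (rule has_field_derivative_transform_within_open[where S = "{0<..}"])
        (use 1 in \<open>auto simp: flat_exp_def\<close>)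
  next
    case 2
    have "((\<lambda>x. 0) has_real_derivative 0) (at x)" by simp
    then have "(flat_exp m has_real_derivative 0) (at x)"
      by (rule has_field_derivative_transform_within_open[where S = "{..<0}"])
        (use 2 in \<open>auto simp: flat_exp_def\<close>)
    then show ?thesis using 2 by (simp add: flat_exp_def)
  next
    case 3
    \<comment> \<open>At 0 the right difference quotient is h^(-(m+1)) exp(-1/h), which is this
      expression at y = 1/h.\<close>
    have "((\<lambda>y. y ^ (m + 1) / exp y) \<longlongrightarrow> (0::real)) at_top"
      by (rule tendsto_power_div_exp_0)
    then have "((\<lambda>h. inverse h ^ (m + 1) / exp (inverse h)) \<longlongrightarrow> (0::real)) (at_right 0)"
      by (rule filterlim_compose) (rule filterlim_inverse_at_top_right)
    then have r: "((\<lambda>h. (flat_exp m (0 + h) - flat_exp m 0) / h) \<longlongrightarrow> 0) (at_right 0)"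
      by (rule Lim_transform_eventually)
        (auto simp: eventually_at_filter flat_exp_def exp_minus field_simps)
    have l: "((\<lambda>h. (flat_exp m (0 + h) - flat_exp m 0) / h) \<longlongrightarrow> 0) (at_left 0)"
      by (rule Lim_transform_eventually[OF tendsto_const])
        (auto simp: eventually_at_filter flat_exp_def)
    have "(flat_exp m has_real_derivative 0) (at 0)"
      unfolding DERIV_def using l r by (simp only: filterlim_split_at)
    then show ?thesis using 3 by (simp add: flat_exp_def)
  qed
qed

lemma smooth_on_flat_exp: "smooth_on UNIV (flat_exp m)"
proof -
  have "Ck_on k UNIV (flat_exp m)" for k
  proof (rule Ck_on_family[OF flat_exp_has_derivative])
    show "Ck_on k UNIV (\<lambda>x. flat_exp (i + 2) x - real i * flat_exp (i + 1) x)"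
      if "\<And>j. Ck_on k UNIV (flat_exp j)" for k i
      using Ck_on_add[OF open_UNIV that[of "i+2"] Ck_on_mult[OF open_UNIV Ck_on_const[of _ _ "- real i"] that[of "i+1"]]]
      by simp
  qed
  then show ?thesis by (simp add: smooth_on_def)
qed

section \<open>Charts, chain rule and locality for vector fields\<close>

lemma atlas_chart:
  assumes "smooth_atlas \<A>" "(U, \<phi>) \<in> \<A>"
  shows "open U" "open (\<phi> ` U)" "homeomorphism U (\<phi> ` U) \<phi> (inv_into U \<phi>)"
    "\<And>x. x \<in> U \<Longrightarrow> inv_into U \<phi> (\<phi> x) = x"
  using assms by (auto simp: smooth_atlas_def homeomorphism_def)

lemma atlas_cover:
  assumes "smooth_atlas \<A>"
  obtains U \<phi> where "(U, \<phi>) \<in> \<A>" "x \<in> U"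
proof -
  have "x \<in> (\<Union>(U, \<phi>)\<in>\<A>. U)"
    using assms by (simp add: smooth_atlas_def)
  then show ?thesis using that by auto
qed

lemma open_chart_image:
  assumes \<A>: "smooth_atlas \<A>" and c: "(U, \<phi>) \<in> \<A>" and W: "open W"
  shows "open (\<phi> ` (U \<inter> W))"
proof -
  note h = atlas_chart[OF \<A> c]
  have "openin (top_of_set (\<phi> ` U)) (\<phi> ` (U \<inter> W))"
    by (rule homeomorphism_imp_open_map[OF h(3)]) (use W in auto)
  then show ?thesis
    using h(2) by (simp add: openin_open_eq)
qed

lemma smooth_fun_const: "smooth_fun \<A> (\<lambda>_. c)"
  by (auto simp: smooth_fun_def o_def smooth_on_const)

lemma smooth_fun_compose:
  assumes "smooth_atlas \<A>" "smooth_fun \<A> f" "smooth_on UNIV \<psi>"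
  shows "smooth_fun \<A> (\<lambda>x. \<psi> (f x))"
  unfolding smooth_fun_def
proof safe
  fix U \<phi> assume c: "(U, \<phi>) \<in> \<A>"
  have "smooth_on (\<phi> ` U) (f \<circ> inv_into U \<phi>)"
    using assms(2) c by (auto simp: smooth_fun_def)
  then show "smooth_on (\<phi> ` U) ((\<lambda>x. \<psi> (f x)) \<circ> inv_into U \<phi>)"
    using Ck_on_compose[OF atlas_chart(2)[OF assms(1) c] assms(3)]
    by (auto simp: smooth_on_def o_def)
qed

lemma smooth_fun_continuous:
  fixes \<A> :: "('a::t2_space, 'e::euclidean_space) chart set"
  assumes \<A>: "smooth_atlas \<A>" and f: "smooth_fun \<A> f"
  shows "continuous_on UNIV f"
proof (intro continuous_at_imp_continuous_on ballI)
  fix x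
  obtain U \<phi> where c: "(U, \<phi>) \<in> \<A>" "x \<in> U" by (rule atlas_cover[OF \<A>])
  note h = atlas_chart[OF \<A> c(1)]
  have "Ck_on 0 (\<phi> ` U) (f \<circ> inv_into U \<phi>)"
    using f c unfolding smooth_fun_def smooth_on_def by blast
  then have "continuous_on (\<phi> ` U) (f \<circ> inv_into U \<phi>)" by simp
  moreover have "continuous_on U \<phi>" using h(3) by (simp add: homeomorphism_def)
  ultimately have "continuous_on U ((f \<circ> inv_into U \<phi>) \<circ> \<phi>)"
    using continuous_on_compose by blast
  then have "continuous_on U f"
    by (rule continuous_on_eq) (simp add: h(4))
  then show "isCont f x"
    using h(1) c(2) by (simp add: continuous_on_eq_continuous_at)
qed

lemma smooth_fun_chart_derivative:
  assumes \<A>: "smooth_atlas \<A>" and f: "smooth_fun \<A> f" and c: "(U, \<phi>) \<in> \<A>" "x \<in> U"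
  shows "(f \<circ> inv_into U \<phi> has_derivative frechet_derivative (f \<circ> inv_into U \<phi>) (at (\<phi> x))) (at (\<phi> x))"
proof -
  have "Ck_on (Suc 0) (\<phi> ` U) (f \<circ> inv_into U \<phi>)"
    using f c(1) unfolding smooth_fun_def smooth_on_def by blast
  then show ?thesis
    using c(2) by (auto simp: frechet_derivative_works[symmetric])
qed

lemma vector_field_chain:
  assumes \<A>: "smooth_atlas \<A>" and V: "smooth_vector_field \<A> V" and f: "smooth_fun \<A> f"
    and s: "smooth_on UNIV \<psi>" and d: "\<And>z. (\<psi> has_real_derivative \<psi>' z) (at z)"
  shows "V (\<lambda>x. \<psi> (f x)) x = \<psi>' (f x) * V f x"
proof -
  obtain U \<phi> where c: "(U, \<phi>) \<in> \<A>" "x \<in> U" by (rule atlas_cover[OF \<A>])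
  obtain a where a: "\<And>f. smooth_fun \<A> f \<Longrightarrow>
      V f x = frechet_derivative (f \<circ> inv_into U \<phi>) (at (\<phi> x)) (a (\<phi> x))"
    using V c unfolding smooth_vector_field_def by fast
  have D: "(\<psi> has_derivative (*) (\<psi>' ((f \<circ> inv_into U \<phi>) (\<phi> x)))) (at ((f \<circ> inv_into U \<phi>) (\<phi> x)))"
    using d by (simp add: has_field_derivative_def)
  have "((\<lambda>y. \<psi> ((f \<circ> inv_into U \<phi>) y)) has_derivative (\<lambda>v. \<psi>' (f x) *
      frechet_derivative (f \<circ> inv_into U \<phi>) (at (\<phi> x)) v)) (at (\<phi> x))"
    using has_derivative_compose[OF smooth_fun_chart_derivative[OF \<A> f c] D]
    by (simp add: atlas_chart(4)[OF \<A> c(1)] c(2))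
  from frechet_derivative_at[OF this] show ?thesis
    by (simp add: a f smooth_fun_compose[OF \<A> f s] o_def) metis
qed

text \<open>Off its closed support f vanishes near x, and a chart maps that neighbourhood to an open
  set, so the derivative in coordinates is the one of the zero function.\<close>

lemma vector_field_local:
  assumes \<A>: "smooth_atlas \<A>" and V: "smooth_vector_field \<A> V" and f: "smooth_fun \<A> f"
    and x: "x \<notin> closure {x. f x \<noteq> 0}"
  shows "V f x = 0"
proof -
  obtain U \<phi> where c: "(U, \<phi>) \<in> \<A>" "x \<in> U" by (rule atlas_cover[OF \<A>])
  obtain a where a: "\<And>f. smooth_fun \<A> f \<Longrightarrow>
      V f x = frechet_derivative (f \<circ> inv_into U \<phi>) (at (\<phi> x)) (a (\<phi> x))"
    using V c unfolding smooth_vector_field_def by fast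
  let ?W = "\<phi> ` (U \<inter> - closure {x. f x \<noteq> 0})"
  have W: "open ?W" by (rule open_chart_image[OF \<A> c(1)]) auto
  have "((\<lambda>_. 0) has_derivative (\<lambda>_. 0)) (at (\<phi> x))" by simp
  then have "(f \<circ> inv_into U \<phi> has_derivative (\<lambda>_. 0)) (at (\<phi> x))"
  proof (rule has_derivative_transform_within_open[OF _ W])
    show "\<phi> x \<in> ?W" using x c by auto
    show "0 = (f \<circ> inv_into U \<phi>) y" if "y \<in> ?W" for y
      using that closure_subset[of "{x. f x \<noteq> 0}"] by (auto simp: atlas_chart(4)[OF \<A> c(1)])
  qed
  from frechet_derivative_at[OF this] show ?thesis
    by (simp add: a f) metis
qed

section \<open>The algebra of smooth functions with compact support\<close>

text \<open>Any compact set off which f vanishes will do: in a Hausdorff space it is closed, so it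
  contains the closure of the set where f is nonzero.\<close>

lemma test_functionsI:
  fixes f :: "'a::t2_space \<Rightarrow> real"
  assumes "smooth_fun \<A> f" "compact K" "\<And>x. x \<notin> K \<Longrightarrow> f x = 0"
  shows "f \<in> test_functions \<A>"
proof -
  have "closure {x. f x \<noteq> 0} \<subseteq> K"
    by (rule closure_minimal) (use assms compact_imp_closed in auto)
  then have "compact (closure {x. f x \<noteq> 0})"
    using compact_Int_closed[OF assms(2) closed_closure, of "{x. f x \<noteq> 0}"] by (simp add: Int_absorb1)
  then show ?thesis
    using assms(1) by (simp add: test_functions_def)
qed

lemma test_functionsD:
  assumes "f \<in> test_functions \<A>"
  shows "smooth_fun \<A> f" "compact (closure {x. f x \<noteq> 0})"
  using assms by (auto simp: test_functions_def)

lemma test_functions_support: "f x \<noteq> 0 \<Longrightarrow> x \<in> closure {x. f x \<noteq> 0}"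
  using closure_subset[of "{x. f x \<noteq> 0}"] by auto

lemma test_functions_add:
  fixes f g :: "'a::t2_space \<Rightarrow> real"
  assumes "smooth_atlas \<A>" "f \<in> test_functions \<A>" "g \<in> test_functions \<A>"
  shows "(\<lambda>x. f x + g x) \<in> test_functions \<A>"
proof (rule test_functionsI[of _ _ "closure {x. f x \<noteq> 0} \<union> closure {x. g x \<noteq> 0}"])
  show "f x + g x = 0" if "x \<notin> closure {x. f x \<noteq> 0} \<union> closure {x. g x \<noteq> 0}" for x
    using that test_functions_support[of f x] test_functions_support[of g x]
    by (metis (lifting) UnCI add.right_neutral)
qed (use assms in \<open>auto simp: test_functionsD intro: smooth_fun_add compact_Un\<close>)

lemma test_functions_mult:
  fixes f g :: "'a::t2_space \<Rightarrow> real"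
  assumes "smooth_atlas \<A>" "f \<in> test_functions \<A>" "smooth_fun \<A> g"
  shows "(\<lambda>x. f x * g x) \<in> test_functions \<A>"
proof (rule test_functionsI[of _ _ "closure {x. f x \<noteq> 0}"])
  show "f x * g x = 0" if "x \<notin> closure {x. f x \<noteq> 0}" for x
    using that test_functions_support[of f x] by auto
qed (use assms in \<open>auto simp: test_functionsD intro: smooth_fun_mult\<close>)

lemma test_functions_compose:
  fixes f :: "'a::t2_space \<Rightarrow> real"
  assumes "smooth_atlas \<A>" "f \<in> test_functions \<A>" "smooth_on UNIV \<psi>" "\<psi> 0 = 0"
  shows "(\<lambda>x. \<psi> (f x)) \<in> test_functions \<A>"
proof (rule test_functionsI[of _ _ "closure {x. f x \<noteq> 0}"])
  show "\<psi> (f x) = 0" if "x \<notin> closure {x. f x \<noteq> 0}" for x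
    using that test_functions_support[of f x] assms(4) by metis
qed (use assms in \<open>auto simp: test_functionsD intro: smooth_fun_compose\<close>)

lemma test_functions_cmult:
  fixes f :: "'a::t2_space \<Rightarrow> real"
  assumes "smooth_atlas \<A>" "f \<in> test_functions \<A>"
  shows "(\<lambda>x. c * f x) \<in> test_functions \<A>"
  using test_functions_mult[OF assms smooth_fun_const[of _ c]] by (simp add: mult.commute)

lemma test_functions_zero: "(\<lambda>_. 0) \<in> test_functions \<A>"
  by (simp add: test_functions_def smooth_fun_const)

lemma test_functions_sum:
  fixes f :: "'i \<Rightarrow> 'a::t2_space \<Rightarrow> real"
  assumes "smooth_atlas \<A>" "finite I" "\<And>i. i \<in> I \<Longrightarrow> f i \<in> test_functions \<A>"
  shows "(\<lambda>x. \<Sum>i\<in>I. f i x) \<in> test_functions \<A>"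
  using assms(2,3)
  by (induction I rule: finite_induct) (auto intro: test_functions_zero test_functions_add[OF assms(1)])

section \<open>Bump functions and cutoffs\<close>

text \<open>The flat function of r^2 - |\<phi>(y) - \<phi>(x)|^2 inside one chart, extended by 0.
  Smoothness across the boundary of the chart domain is the point: the preimage \<open>K\<close> of
  the closed ball is compact, hence closed in the manifold, so \<open>U\<close> and the complement
  of \<open>K\<close> are two open sets covering everything, with the function zero on the
  second.\<close>

lemma exists_bump:
  fixes \<A> :: "('a::t2_space, 'e::euclidean_space) chart set"
  assumes \<A>: "smooth_atlas \<A>"
  obtains b where "b \<in> test_functions \<A>" "b x > 0" "\<And>y. b y \<ge> 0"
proof -
  obtain U \<phi> where c: "(U, \<phi>) \<in> \<A>" "x \<in> U" by (rule atlas_cover[OF \<A>])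
  note h = atlas_chart[OF \<A> c(1)]
  obtain r where r: "r > 0" "cball (\<phi> x) r \<subseteq> \<phi> ` U"
    using h(2) c(2) by (meson imageI open_contains_cball)
  define K where "K = inv_into U \<phi> ` cball (\<phi> x) r"
  have K: "compact K"
    unfolding K_def using h(3) r(2)
    by (intro compact_continuous_image) (auto simp: homeomorphism_def intro: continuous_on_subset)
  have KU: "K \<subseteq> U"
    unfolding K_def using r(2) by (auto intro: inv_into_into)
  define b where "b y = (if y \<in> U then flat_exp 0 (r\<^sup>2 - (norm (\<phi> y - \<phi> x))\<^sup>2) else 0)" for y
  have b0: "b y = 0" if "y \<notin> K" for y
  proof (rule ccontr)
    assume "b y \<noteq> 0"
    then have y: "y \<in> U" "(norm (\<phi> y - \<phi> x))\<^sup>2 < r\<^sup>2"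
      by (auto simp: b_def flat_exp_def split: if_splits)
    then have "norm (\<phi> y - \<phi> x) < r"
      using r(1) by (simp add: power2_less_imp_less)
    then have "\<phi> y \<in> cball (\<phi> x) r"
      by (simp add: dist_norm norm_minus_commute)
    then have "y \<in> K"
      unfolding K_def using h(4)[OF y(1)] by (metis imageI)
    with that show False by simp
  qed
  have "smooth_fun \<A> b"
    unfolding smooth_fun_def
  proof safe
    fix W \<psi> assume d: "(W, \<psi>) \<in> \<A>"
    note g = atlas_chart[OF \<A> d]
    have o: "open (\<psi> ` (W \<inter> U))" "open (\<psi> ` (W \<inter> - K))"
      using compact_imp_closed[OF K] h(1) by (auto intro!: open_chart_image[OF \<A> d])
    have nrm: "(norm v)\<^sup>2 = (\<Sum>e\<in>Basis. (v \<bullet> e) * (v \<bullet> e))" for v :: 'e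
      using euclidean_inner[of v v] by (simp add: power2_norm_eq_inner)
    let ?T = "\<phi> \<circ> inv_into W \<psi>"
    \<comment> \<open>The squared distance is expanded in coordinates, with differences written as
      sums, to fit the rules for sums, products and components of C^k functions.\<close>
    let ?q = "\<lambda>z. r\<^sup>2 + (\<Sum>e\<in>Basis. (- 1) * ((?T z \<bullet> e + - (\<phi> x \<bullet> e)) * (?T z \<bullet> e + - (\<phi> x \<bullet> e))))"
    have T: "smooth_on (\<psi> ` (W \<inter> U)) ?T"
      using \<A> c(1) d unfolding smooth_atlas_def by fast
    have "Ck_on k (\<psi> ` (W \<inter> U)) (\<lambda>z. flat_exp 0 (?q z))" for k
    proof (rule Ck_on_compose[OF o(1) smooth_on_flat_exp])
      have "Ck_on k (\<psi> ` (W \<inter> U)) ?T" using T by (simp add: smooth_on_def)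
      note Ti = Ck_on_add[OF o(1) Ck_on_inner[OF o(1) this] Ck_on_const]
      show "Ck_on k (\<psi> ` (W \<inter> U)) ?q"
        by (rule Ck_on_add[OF o(1) Ck_on_const Ck_on_sum[OF o(1) finite_Basis
              Ck_on_mult[OF o(1) Ck_on_const Ck_on_mult[OF o(1) Ti Ti]]]])
    qed
    moreover have "flat_exp 0 (?q z) = (b \<circ> inv_into W \<psi>) z" if "z \<in> \<psi> ` (W \<inter> U)" for z
    proof -
      have "?q z = r\<^sup>2 - (norm (?T z - \<phi> x))\<^sup>2"
        unfolding nrm by (simp add: sum_negf inner_diff_left)
      then show ?thesis using that by (auto simp: b_def g(4))
    qed
    ultimately have 1: "smooth_on (\<psi> ` (W \<inter> U)) (b \<circ> inv_into W \<psi>)"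
      unfolding smooth_on_def using Ck_on_cong[OF o(1)] by blast
    have 2: "smooth_on (\<psi> ` (W \<inter> - K)) (b \<circ> inv_into W \<psi>)"
      by (rule smooth_on_cong[OF o(2) smooth_on_const[of _ 0]]) (auto simp: g(4) b0)
    have "\<psi> ` (W \<inter> U) \<union> \<psi> ` (W \<inter> - K) = \<psi> ` W"
      using KU by auto
    then show "smooth_on (\<psi> ` W) (b \<circ> inv_into W \<psi>)"
      using smooth_on_Un[OF o 1 2] by simp
  qed
  then have "b \<in> test_functions \<A>"
    using K b0 by (rule test_functionsI)
  moreover have "b x > 0"
    using c(2) r(1) by (simp add: b_def flat_exp_def)
  moreover have "b y \<ge> 0" for y
    by (simp add: b_def flat_exp_def)
  ultimately show ?thesis using that by blast
qed

text \<open>A finite sum of bumps over a subcover, with c its minimum on K. The normalisation to the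
  value 1 is left to \<open>exists_flat_cutoff\<close>.\<close>

lemma exists_cutoff:
  fixes \<A> :: "('a::t2_space, 'e::euclidean_space) chart set"
  assumes \<A>: "smooth_atlas \<A>" and K: "compact K"
  obtains S c where "S \<in> test_functions \<A>" "c > 0" "\<And>x. x \<in> K \<Longrightarrow> S x \<ge> c"
proof (cases "K = {}")
  case True
  then show ?thesis using that[OF test_functions_zero[of \<A>], of 1] by simp
next
  case False
  have "\<exists>b. b \<in> test_functions \<A> \<and> b x > 0 \<and> (\<forall>y. b y \<ge> 0)" for x
    using exists_bump[OF \<A>, of x] by metis
  then obtain b where b: "\<And>x. b x \<in> test_functions \<A>" "\<And>x. b x x > 0" "\<And>x y. b x y \<ge> 0"
    by metis
  have cont: "continuous_on UNIV (b x)" for x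
    by (rule smooth_fun_continuous[OF \<A> test_functionsD(1)[OF b(1)]])
  have "open {y. b x y > 0}" for x
    using open_Collect_less[OF continuous_on_const cont] by simp
  then obtain I where I: "I \<subseteq> K" "finite I" "K \<subseteq> (\<Union>x\<in>I. {y. b x y > 0})"
    by (rule compactE_image[OF K, of K "\<lambda>x. {y. b x y > 0}"]) (use b(2) in auto)
  define S where "S y = (\<Sum>x\<in>I. b x y)" for y
  have S: "S \<in> test_functions \<A>"
    unfolding S_def[abs_def] by (rule test_functions_sum[OF \<A> I(2) b(1)])
  obtain z where z: "z \<in> K" "\<And>y. y \<in> K \<Longrightarrow> S z \<le> S y"
    using continuous_attains_inf[OF K False continuous_on_subset[OF smooth_fun_continuous[OF \<A> test_functionsD(1)[OF S]]]]
    by auto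
  obtain x where "x \<in> I" "b x z > 0"
    using I(3) z(1) by auto
  then have "S z > 0"
    unfolding S_def using I(2) b(3) by (intro sum_pos2) auto
  then show ?thesis using that[OF S] z(2) by blast
qed

section \<open>Symmetric semigroups with a diffusion core\<close>

lemma Lp2_iff: "f \<in> Lp 2 M \<longleftrightarrow> f \<in> borel_measurable M \<and> integrable M (\<lambda>x. (f x)\<^sup>2)"
  by (simp add: Lp_def)

text \<open>The common core of the Cauchy-Schwarz inequalities for L^2 and for the energy form. Both
  may degenerate, so c = 0 has to be allowed.\<close>

lemma quadratic_discriminant:
  fixes a b c :: real
  assumes "\<And>t. 0 \<le> a + 2 * b * t + c * t\<^sup>2"
  shows "b\<^sup>2 \<le> a * c"
proof (cases "c = 0")
  case True
  have "b = 0"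
  proof (rule ccontr)
    assume "b \<noteq> 0"
    then show False
      using assms[of "- (a + 1) / (2 * b)"] True by simp
  qed
  then show ?thesis using True by simp
next
  case False
  have "c > 0"
  proof (rule ccontr)
    assume "\<not> c > 0"
    with False have c: "c < 0" by simp
    \<comment> \<open>For c < 0 this t is at least 1 and makes - c t exceed |a| + 2 |b| + 1, so the
      quadratic term beats the other two.\<close>
    define t where "t = (\<bar>a\<bar> + 2 * \<bar>b\<bar> + 1) / (- c) + 1"
    have "(\<bar>a\<bar> + 2 * \<bar>b\<bar> + 1) / (- c) \<ge> 0"
      by (intro divide_nonneg_pos) (use c in auto)
    then have t1: "t \<ge> 1" by (simp add: t_def)
    have "- c * t \<ge> \<bar>a\<bar> + 2 * \<bar>b\<bar> + 1"
      using c by (simp add: t_def field_simps)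
    then have "(\<bar>a\<bar> + 2 * \<bar>b\<bar> + 1) * t \<le> - c * t * t"
      using t1 by (intro mult_right_mono) auto
    moreover have "\<bar>a\<bar> + 1 \<le> (\<bar>a\<bar> + 1) * t" using t1 by (simp add: mult_le_cancel_left1)
    moreover have "b * t \<le> \<bar>b\<bar> * t" using t1 by (intro mult_right_mono) auto
    ultimately have "a + 2 * b * t + c * t\<^sup>2 < 0"
      by (simp add: power2_eq_square algebra_simps)
    with assms[of t] show False by simp
  qed
  then show ?thesis
    using assms[of "- b / c"] by (simp add: field_simps power2_eq_square)
qed

lemma Lp2_integrable_mult:
  assumes "f \<in> Lp 2 M" "g \<in> Lp 2 M"
  shows "integrable M (\<lambda>x. f x * g x)"
proof (rule Bochner_Integration.integrable_bound[of _ "\<lambda>x. (f x)\<^sup>2 + (g x)\<^sup>2"])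
  show "AE x in M. norm (f x * g x) \<le> norm ((f x)\<^sup>2 + (g x)\<^sup>2)"
  proof (rule AE_I2)
    fix x
    have "0 \<le> (\<bar>f x\<bar> - \<bar>g x\<bar>)\<^sup>2" by simp
    then have "2 * \<bar>f x * g x\<bar> \<le> (f x)\<^sup>2 + (g x)\<^sup>2" by (simp add: power2_diff abs_mult)
    then show "norm (f x * g x) \<le> norm ((f x)\<^sup>2 + (g x)\<^sup>2)" by simp
  qed
qed (use assms in \<open>auto simp: Lp2_iff\<close>)

lemma Lp2_lincomb:
  assumes "f \<in> Lp 2 M" "g \<in> Lp 2 M"
  shows "(\<lambda>x. a * f x + b * g x) \<in> Lp 2 M"
proof -
  have "integrable M (\<lambda>x. a\<^sup>2 * (f x)\<^sup>2 + 2 * a * b * (f x * g x) + b\<^sup>2 * (g x)\<^sup>2)"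
    using assms Lp2_integrable_mult[OF assms] by (auto simp: Lp2_iff)
  moreover have "(\<lambda>x. a\<^sup>2 * (f x)\<^sup>2 + 2 * a * b * (f x * g x) + b\<^sup>2 * (g x)\<^sup>2) = (\<lambda>x. (a * f x + b * g x)\<^sup>2)"
    by (auto simp: power2_eq_square algebra_simps)
  moreover have "(\<lambda>x. a * f x + b * g x) \<in> borel_measurable M"
    using assms unfolding Lp2_iff by (intro borel_measurable_add borel_measurable_times) auto
  ultimately show ?thesis
    by (simp add: Lp2_iff)
qed

lemma Lp2_diff: "f \<in> Lp 2 M \<Longrightarrow> g \<in> Lp 2 M \<Longrightarrow> (\<lambda>x. f x - g x) \<in> Lp 2 M"
  using Lp2_lincomb[of f M g 1 "-1"] by simp

lemma Lp2_Cauchy_Schwarz: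
  assumes "f \<in> Lp 2 M" "g \<in> Lp 2 M"
  shows "\<bar>LINT x|M. f x * g x\<bar> \<le> sqrt (LINT x|M. (f x)\<^sup>2) * sqrt (LINT x|M. (g x)\<^sup>2)"
proof -
  have "(LINT x|M. f x * g x)\<^sup>2 \<le> (LINT x|M. (f x)\<^sup>2) * (LINT x|M. (g x)\<^sup>2)"
  proof (rule quadratic_discriminant)
    fix t
    have "0 \<le> (LINT x|M. (f x + t * g x)\<^sup>2)" by simp
    also have "(\<lambda>x. (f x + t * g x)\<^sup>2) = (\<lambda>x. (f x)\<^sup>2 + (2 * t * (f x * g x) + t\<^sup>2 * (g x)\<^sup>2))"
      by (auto simp: power2_eq_square algebra_simps)
    also have "(LINT x|M. (f x)\<^sup>2 + (2 * t * (f x * g x) + t\<^sup>2 * (g x)\<^sup>2)) =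
        (LINT x|M. (f x)\<^sup>2) + (2 * t * (LINT x|M. f x * g x) + t\<^sup>2 * (LINT x|M. (g x)\<^sup>2))"
      using assms Lp2_integrable_mult[OF assms] by (simp add: Lp2_iff)
    finally show "0 \<le> (LINT x|M. (f x)\<^sup>2) + 2 * (LINT x|M. f x * g x) * t + (LINT x|M. (g x)\<^sup>2) * t\<^sup>2"
      by (simp add: algebra_simps)
  qed
  from real_sqrt_le_mono[OF this] show ?thesis
    by (simp add: real_sqrt_mult)
qed

lemma Lp2_bounded_support:
  assumes "f \<in> borel_measurable M" "\<And>x. \<bar>f x\<bar> \<le> C" "A \<in> sets M" "emeasure M A < \<infinity>"
    "\<And>x. x \<in> space M \<Longrightarrow> x \<notin> A \<Longrightarrow> f x = 0"
  shows "f \<in> Lp 2 M"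
proof -
  have "integrable M (\<lambda>x. indicator A x * C\<^sup>2)"
    using assms(3,4) by auto
  then have "integrable M (\<lambda>x. (f x)\<^sup>2)"
  proof (rule Bochner_Integration.integrable_bound)
    have "(f x)\<^sup>2 \<le> C\<^sup>2" for x using assms(2)[of x] by (simp add: abs_le_square_iff[symmetric])
    then show "AE x in M. norm ((f x)\<^sup>2) \<le> norm (indicator A x * C\<^sup>2)"
      using assms(5) by (intro AE_I2) (auto split: split_indicator)
  qed (use assms(1) in auto)
  then show ?thesis using assms(1) by (simp add: Lp2_iff)
qed

section \<open>Semigroup estimates over an abstract core of test functions\<close>

text \<open>A pair z is read as starting point and end point of the heat flow, so this is the
  increment of f along it.\<close>

abbreviation jump :: "('a \<Rightarrow> real) \<Rightarrow> 'a \<times> 'a \<Rightarrow> real" where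
  "jump f z \<equiv> f (snd z) - f (fst z)"

text \<open>What the probabilistic argument needs of the geometry, without manifolds: a class D
  stable under \<open>L\<close>, \<Gamma> and smooth functions vanishing at 0, on which
  \<open>L\<close> is contained in the generator and satisfies the second-order chain rule. That
  chain rule expresses that the process has no jumps. Here \<Gamma> takes a single argument and
  stands for the quadratic \<Gamma>(f,f).\<close>

locale diffusion_semigroup =
  fixes M :: "'a::{t2_space,second_countable_topology} measure"
    and D :: "('a \<Rightarrow> real) set"
    and L \<Gamma> :: "('a \<Rightarrow> real) \<Rightarrow> 'a \<Rightarrow> real"
    and P :: "real \<Rightarrow> ('a \<Rightarrow> real) \<Rightarrow> 'a \<Rightarrow> real"
    and k :: "real \<Rightarrow> 'a \<Rightarrow> 'a measure"
  assumes sets_M: "sets M = sets borel"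
    and sigma_finite: "sigma_finite_measure M"
    and D_continuous: "\<And>f. f \<in> D \<Longrightarrow> continuous_on UNIV f"
    and D_bounded: "\<And>f. f \<in> D \<Longrightarrow> \<exists>C. \<forall>x. \<bar>f x\<bar> \<le> C"
    and D_support: "\<And>f. f \<in> D \<Longrightarrow> \<exists>A\<in>sets borel. emeasure M A < \<infinity> \<and> (\<forall>x. x \<notin> A \<longrightarrow> f x = 0 \<and> \<Gamma> f x = 0)"
    and D_L: "\<And>f. f \<in> D \<Longrightarrow> L f \<in> D"
    and D_\<Gamma>: "\<And>f. f \<in> D \<Longrightarrow> \<Gamma> f \<in> D"
    and \<Gamma>_nonneg: "\<And>f x. f \<in> D \<Longrightarrow> \<Gamma> f x \<ge> 0"
    and D_compose: "\<And>f \<psi>. f \<in> D \<Longrightarrow> smooth_on UNIV \<psi> \<Longrightarrow> \<psi> 0 = 0 \<Longrightarrow> (\<lambda>x. \<psi> (f x)) \<in> D"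
    and L_compose: "\<And>f \<psi> \<psi>' \<psi>''. f \<in> D \<Longrightarrow> smooth_on UNIV \<psi> \<Longrightarrow> \<psi> 0 = 0 \<Longrightarrow>
        (\<And>z. (\<psi> has_real_derivative \<psi>' z) (at z)) \<Longrightarrow> (\<And>z. (\<psi>' has_real_derivative \<psi>'' z) (at z)) \<Longrightarrow>
        L (\<lambda>x. \<psi> (f x)) = (\<lambda>x. \<psi>' (f x) * L f x + \<psi>'' (f x) * \<Gamma> f x)"
    and generator: "\<And>f. f \<in> D \<Longrightarrow> (f, L f) \<in> semigroup_generator M P"
    and markov: "symmetric_markov_semigroup M P"
    and kernel: "heat_kernel M P k"
begin

lemma measurable_M[simp]: "borel_measurable M = borel_measurable borel"
  using sets_M by (auto simp: measurable_def sets_eq_imp_space_eq[OF sets_M])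

lemma space_M: "space M = UNIV"
  using sets_eq_imp_space_eq[OF sets_M] by simp

lemma D_measurable: "f \<in> D \<Longrightarrow> f \<in> borel_measurable borel"
  using D_continuous by (rule borel_measurable_continuous_onI)

lemma D_L2: assumes "f \<in> D" shows "f \<in> Lp 2 M"
proof -
  obtain C where "\<And>x. \<bar>f x\<bar> \<le> C" using D_bounded[OF assms] by blast
  moreover obtain A where "A \<in> sets borel" "emeasure M A < \<infinity>" "\<And>x. x \<notin> A \<Longrightarrow> f x = 0"
    using D_support[OF assms] by blast
  ultimately show ?thesis
    using D_measurable[OF assms] by (intro Lp2_bounded_support[of f M C A]) (auto simp: sets_M)
qed

lemma P_Lp2: "s \<ge> 0 \<Longrightarrow> f \<in> Lp 2 M \<Longrightarrow> P s f \<in> Lp 2 M"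
  and P_linear: "s \<ge> 0 \<Longrightarrow> f \<in> Lp 2 M \<Longrightarrow> g \<in> Lp 2 M \<Longrightarrow>
    AE x in M. P s (\<lambda>y. a * f y + b * g y) x = a * P s f x + b * P s g x"
  and P_contraction: "s \<ge> 0 \<Longrightarrow> f \<in> Lp 2 M \<Longrightarrow> (LINT x|M. (P s f x)\<^sup>2) \<le> (LINT x|M. (f x)\<^sup>2)"
  and P_symmetric: "s \<ge> 0 \<Longrightarrow> f \<in> Lp 2 M \<Longrightarrow> g \<in> Lp 2 M \<Longrightarrow> (LINT x|M. P s f x * g x) = (LINT x|M. f x * P s g x)"
  and P_0: "f \<in> Lp 2 M \<Longrightarrow> AE x in M. P 0 f x = f x"
  and P_add: "s \<ge> 0 \<Longrightarrow> t \<ge> 0 \<Longrightarrow> f \<in> Lp 2 M \<Longrightarrow> AE x in M. P (s + t) f x = P s (P t f) x"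
  and P_continuous: "f \<in> Lp 2 M \<Longrightarrow> L2_tendsto M (\<lambda>t. P t f) f (at_right 0)"
proof (goal_cases)
  note m = markov[unfolded symmetric_markov_semigroup_def]
  { case 1 then show ?case by (rule m[THEN conjunct1, rule_format]) }
  { case 2 then show ?case by (rule m[THEN conjunct2, THEN conjunct1, rule_format]) }
  { case 3 then show ?case by (rule m[THEN conjunct2, THEN conjunct2, THEN conjunct1, rule_format]) }
  { case 4 then show ?case by (rule m[THEN conjunct2, THEN conjunct2, THEN conjunct2, THEN conjunct1, rule_format]) }
  { case 5 then show ?case by (rule m[THEN conjunct2, THEN conjunct2, THEN conjunct2, THEN conjunct2, THEN conjunct2, THEN conjunct1, rule_format]) }
  { case 6 then show ?case by (rule m[THEN conjunct2, THEN conjunct2, THEN conjunct2, THEN conjunct2, THEN conjunct2, THEN conjunct2, THEN conjunct1, rule_format]) }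
  { case 7 then show ?case by (rule m[THEN conjunct2, THEN conjunct2, THEN conjunct2, THEN conjunct2, THEN conjunct2, THEN conjunct2, THEN conjunct2, rule_format]) }
qed

lemma generator_remainder:
  assumes "g \<in> D" "\<epsilon> > 0"
  shows "\<exists>\<delta>>0. \<forall>h. 0 < h \<longrightarrow> h \<le> \<delta> \<longrightarrow> sqrt (LINT x|M. (P h g x - g x - h * L g x)\<^sup>2) \<le> \<epsilon> * h"
proof -
  have "((\<lambda>h. LINT x|M. ((P h g x - g x) / h - L g x)\<^sup>2) \<longlongrightarrow> 0) (at_right 0)"
    using generator[OF assms(1)] by (simp add: semigroup_generator_def L2_tendsto_def)
  then have "eventually (\<lambda>h. (LINT x|M. ((P h g x - g x) / h - L g x)\<^sup>2) < \<epsilon>\<^sup>2) (at_right 0)"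
    using assms(2) by (intro order_tendstoD) auto
  then obtain \<delta> where d: "\<delta> > 0" "\<And>h. 0 < h \<Longrightarrow> h < \<delta> \<Longrightarrow> (LINT x|M. ((P h g x - g x) / h - L g x)\<^sup>2) < \<epsilon>\<^sup>2"
    unfolding eventually_at_right_field by auto
  have "sqrt (LINT x|M. (P h g x - g x - h * L g x)\<^sup>2) \<le> \<epsilon> * h" if h: "0 < h" "h \<le> \<delta> / 2" for h
  proof -
    have "(P h g x - g x - h * L g x)\<^sup>2 = h\<^sup>2 * ((P h g x - g x) / h - L g x)\<^sup>2" for x
      using h by (simp add: power_mult_distrib[symmetric] field_simps)
    then have "(LINT x|M. (P h g x - g x - h * L g x)\<^sup>2) = h\<^sup>2 * (LINT x|M. ((P h g x - g x) / h - L g x)\<^sup>2)"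
      by simp
    also have "\<dots> \<le> h\<^sup>2 * \<epsilon>\<^sup>2"
      using d h by (intro mult_left_mono less_imp_le[OF d(2)]) auto
    also have "\<dots> = (\<epsilon> * h)\<^sup>2" by (simp add: power_mult_distrib)
    finally show ?thesis
      using h assms(2) by (intro real_le_lsqrt) auto
  qed
  then show ?thesis using d(1) by (intro exI[of _ "\<delta> / 2"]) auto
qed

text \<open>\<open>P s\<close> is applied to the remainder of the generator at time 0. Contraction
  carries the bound to every s with the same \<delta>, and pairing with a costs only its L^2 norm.
  Uniformity in s and a is what the later arguments rest on.\<close>

lemma dynkin_remainder_L2:
  assumes g: "g \<in> D" and e: "\<epsilon> > 0"
  shows "\<exists>\<delta>>0. \<forall>s h a. 0 \<le> s \<longrightarrow> 0 < h \<longrightarrow> h \<le> \<delta> \<longrightarrow> a \<in> Lp 2 M \<longrightarrow>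
    \<bar>(LINT x|M. a x * P (s + h) g x) - (LINT x|M. a x * P s g x) - h * (LINT x|M. a x * P s (L g) x)\<bar>
      \<le> \<epsilon> * h * sqrt (LINT x|M. (a x)\<^sup>2)"
proof -
  obtain \<delta> where d: "\<delta> > 0" "\<And>h. 0 < h \<Longrightarrow> h \<le> \<delta> \<Longrightarrow>
      sqrt (LINT x|M. (P h g x - g x - h * L g x)\<^sup>2) \<le> \<epsilon> * h"
    using generator_remainder[OF g e] by blast
  have "\<bar>(LINT x|M. a x * P (s + h) g x) - (LINT x|M. a x * P s g x) - h * (LINT x|M. a x * P s (L g) x)\<bar>
      \<le> \<epsilon> * h * sqrt (LINT x|M. (a x)\<^sup>2)" if s: "0 \<le> s" and h: "0 < h" "h \<le> \<delta>" and a: "a \<in> Lp 2 M" for s h a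
  proof -
    note gL = D_L2[OF g] and LL = D_L2[OF D_L[OF g]]
    have Ph: "P h g \<in> Lp 2 M" using P_Lp2 gL h by simp
    \<comment> \<open>The remainder is assembled in two steps, with explicit coefficients, in the
      shape of the almost everywhere linearity of \<open>P s\<close>.\<close>
    define u where "u = (\<lambda>y. 1 * P h g y + (- 1) * g y)"
    define r where "r = (\<lambda>y. 1 * u y + (- h) * L g y)"
    have u: "u \<in> Lp 2 M" unfolding u_def by (rule Lp2_lincomb[OF Ph gL])
    have r: "r \<in> Lp 2 M" unfolding r_def by (rule Lp2_lincomb[OF u LL])
    have "AE x in M. P s r x = P (s + h) g x - P s g x - h * P s (L g) x"
      using P_linear[OF s u LL, of 1 "- h", folded r_def] P_linear[OF s Ph gL, of 1 "- 1", folded u_def]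
        P_add[OF s less_imp_le[OF h(1)] gL]
      by eventually_elim simp
    then have "(LINT x|M. a x * P s r x) = (LINT x|M. a x * (P (s + h) g x - P s g x - h * P s (L g) x))"
      using a P_Lp2[OF s r] P_Lp2[OF s gL] P_Lp2[OF s LL] P_Lp2[OF add_nonneg_nonneg[OF s less_imp_le[OF h(1)]] gL]
      unfolding Lp2_iff
      by (intro integral_cong_AE borel_measurable_times borel_measurable_diff borel_measurable_const) auto
    also have "\<dots> = (LINT x|M. (a x * P (s + h) g x - a x * P s g x) - h * (a x * P s (L g) x))"
      by (simp add: algebra_simps)
    also have "\<dots> = (LINT x|M. a x * P (s + h) g x) - (LINT x|M. a x * P s g x) - h * (LINT x|M. a x * P s (L g) x)"
      using Lp2_integrable_mult[OF a P_Lp2] s h gL LL by simp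
    finally have "\<bar>(LINT x|M. a x * P (s + h) g x) - (LINT x|M. a x * P s g x) - h * (LINT x|M. a x * P s (L g) x)\<bar>
      = \<bar>LINT x|M. a x * P s r x\<bar>" by simp
    also have "\<dots> \<le> sqrt (LINT x|M. (a x)\<^sup>2) * sqrt (LINT x|M. (P s r x)\<^sup>2)"
      by (rule Lp2_Cauchy_Schwarz[OF a P_Lp2[OF s r]])
    also have "\<dots> \<le> sqrt (LINT x|M. (a x)\<^sup>2) * sqrt (LINT x|M. (r x)\<^sup>2)"
      by (intro mult_left_mono real_sqrt_le_mono P_contraction s r) simp
    also have "\<dots> \<le> sqrt (LINT x|M. (a x)\<^sup>2) * (\<epsilon> * h)"
      using d(2)[OF h] by (intro mult_left_mono) (simp_all add: r_def u_def)
    finally show ?thesis by (simp add: mult.commute)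
  qed
  then show ?thesis using d(1) by blast
qed

text \<open>A heat kernel is prescribed only for positive times; the Dirac kernel at time 0 puts the
  initial law on the diagonal and allows Dynkin's formula to start there.\<close>

definition \<kappa> :: "real \<Rightarrow> 'a \<Rightarrow> 'a measure" where
  "\<kappa> s x = (if s = 0 then return borel x else k s x)"

lemma \<kappa>_measurable: "s \<ge> 0 \<Longrightarrow> \<kappa> s \<in> borel \<rightarrow>\<^sub>M prob_algebra borel"
  using kernel measurable_return_prob_space[of borel]
  by (cases "s = 0") (auto simp: \<kappa>_def[abs_def] heat_kernel_def)

lemma \<kappa>_in_prob_algebra: "s \<ge> 0 \<Longrightarrow> \<kappa> s x \<in> space (prob_algebra borel)"
  using measurable_space[OF \<kappa>_measurable] by simp

lemma \<kappa>_prob: "s \<ge> 0 \<Longrightarrow> prob_space (\<kappa> s x)"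
  using \<kappa>_in_prob_algebra[of s x] by (simp add: space_prob_algebra)

lemma \<kappa>_sets: "s \<ge> 0 \<Longrightarrow> sets (\<kappa> s x) = sets borel"
  using \<kappa>_in_prob_algebra[of s x] by (simp add: space_prob_algebra)

lemma \<kappa>_semigroup:
  assumes "s \<ge> 0" "f \<in> Lp 2 M"
  shows "AE x in M. P s f x = (LINT y|\<kappa> s x. f y)"
proof (cases "s = 0")
  case True
  have "f \<in> borel_measurable borel" using assms(2) by (simp add: Lp2_iff)
  then show ?thesis
    by - (rule AE_mp[OF P_0[OF assms(2)] AE_I2], simp add: True \<kappa>_def integral_return)
next
  case False
  then show ?thesis
    using assms
    by - (rule AE_mp[OF kernel[unfolded heat_kernel_def, THEN conjunct2, rule_format, of s f] AE_I2], simp_all add: \<kappa>_def)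
qed

end

section \<open>The joint law of a point and its heat flow\<close>

text \<open>These functions are integrable for every probability law on the Borel sets, and closure
  rules turn all integrability questions below into structural ones.\<close>

definition bdd_borel :: "('b::topological_space \<Rightarrow> real) \<Rightarrow> bool" where
  "bdd_borel F \<longleftrightarrow> F \<in> borel_measurable borel \<and> (\<exists>C. \<forall>z. \<bar>F z\<bar> \<le> C)"

lemma bdd_borelI: "F \<in> borel_measurable borel \<Longrightarrow> (\<And>z. \<bar>F z\<bar> \<le> C) \<Longrightarrow> bdd_borel F"
  unfolding bdd_borel_def by blast

lemma bdd_borel_measurable: "bdd_borel F \<Longrightarrow> F \<in> borel_measurable borel"
  unfolding bdd_borel_def by blast

lemma bdd_borelE: assumes "bdd_borel F" obtains C where "C \<ge> 0" "\<And>z. \<bar>F z\<bar> \<le> C"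
proof -
  obtain C where "\<And>z. \<bar>F z\<bar> \<le> C" using assms unfolding bdd_borel_def by blast
  then show ?thesis using that[of C] order_trans[OF abs_ge_zero] by blast
qed

lemma bdd_borel_const: "bdd_borel (\<lambda>_. c)"
  by (rule bdd_borelI[of _ "\<bar>c\<bar>"]) auto

lemma bdd_borel_add: assumes "bdd_borel F" "bdd_borel G" shows "bdd_borel (\<lambda>z. F z + G z)"
proof -
  obtain C1 C2 where "\<And>z. \<bar>F z\<bar> \<le> C1" "\<And>z. \<bar>G z\<bar> \<le> C2" using assms by (metis bdd_borelE)
  then have "\<bar>F z + G z\<bar> \<le> C1 + C2" for z by (metis abs_triangle_ineq add_mono order_trans)
  then show ?thesis using assms by (intro bdd_borelI borel_measurable_add borel_measurable_times) (auto dest: bdd_borel_measurable)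
qed

lemma bdd_borel_mult: assumes "bdd_borel F" "bdd_borel G" shows "bdd_borel (\<lambda>z. F z * G z)"
proof -
  obtain C1 C2 where "C1 \<ge> 0" "\<And>z. \<bar>F z\<bar> \<le> C1" "\<And>z. \<bar>G z\<bar> \<le> C2" using assms by (metis bdd_borelE)
  then have "\<bar>F z * G z\<bar> \<le> C1 * C2" for z unfolding abs_mult by (intro mult_mono) auto
  then show ?thesis using assms by (intro bdd_borelI borel_measurable_add borel_measurable_times) (auto dest: bdd_borel_measurable)
qed

text \<open>\<alpha> itself may be unbounded: the values of F lie in a compact interval, on which a
  continuous function is bounded.\<close>

lemma bdd_borel_continuous:
  assumes "bdd_borel F" "continuous_on UNIV \<alpha>" shows "bdd_borel (\<lambda>z. \<alpha> (F z))"
proof -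
  obtain C where C: "\<And>z. \<bar>F z\<bar> \<le> C" using assms(1) by (metis bdd_borelE)
  have "compact (\<alpha> ` {-C..C})"
    by (intro compact_continuous_image) (auto intro: continuous_on_subset[OF assms(2)])
  then have "bounded (\<alpha> ` {-C..C})" by (rule compact_imp_bounded)
  then obtain C' where "\<And>x. x \<in> {-C..C} \<Longrightarrow> norm (\<alpha> x) \<le> C'"
    unfolding bounded_iff by (metis image_eqI)
  then have "\<bar>\<alpha> (F z)\<bar> \<le> C'" for z using C[of z] by (simp add: abs_le_iff)
  moreover have "(\<lambda>z. \<alpha> (F z)) \<in> borel_measurable borel"
    using borel_measurable_continuous_onI[OF assms(2)] bdd_borel_measurable[OF assms(1)] by simp
  ultimately show ?thesis by (rule bdd_borelI[rotated])
qed

lemma bdd_borel_diff: assumes "bdd_borel F" "bdd_borel G" shows "bdd_borel (\<lambda>z. F z - G z)"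
  using bdd_borel_add[OF assms(1) bdd_borel_mult[OF bdd_borel_const[of "- 1"] assms(2)]] by simp

lemma bdd_borel_power: "bdd_borel F \<Longrightarrow> bdd_borel (\<lambda>z. F z ^ n)"
  by (erule bdd_borel_continuous) (intro continuous_intros)

lemma bdd_borel_sum: "(\<And>i. i \<in> I \<Longrightarrow> bdd_borel (F i)) \<Longrightarrow> bdd_borel (\<lambda>z. \<Sum>i\<in>I. F i z)"
  by (induction I rule: infinite_finite_induct) (auto intro: bdd_borel_const bdd_borel_add)

text \<open>Second countability enters here, identifying the product of the Borel \<sigma>-algebras
  with the Borel \<sigma>-algebra of the product.\<close>

lemma bdd_borel_fst:
  fixes a :: "'a::second_countable_topology \<Rightarrow> real"
  assumes "bdd_borel a" shows "bdd_borel (\<lambda>z :: 'a \<times> 'b::second_countable_topology. a (fst z))"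
proof -
  have "(\<lambda>z :: 'a \<times> 'b. a (fst z)) \<in> borel_measurable (borel \<Otimes>\<^sub>M borel)"
    using bdd_borel_measurable[OF assms] by simp
  then show ?thesis using assms unfolding borel_prod bdd_borel_def by auto
qed

lemma bdd_borel_snd:
  fixes a :: "'b::second_countable_topology \<Rightarrow> real"
  assumes "bdd_borel a" shows "bdd_borel (\<lambda>z :: 'a::second_countable_topology \<times> 'b. a (snd z))"
proof -
  have "(\<lambda>z :: 'a \<times> 'b. a (snd z)) \<in> borel_measurable (borel \<Otimes>\<^sub>M borel)"
    using bdd_borel_measurable[OF assms] by simp
  then show ?thesis using assms unfolding borel_prod bdd_borel_def by auto
qed

lemma bdd_borel_powr_abs:
  assumes "bdd_borel F" "q > 0" shows "bdd_borel (\<lambda>z. \<bar>F z\<bar> powr q)"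
  by (rule bdd_borel_continuous[OF assms(1)])
    (intro continuous_on_powr' continuous_intros, use assms(2) in simp)

lemmas bdd_borel_intros = bdd_borel_const bdd_borel_add bdd_borel_diff bdd_borel_mult bdd_borel_power
  bdd_borel_sum bdd_borel_fst bdd_borel_snd

lemma bdd_borel_integrable:
  assumes "prob_space M" "sets M = sets borel" "bdd_borel F" shows "integrable M F"
proof -
  interpret prob_space M by fact
  obtain C where "\<And>z. \<bar>F z\<bar> \<le> C" using assms(3) by (metis bdd_borelE)
  then show ?thesis
    using bdd_borel_measurable[OF assms(3)] measurable_cong_sets[OF assms(2) refl, of borel]
    by (intro integrable_const_bound[of _ C]) auto
qed

lemma (in diffusion_semigroup) D_bdd_borel: "f \<in> D \<Longrightarrow> bdd_borel f"
  using D_bounded[of f] D_measurable[of f] unfolding bdd_borel_def by blast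

section \<open>The joint law of a uniform starting point and its heat flow\<close>

text \<open>Finite positive measure of \<open>B\<close> is what makes the uniform law on
  \<open>B\<close> meaningful, and with it convergence in distribution; null sets and sets of
  infinite measure are treated separately afterwards.\<close>

locale diffusion_on = diffusion_semigroup +
  fixes B :: "'a set"
  assumes B_sets: "B \<in> sets borel" and B_pos: "emeasure M B \<noteq> 0" and B_finite: "emeasure M B \<noteq> \<infinity>"
begin

definition m0 :: "'a measure" where
  "m0 = density M (\<lambda>x. ennreal (indicator B x / measure M B))"

text \<open>The law of the pair of X_0 and X_s with X_0 uniform on \<open>B\<close>. Only such
  two-point laws are needed, so no path space is built.\<close>

definition J :: "real \<Rightarrow> ('a \<times> 'a) measure" where
  "J s = m0 \<bind> (\<lambda>x. distr (\<kappa> s x) borel (Pair x))"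

lemma B_measure: "emeasure M B = ennreal (measure M B)" "measure M B > 0"
  using B_pos B_finite by (auto simp: measure_def enn2real_positive_iff less_top zero_less_iff_neq_zero)

lemma sets_m0: "sets m0 = sets borel" and space_m0: "space m0 = UNIV"
  by (simp_all add: m0_def sets_M space_M)

lemma measurable_m0: "borel_measurable m0 = borel_measurable borel"
  by (rule measurable_cong_sets) (simp_all add: sets_m0)

lemma m0_nn_integral:
  assumes "f \<in> borel_measurable borel"
  shows "(\<integral>\<^sup>+x. f x \<partial>m0) = ennreal (1 / measure M B) * (\<integral>\<^sup>+x\<in>B. f x \<partial>M)"
proof -
  have "(\<integral>\<^sup>+x. f x \<partial>m0) = (\<integral>\<^sup>+x. ennreal (indicator B x / measure M B) * f x \<partial>M)"
    unfolding m0_def using assms B_sets by (intro nn_integral_density) (auto simp: sets_M)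
  also have "\<dots> = (\<integral>\<^sup>+x. ennreal (1 / measure M B) * (f x * indicator B x) \<partial>M)"
    by (intro nn_integral_cong) (auto split: split_indicator)
  also have "\<dots> = ennreal (1 / measure M B) * (\<integral>\<^sup>+x\<in>B. f x \<partial>M)"
    using assms B_sets by (intro nn_integral_cmult) (auto simp: sets_M)
  finally show ?thesis .
qed

lemma m0_integral:
  assumes "f \<in> borel_measurable borel"
  shows "(LINT x|m0. f x) = (LINT x|M. indicator B x * f x) / measure M B"
proof -
  have "(LINT x|m0. f x) = (LINT x|M. (indicator B x / measure M B) *\<^sub>R f x)"
    unfolding m0_def using assms B_sets by (intro integral_density) (auto simp: sets_M)
  also have "\<dots> = (LINT x|M. (indicator B x * f x) / measure M B)"
    by simp
  also have "\<dots> = (LINT x|M. indicator B x * f x) / measure M B"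
    by (rule integral_divide_zero)
  finally show ?thesis .
qed

sublocale m0: prob_space m0
proof
  have "(\<integral>\<^sup>+x. 1 \<partial>m0) = ennreal (1 / measure M B) * (\<integral>\<^sup>+x\<in>B. 1 \<partial>M)"
    by (rule m0_nn_integral) simp
  also have "\<dots> = 1"
    using B_sets B_measure by (simp add: sets_M ennreal_mult[symmetric])
  finally show "emeasure m0 (space m0) = 1" by simp
qed

lemma Pair_measurable: "Pair x \<in> borel \<rightarrow>\<^sub>M (borel :: ('a \<times> 'a) measure)"
  unfolding borel_prod[symmetric] by simp

lemma kernel_measurable:
  assumes "s \<ge> 0"
  shows "(\<lambda>x. distr (\<kappa> s x) borel (Pair x)) \<in> m0 \<rightarrow>\<^sub>M prob_algebra (borel :: ('a \<times> 'a) measure)"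
proof (rule measurable_distr_prob_space2)
  show "\<kappa> s \<in> m0 \<rightarrow>\<^sub>M prob_algebra borel"
    using \<kappa>_measurable[OF assms] measurable_cong_sets[OF sets_m0 refl] by blast
  have "sets (m0 \<Otimes>\<^sub>M borel) = sets (borel :: ('a \<times> 'a) measure)"
    unfolding borel_prod[symmetric] by (intro sets_pair_measure_cong sets_m0 refl)
  then have "(\<lambda>x. x) \<in> m0 \<Otimes>\<^sub>M borel \<rightarrow>\<^sub>M (borel :: ('a \<times> 'a) measure)"
    by (rule measurable_ident_sets)
  then show "(\<lambda>(x, y). (x, y)) \<in> m0 \<Otimes>\<^sub>M borel \<rightarrow>\<^sub>M (borel :: ('a \<times> 'a) measure)"
    unfolding case_prod_beta prod.collapse .
qed

lemma sets_J: assumes "s \<ge> 0" shows "sets (J s) = sets borel"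
  unfolding J_def by (rule sets_bind) (auto simp: space_m0)

lemma J_prob: assumes "s \<ge> 0" shows "prob_space (J s)"
  unfolding J_def
proof (rule m0.prob_space_bind)
  show "(\<lambda>x. distr (\<kappa> s x) borel (Pair x)) \<in> m0 \<rightarrow>\<^sub>M subprob_algebra borel"
    by (rule measurable_prob_algebraD[OF kernel_measurable[OF assms]])
  have "prob_space (distr (\<kappa> s x) borel (Pair x))" for x
    using measurable_space[OF kernel_measurable[OF assms], of x] by (simp add: space_prob_algebra space_m0)
  then show "AE x in m0. prob_space (distr (\<kappa> s x) borel (Pair x))" by simp
qed

lemma measurable_\<kappa>_Pair: "s \<ge> 0 \<Longrightarrow> Pair x \<in> \<kappa> s x \<rightarrow>\<^sub>M (borel :: ('a \<times> 'a) measure)"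
  using Pair_measurable measurable_cong_sets[OF \<kappa>_sets refl] by blast

lemma J_nn_integral:
  assumes s: "s \<ge> 0" and F: "F \<in> borel_measurable borel"
  shows "(\<integral>\<^sup>+z. F z \<partial>J s) = (\<integral>\<^sup>+x. (\<integral>\<^sup>+y. F (x, y) \<partial>\<kappa> s x) \<partial>m0)"
  unfolding J_def
  using measurable_\<kappa>_Pair[OF s] F
  by (subst nn_integral_bind[OF F measurable_prob_algebraD[OF kernel_measurable[OF s]]])
    (simp add: nn_integral_distr)

lemma J_integral:
  assumes s: "s \<ge> 0" and F: "bdd_borel F"
  shows "(LINT z|J s. F z) = (LINT x|m0. (LINT y|\<kappa> s x. F (x, y)))"
proof -
  obtain C where C: "\<And>z. \<bar>F z\<bar> \<le> C" using F by (metis bdd_borelE)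
  have "prob_space (distr (\<kappa> s x) borel (Pair x))" for x
    using measurable_space[OF kernel_measurable[OF s], of x] by (simp add: space_prob_algebra space_m0)
  then have "emeasure (distr (\<kappa> s x) borel (Pair x)) (space (distr (\<kappa> s x) borel (Pair x))) \<le> ennreal 1" for x
    by (simp add: prob_space.emeasure_space_1 del: space_distr)
  then have "(LINT z|J s. F z) = (LINT x|m0. (LINT z|distr (\<kappa> s x) borel (Pair x). F z))"
    unfolding J_def
    by (intro integral_bind[OF bdd_borel_measurable[OF F] C measurable_prob_algebraD[OF kernel_measurable[OF s]]
          m0.finite_measure_axioms, of 1]) auto
  then show ?thesis
    using measurable_\<kappa>_Pair[OF s] bdd_borel_measurable[OF F] by (simp add: integral_distr)
qed

lemma J_integrable: "s \<ge> 0 \<Longrightarrow> bdd_borel F \<Longrightarrow> integrable (J s) F"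
  by (rule bdd_borel_integrable[OF J_prob sets_J])

lemma \<kappa>_integral_measurable:
  fixes f :: "'a \<Rightarrow> real"
  assumes "s \<ge> 0" "f \<in> borel_measurable borel"
  shows "(\<lambda>x. LINT y|\<kappa> s x. f y) \<in> borel_measurable borel"
  using measurable_compose[OF measurable_prob_algebraD[OF \<kappa>_measurable[OF assms(1)]]
      integral_measurable_subprob_algebra[OF assms(2)]] .

lemma J_fst:
  assumes s: "s \<ge> 0" and a: "bdd_borel a"
  shows "(LINT z|J s. a (fst z)) = (LINT x|m0. a x)"
  by (subst J_integral[OF s bdd_borel_fst[OF a]]) (simp add: prob_space.prob_space[OF \<kappa>_prob[OF s]])

lemma J_0:
  assumes F: "bdd_borel F"
  shows "(LINT z|J 0. F z) = (LINT x|m0. F (x, x))"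
proof -
  have "(\<lambda>y. F (x, y)) \<in> borel_measurable borel" for x
    using measurable_compose[OF Pair_measurable bdd_borel_measurable[OF F]] .
  then show ?thesis
    by (subst J_integral[OF order_refl F]) (simp add: \<kappa>_def integral_return)
qed

text \<open>The bridge from probability to the semigroup: for a product the expectation is an L^2
  pairing with \<open>P s g\<close>, which does not see the null sets on which the kernel is
  undetermined. The second factor must lie in L^2, hence the restriction to products with a test
  function.\<close>

lemma J_product:
  assumes s: "s \<ge> 0" and a: "bdd_borel a" and g: "g \<in> Lp 2 M" "bdd_borel g"
  shows "(LINT z|J s. a (fst z) * g (snd z)) = (LINT x|M. (indicator B x * a x) * P s g x) / measure M B"
proof -
  have "(LINT z|J s. a (fst z) * g (snd z)) = (LINT x|m0. a x * (LINT y|\<kappa> s x. g y))"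
    by (subst J_integral[OF s]) (auto intro!: bdd_borel_intros a g(2))
  also have "\<dots> = (LINT x|M. indicator B x * (a x * (LINT y|\<kappa> s x. g y))) / measure M B"
    using bdd_borel_measurable[OF a] \<kappa>_integral_measurable[OF s bdd_borel_measurable[OF g(2)]]
    by (intro m0_integral) simp
  also have "(LINT x|M. indicator B x * (a x * (LINT y|\<kappa> s x. g y))) = (LINT x|M. (indicator B x * a x) * P s g x)"
  proof (rule integral_cong_AE)
    show "AE x in M. indicator B x * (a x * (LINT y|\<kappa> s x. g y)) = (indicator B x * a x) * P s g x"
      by (rule AE_mp[OF \<kappa>_semigroup[OF s g(1)] AE_I2]) simp
    show "(\<lambda>x. indicator B x * a x * P s g x) \<in> borel_measurable M"
      using P_Lp2[OF s g(1)] bdd_borel_measurable[OF a] B_sets unfolding Lp2_iff measurable_M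
      by (intro borel_measurable_times borel_measurable_indicator) auto
    show "(\<lambda>x. indicator B x * (a x * (LINT y|\<kappa> s x. g y))) \<in> borel_measurable M"
      using bdd_borel_measurable[OF a] \<kappa>_integral_measurable[OF s bdd_borel_measurable[OF g(2)]] B_sets by simp
  qed
  finally show ?thesis .
qed

section \<open>Dynkin's formula as an estimate on short time steps\<close>

text \<open>The defect of one forward step of length h in Dynkin's formula, where G is the generator
  applied to F in its second variable.\<close>

abbreviation dynkin_error :: "real \<Rightarrow> real \<Rightarrow> ('a \<times> 'a \<Rightarrow> real) \<Rightarrow> ('a \<times> 'a \<Rightarrow> real) \<Rightarrow> real" where
  "dynkin_error s h F G \<equiv> \<bar>integral\<^sup>L (J (s + h)) F - integral\<^sup>L (J s) F - h * integral\<^sup>L (J s) G\<bar>"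

lemma dynkin_product:
  assumes g: "g \<in> D" and C: "C \<ge> 0" and e: "\<epsilon> > 0"
  shows "\<exists>\<delta>>0. \<forall>s h a. 0 \<le> s \<longrightarrow> 0 < h \<longrightarrow> h \<le> \<delta> \<longrightarrow> a \<in> borel_measurable borel \<longrightarrow> (\<forall>x. \<bar>a x\<bar> \<le> C) \<longrightarrow>
    dynkin_error s h (\<lambda>z. a (fst z) * g (snd z)) (\<lambda>z. a (fst z) * L g (snd z)) \<le> \<epsilon> * h"
proof -
  define c where "c = measure M B"
  have c: "c > 0" using B_measure by (simp add: c_def)
  \<comment> \<open>The L^2 norm of a restricted to \<open>B\<close> is at most C sqrt(c), and
    \<open>J\<close> divides by c; this choice compensates both. The summand 1 guards against C =
    0.\<close>
  define \<epsilon>' where "\<epsilon>' = \<epsilon> * sqrt c / (C + 1)"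
  have e': "\<epsilon>' > 0" using e c C by (simp add: \<epsilon>'_def)
  obtain \<delta> where d: "\<delta> > 0" "\<And>s h a. 0 \<le> s \<Longrightarrow> 0 < h \<Longrightarrow> h \<le> \<delta> \<Longrightarrow> a \<in> Lp 2 M \<Longrightarrow>
    \<bar>(LINT x|M. a x * P (s + h) g x) - (LINT x|M. a x * P s g x) - h * (LINT x|M. a x * P s (L g) x)\<bar>
      \<le> \<epsilon>' * h * sqrt (LINT x|M. (a x)\<^sup>2)"
    using dynkin_remainder_L2[OF g e'] by blast
  have "dynkin_error s h (\<lambda>z. a (fst z) * g (snd z)) (\<lambda>z. a (fst z) * L g (snd z)) \<le> \<epsilon> * h"
    if s: "0 \<le> s" and h: "0 < h" "h \<le> \<delta>" and a: "a \<in> borel_measurable borel" "\<And>x. \<bar>a x\<bar> \<le> C" for s h a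
  proof -
    have ab: "bdd_borel a" using a by (rule bdd_borelI)
    let ?a = "\<lambda>x. indicator B x * a x"
    have aL: "?a \<in> Lp 2 M"
      using a C B_sets B_finite
      by (intro Lp2_bounded_support[of _ _ C B]) (auto simp: sets_M less_top split: split_indicator)
    have "(LINT x|M. (?a x)\<^sup>2) \<le> (LINT x|M. indicator B x * C\<^sup>2)"
    proof (rule integral_mono)
      show "integrable M (\<lambda>x. (?a x)\<^sup>2)" using aL by (simp add: Lp2_iff)
      show "integrable M (\<lambda>x. indicator B x * C\<^sup>2)"
        using B_sets B_finite by (simp add: sets_M less_top)
      show "(?a x)\<^sup>2 \<le> indicator B x * C\<^sup>2" for x
        using a(2)[of x] C by (auto split: split_indicator simp: abs_le_square_iff[symmetric])
    qed
    also have "\<dots> = C\<^sup>2 * c"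
      using B_sets B_finite by (simp add: c_def sets_M space_M)
    finally have "sqrt (LINT x|M. (?a x)\<^sup>2) \<le> C * sqrt c"
      using C c by (intro real_le_lsqrt) (auto simp: power_mult_distrib)
    then have "\<epsilon>' * h * sqrt (LINT x|M. (?a x)\<^sup>2) \<le> \<epsilon>' * h * (C * sqrt c)"
      using e' h by (intro mult_left_mono) auto
    also have "\<dots> = \<epsilon> * h * c * (C / (C + 1))"
      using c C by (simp add: \<epsilon>'_def field_simps)
    also have "\<dots> \<le> \<epsilon> * h * c * 1"
      using e h c C by (intro mult_left_mono) auto
    finally have *: "\<epsilon>' * h * sqrt (LINT x|M. (?a x)\<^sup>2) \<le> \<epsilon> * h * c" by simp
    have "dynkin_error s h (\<lambda>z. a (fst z) * g (snd z)) (\<lambda>z. a (fst z) * L g (snd z)) =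
      \<bar>(LINT x|M. ?a x * P (s + h) g x) - (LINT x|M. ?a x * P s g x) - h * (LINT x|M. ?a x * P s (L g) x)\<bar> / c"
      using s h c by (simp add: J_product[OF _ ab D_L2[OF g] D_bdd_borel[OF g]] J_product[OF _ ab D_L2[OF D_L[OF g]] D_bdd_borel[OF D_L[OF g]]] c_def[symmetric] diff_divide_distrib[symmetric])
    also have "\<dots> \<le> \<epsilon> * h"
      using order_trans[OF d(2)[OF s h aL] *] c by (simp add: divide_le_eq)
    finally show ?thesis .
  qed
  then show ?thesis using d(1) by blast
qed

lemma J_sum_integral:
  assumes "s \<ge> 0" "\<And>i. i \<in> I \<Longrightarrow> bdd_borel (F i)"
  shows "(LINT z|J s. (\<Sum>i\<in>I. F i z)) = (\<Sum>i\<in>I. LINT z|J s. F i z)"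
  by (rule Bochner_Integration.integral_sum) (use assms J_integrable in auto)

text \<open>A function of f(x) and f(y) is accessible through \<open>J_product\<close> once it is a
  finite sum of products. The factor in f(x) and the weight w merge into one multiplier a(x), and
  the chain rule acts on the factor in f(y). The induction over I spends half of \<epsilon> on each
  new term.\<close>

lemma dynkin_separable:
  fixes \<alpha> \<eta> \<eta>1 \<eta>2 :: "'i \<Rightarrow> real \<Rightarrow> real"
  assumes f: "f \<in> D" and I: "finite I" and e: "\<epsilon> > 0"
    and \<alpha>: "\<And>i. i \<in> I \<Longrightarrow> continuous_on UNIV (\<alpha> i)"
    and \<eta>: "\<And>i. i \<in> I \<Longrightarrow> smooth_on UNIV (\<eta> i)"
    and \<eta>1: "\<And>i z. i \<in> I \<Longrightarrow> (\<eta> i has_real_derivative \<eta>1 i z) (at z)"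
    and \<eta>2: "\<And>i z. i \<in> I \<Longrightarrow> (\<eta>1 i has_real_derivative \<eta>2 i z) (at z)"
  shows "\<exists>\<delta>>0. \<forall>s h w. 0 \<le> s \<longrightarrow> 0 < h \<longrightarrow> h \<le> \<delta> \<longrightarrow> w \<in> borel_measurable borel \<longrightarrow> (\<forall>x. \<bar>w x\<bar> \<le> 1) \<longrightarrow>
    dynkin_error s h (\<lambda>z. w (fst z) * (\<Sum>i\<in>I. \<alpha> i (f (fst z)) * \<eta> i (f (snd z)))) (\<lambda>z. w (fst z) * ((\<Sum>i\<in>I. \<alpha> i (f (fst z)) * \<eta>1 i (f (snd z))) * L f (snd z)
         + (\<Sum>i\<in>I. \<alpha> i (f (fst z)) * \<eta>2 i (f (snd z))) * \<Gamma> f (snd z))) \<le> \<epsilon> * h"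
  using I \<alpha> \<eta> \<eta>1 \<eta>2 e
proof (induction I arbitrary: \<epsilon> rule: finite_induct)
  case empty
  then show ?case by (intro exI[of _ 1]) auto
next
  case (insert j I)
  have ct: "continuous_on UNIV (\<eta> i)" "continuous_on UNIV (\<eta>1 i)" "continuous_on UNIV (\<eta>2 i)" if "i \<in> insert j I" for i
  proof -
    have "Ck_on (Suc (Suc 0)) UNIV (\<eta> i)"
      using insert.prems(2)[OF that] unfolding smooth_on_def by blast
    have s1: "smooth_on UNIV (\<eta>1 i)"
      by (rule smooth_on_real_deriv[OF insert.prems(2,3)[OF that]])
    have s2: "smooth_on UNIV (\<eta>2 i)"
      by (rule smooth_on_real_deriv[OF s1 insert.prems(4)[OF that]])
    show "continuous_on UNIV (\<eta> i)" "continuous_on UNIV (\<eta>1 i)" "continuous_on UNIV (\<eta>2 i)"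
      using insert.prems(2)[OF that] s1 s2 unfolding smooth_on_def by (metis Ck_on.simps(1))+
  qed
  note bf = bdd_borel_continuous[OF D_bdd_borel[OF f]]
  define T where "T i = (\<lambda>w z. w (fst z) * (\<alpha> i (f (fst z)) * \<eta> i (f (snd z))))" for i and w :: "'a \<Rightarrow> real" and z :: "'a \<times> 'a"
  define U where "U i = (\<lambda>w z. w (fst z) * ((\<alpha> i (f (fst z)) * \<eta>1 i (f (snd z))) * L f (snd z)
         + (\<alpha> i (f (fst z)) * \<eta>2 i (f (snd z))) * \<Gamma> f (snd z)))" for i and w :: "'a \<Rightarrow> real" and z :: "'a \<times> 'a"
  have bT: "bdd_borel (T i w)" and bU: "bdd_borel (U i w)" if "i \<in> insert j I" "bdd_borel w" for i w
    unfolding T_def U_def using that ct[OF that(1)] insert.prems(1)[OF that(1)]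
    by (intro bdd_borel_add bdd_borel_mult bdd_borel_fst bdd_borel_snd that bf D_bdd_borel D_L D_\<Gamma> f; simp)+
  have single: "\<exists>\<delta>>0. \<forall>s h w. 0 \<le> s \<longrightarrow> 0 < h \<longrightarrow> h \<le> \<delta> \<longrightarrow> w \<in> borel_measurable borel \<longrightarrow> (\<forall>x. \<bar>w x\<bar> \<le> 1) \<longrightarrow>
    dynkin_error s h (\<lambda>z. T j w z) (\<lambda>z. U j w z) \<le> \<epsilon> / 2 * h"
  proof -
    \<comment> \<open>Subtracting the value at 0 makes \<eta>(f) vanish where f does, so that g
      belongs to D.\<close>
    define g where "g x = \<eta> j (f x) - \<eta> j 0" for x
    have g: "g \<in> D" "L g = (\<lambda>x. \<eta>1 j (f x) * L f x + \<eta>2 j (f x) * \<Gamma> f x)"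
    proof -
      have "smooth_on UNIV (\<lambda>z. \<eta> j z - \<eta> j 0)"
        using smooth_on_add[OF open_UNIV insert.prems(2)[of j] smooth_on_const[of _ "- \<eta> j 0"]] by simp
      note s = this
      have d: "((\<lambda>z. \<eta> j z - \<eta> j 0) has_real_derivative \<eta>1 j z) (at z)" for z
        using insert.prems(3)[of j z] by (auto intro!: derivative_eq_intros)
      show "g \<in> D"
        unfolding g_def by (rule D_compose[OF f s]) simp
      show "L g = (\<lambda>x. \<eta>1 j (f x) * L f x + \<eta>2 j (f x) * \<Gamma> f x)"
        unfolding g_def by (rule L_compose[OF f s _ d]) (use insert.prems(4)[of j] in auto)
    qed
    have ba: "bdd_borel (\<lambda>x. \<alpha> j (f x))"
      using insert.prems(1) by (intro bf) simp
    obtain C where C: "C \<ge> 0" "\<And>x. \<bar>\<alpha> j (f x)\<bar> \<le> C" by (rule bdd_borelE[OF ba]) blast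
    have e2: "\<epsilon> / 2 > 0" using insert.prems(5) by simp
    obtain \<delta> where d: "\<delta> > 0" "\<And>s h a. 0 \<le> s \<Longrightarrow> 0 < h \<Longrightarrow> h \<le> \<delta> \<Longrightarrow> a \<in> borel_measurable borel \<Longrightarrow> (\<And>x. \<bar>a x\<bar> \<le> C) \<Longrightarrow>
      dynkin_error s h (\<lambda>z. a (fst z) * g (snd z)) (\<lambda>z. a (fst z) * L g (snd z)) \<le> \<epsilon> / 2 * h"
      using dynkin_product[OF g(1) C(1) e2] by blast
    have "dynkin_error s h (\<lambda>z. T j w z) (\<lambda>z. U j w z) \<le> \<epsilon> / 2 * h"
      if s: "0 \<le> s" and h: "0 < h" "h \<le> \<delta>" and w: "w \<in> borel_measurable borel" "\<And>x. \<bar>w x\<bar> \<le> 1" for s h w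
    proof -
      define a where "a x = w x * \<alpha> j (f x)" for x
      have bw: "bdd_borel w" using w by (rule bdd_borelI)
      have bda: "bdd_borel a" unfolding a_def by (intro bdd_borel_mult bw ba)
      have aC: "\<bar>a x\<bar> \<le> C" for x
        using mult_mono[OF w(2)[of x] C(2)[of x]] by (simp add: a_def abs_mult)
      have T: "T j w z = a (fst z) * g (snd z) + a (fst z) * \<eta> j 0" for z
        by (simp add: T_def a_def g_def algebra_simps)
      have U: "U j w z = a (fst z) * L g (snd z)" for z
        by (simp add: U_def a_def g(2) algebra_simps)
      \<comment> \<open>The constant removed from g leaves a term in the starting point alone. Its
        integral does not depend on time, so it drops out of the defect.\<close>
      have c: "(LINT z|J r. a (fst z) * \<eta> j 0) = (LINT x|m0. a x * \<eta> j 0)" if "r \<ge> 0" for r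
        by (rule J_fst[OF that, of "\<lambda>x. a x * \<eta> j 0"]) (intro bdd_borel_intros bda)
      have "(LINT z|J r. T j w z) = (LINT z|J r. a (fst z) * g (snd z)) + (LINT x|m0. a x * \<eta> j 0)" if r: "r \<ge> 0" for r
        unfolding T c[OF r, symmetric]
        by (intro Bochner_Integration.integral_add J_integrable r bdd_borel_intros bda D_bdd_borel g(1))
      then show ?thesis
        using d(2)[OF s h bdd_borel_measurable[OF bda] aC] s h by (simp add: U)
    qed
    then show ?thesis using d(1) by blast
  qed
  have "\<epsilon> / 2 > 0" using insert.prems(5) by simp
  from insert.IH[OF insert.prems(1-4)[OF insertI2] this] obtain \<delta>1 where d1: "\<delta>1 > 0"
    "\<And>s h w. 0 \<le> s \<Longrightarrow> 0 < h \<Longrightarrow> h \<le> \<delta>1 \<Longrightarrow> w \<in> borel_measurable borel \<Longrightarrow> (\<forall>x. \<bar>w x\<bar> \<le> 1) \<Longrightarrow>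
    dynkin_error s h (\<lambda>z. w (fst z) * (\<Sum>i\<in>I. \<alpha> i (f (fst z)) * \<eta> i (f (snd z)))) (\<lambda>z. w (fst z) * ((\<Sum>i\<in>I. \<alpha> i (f (fst z)) * \<eta>1 i (f (snd z))) * L f (snd z)
         + (\<Sum>i\<in>I. \<alpha> i (f (fst z)) * \<eta>2 i (f (snd z))) * \<Gamma> f (snd z))) \<le> \<epsilon> / 2 * h"
    by blast
  have sT: "w (fst z) * (\<Sum>i\<in>I'. \<alpha> i (f (fst z)) * \<eta> i (f (snd z))) = (\<Sum>i\<in>I'. T i w z)" for w z I'
    by (simp add: T_def sum_distrib_left)
  have sU: "w (fst z) * ((\<Sum>i\<in>I'. \<alpha> i (f (fst z)) * \<eta>1 i (f (snd z))) * L f (snd z)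
         + (\<Sum>i\<in>I'. \<alpha> i (f (fst z)) * \<eta>2 i (f (snd z))) * \<Gamma> f (snd z)) = (\<Sum>i\<in>I'. U i w z)" for w z I'
    by (simp add: U_def sum_distrib_left sum_distrib_right sum.distrib[symmetric])
  note d1 = d1[unfolded sT sU]
  obtain \<delta>2 where d2: "\<delta>2 > 0" "\<And>s h w. 0 \<le> s \<Longrightarrow> 0 < h \<Longrightarrow> h \<le> \<delta>2 \<Longrightarrow> w \<in> borel_measurable borel \<Longrightarrow> (\<forall>x. \<bar>w x\<bar> \<le> 1) \<Longrightarrow>
    dynkin_error s h (\<lambda>z. T j w z) (\<lambda>z. U j w z) \<le> \<epsilon> / 2 * h"
    using single by blast
  have lin: "\<bar>(a2 + a1) - (b2 + b1) - h * (c2 + c1)\<bar> \<le> E + E"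
    if "\<bar>a1 - b1 - h * c1\<bar> \<le> E" "\<bar>a2 - b2 - h * c2\<bar> \<le> E" for a1 a2 b1 b2 c1 c2 h E :: real
    using that by (simp add: distrib_left)
  show ?case
    unfolding sT sU
  proof (intro exI[of _ "min \<delta>1 \<delta>2"] conjI allI impI)
    fix s h :: real and w :: "'a \<Rightarrow> real"
    assume s: "0 \<le> s" and h: "0 < h" "h \<le> min \<delta>1 \<delta>2" and w: "w \<in> borel_measurable borel" "\<forall>x. \<bar>w x\<bar> \<le> 1"
    have bw: "bdd_borel w" using w by (intro bdd_borelI) auto
    have Ts: "(LINT z|J r. (\<Sum>i\<in>insert j I. T i w z)) = (LINT z|J r. T j w z) + (LINT z|J r. (\<Sum>i\<in>I. T i w z))"
      if "r \<ge> 0" for r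
      using insert.hyps bT[OF _ bw] that by (simp add: J_sum_integral)
        (auto intro!: Bochner_Integration.integral_add J_integrable bdd_borel_sum simp: J_sum_integral[symmetric])
    have Us: "(LINT z|J r. (\<Sum>i\<in>insert j I. U i w z)) = (LINT z|J r. U j w z) + (LINT z|J r. (\<Sum>i\<in>I. U i w z))"
      if "r \<ge> 0" for r
      using insert.hyps bU[OF _ bw] that by (simp add: J_sum_integral)
        (auto intro!: Bochner_Integration.integral_add J_integrable bdd_borel_sum simp: J_sum_integral[symmetric])
    have sh: "s + h \<ge> 0" using s h by simp
    have h12: "h \<le> \<delta>1" "h \<le> \<delta>2" using h by auto
    show "dynkin_error s h (\<lambda>z. (\<Sum>i\<in>insert j I. T i w z)) (\<lambda>z. (\<Sum>i\<in>insert j I. U i w z)) \<le> \<epsilon> * h"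
      unfolding Ts[OF s] Ts[OF sh] Us[OF s]
      by (rule order_trans[OF lin[OF d1(2)[OF s h(1) h12(1) w] d2(2)[OF s h(1) h12(2) w]]]) simp
  qed (use d1 d2 in auto)
qed

text \<open>Form for applications: the separable decomposition is given only to justify the
  estimate, while the generator is stated through the derivatives of \<Psi> in closed form,
  identified with the sums by uniqueness of derivatives.\<close>

lemma dynkin:
  fixes \<Psi> \<Psi>1 \<Psi>2 :: "real \<Rightarrow> real \<Rightarrow> real" and \<alpha> \<eta> \<eta>1 \<eta>2 :: "'i \<Rightarrow> real \<Rightarrow> real"
  assumes f: "f \<in> D" and I: "finite I" and e: "\<epsilon> > 0"
    and \<alpha>: "\<And>i. i \<in> I \<Longrightarrow> continuous_on UNIV (\<alpha> i)"
    and \<eta>: "\<And>i. i \<in> I \<Longrightarrow> smooth_on UNIV (\<eta> i)"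
    and \<eta>1: "\<And>i z. i \<in> I \<Longrightarrow> (\<eta> i has_real_derivative \<eta>1 i z) (at z)"
    and \<eta>2: "\<And>i z. i \<in> I \<Longrightarrow> (\<eta>1 i has_real_derivative \<eta>2 i z) (at z)"
    and \<Psi>: "\<And>c z. \<Psi> c z = (\<Sum>i\<in>I. \<alpha> i c * \<eta> i z)"
    and \<Psi>1: "\<And>c z. (\<Psi> c has_real_derivative \<Psi>1 c z) (at z)"
    and \<Psi>2: "\<And>c z. (\<Psi>1 c has_real_derivative \<Psi>2 c z) (at z)"
  obtains \<delta> where "\<delta> > 0"
    "\<And>s h w. 0 \<le> s \<Longrightarrow> 0 < h \<Longrightarrow> h \<le> \<delta> \<Longrightarrow> w \<in> borel_measurable borel \<Longrightarrow> (\<And>x. \<bar>w x\<bar> \<le> 1) \<Longrightarrow>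
    dynkin_error s h (\<lambda>z. w (fst z) * \<Psi> (f (fst z)) (f (snd z))) (\<lambda>z. w (fst z) * (\<Psi>1 (f (fst z)) (f (snd z)) * L f (snd z)
         + \<Psi>2 (f (fst z)) (f (snd z)) * \<Gamma> f (snd z))) \<le> \<epsilon> * h"
proof -
  have 1: "\<Psi>1 c z = (\<Sum>i\<in>I. \<alpha> i c * \<eta>1 i z)" for c z
  proof (rule DERIV_unique[OF \<Psi>1])
    show "(\<Psi> c has_real_derivative (\<Sum>i\<in>I. \<alpha> i c * \<eta>1 i z)) (at z)"
      unfolding \<Psi>[abs_def] by (intro DERIV_sum DERIV_cmult \<eta>1)
  qed
  have 2: "\<Psi>2 c z = (\<Sum>i\<in>I. \<alpha> i c * \<eta>2 i z)" for c z
  proof (rule DERIV_unique[OF \<Psi>2])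
    show "(\<Psi>1 c has_real_derivative (\<Sum>i\<in>I. \<alpha> i c * \<eta>2 i z)) (at z)"
      unfolding 1[abs_def] by (intro DERIV_sum DERIV_cmult \<eta>2)
  qed
  note D = dynkin_separable[where \<alpha> = \<alpha> and \<eta> = \<eta> and ?\<eta>1.0 = \<eta>1 and ?\<eta>2.0 = \<eta>2, OF f I e \<alpha> \<eta> \<eta>1 \<eta>2,
      folded \<Psi> 1 2]
  show ?thesis
    by (rule exE[OF D], assumption, assumption, assumption, assumption, elim conjE, rule that, assumption, blast)
qed

section \<open>Moments of increments\<close>

text \<open>The generator lowers the degree of the power by one or two. Since f is bounded, both
  terms are dominated by a constant times the power 2j, whose expectation is O(t^j) by induction;
  summing over [0,t] yields one more factor t.\<close>

lemma moment_bound: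
  assumes f: "f \<in> D"
  shows "\<exists>C\<ge>0. \<forall>t\<ge>0. (LINT z|J t. jump f z ^ (2 * j)) \<le> C * t ^ j"
proof (induction j)
  case 0
  show ?case
    by (intro exI[of _ 1]) (auto simp: prob_space.prob_space[OF J_prob])
next
  case (Suc j)
  then obtain C where C: "C \<ge> 0" "\<And>t. t \<ge> 0 \<Longrightarrow> (LINT z|J t. jump f z ^ (2 * j)) \<le> C * t ^ j"
    by blast
  define n where "n = 2 * j + 2"
  obtain CF where CF: "CF \<ge> 0" "\<And>x. \<bar>f x\<bar> \<le> CF" by (rule bdd_borelE[OF D_bdd_borel[OF f]]) blast
  obtain CL where CL: "CL \<ge> 0" "\<And>x. \<bar>L f x\<bar> \<le> CL" by (rule bdd_borelE[OF D_bdd_borel[OF D_L[OF f]]]) blast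
  obtain CG where CG: "CG \<ge> 0" "\<And>x. \<bar>\<Gamma> f x\<bar> \<le> CG" by (rule bdd_borelE[OF D_bdd_borel[OF D_\<Gamma>[OF f]]]) blast
  \<comment> \<open>The drift term has degree 2j + 1, and its surplus factor is bounded by 2
    \<open>CF\<close>; the \<Gamma> term has degree 2j already.\<close>
  define K where "K = real n * (2 * CF) * CL + real n * real (n - 1) * CG"
  have K: "K \<ge> 0" using CF CL CG by (simp add: K_def)
  define H where "H s = (LINT z|J s. jump f z ^ n)" for s
  note bd = bdd_borel_intros D_bdd_borel f D_L[OF f] D_\<Gamma>[OF f]
  \<comment> \<open>Under \<open>J 0\<close> both points coincide, and n is positive.\<close>
  have H0: "H 0 = 0"
    unfolding H_def by (subst J_0) (auto intro!: bd simp: n_def)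
  have "H t - H 0 \<le> t * (K * C * t ^ j)" if t: "t \<ge> 0" for t
  proof (rule telescoping_bound[OF t])
    fix \<epsilon> :: real assume e: "\<epsilon> > 0"
    obtain \<delta> where d: "\<delta> > 0"
      "\<And>s h w. 0 \<le> s \<Longrightarrow> 0 < h \<Longrightarrow> h \<le> \<delta> \<Longrightarrow> w \<in> borel_measurable borel \<Longrightarrow> (\<And>x. \<bar>w x\<bar> \<le> 1) \<Longrightarrow>
      dynkin_error s h (\<lambda>z. w (fst z) * jump f z ^ n) (\<lambda>z. w (fst z) * (real n * jump f z ^ (n - 1) * L f (snd z)
         + real n * (real (n - 1) * jump f z ^ (n - 2)) * \<Gamma> f (snd z))) \<le> \<epsilon> * h"
    \<comment> \<open>The binomial expansion of (z - c)^n is the required separable form.\<close>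
    proof (rule dynkin[where \<Psi> = "\<lambda>c z. (z - c) ^ n" and ?\<Psi>1.0 = "\<lambda>c z. real n * (z - c) ^ (n - 1)"
          and ?\<Psi>2.0 = "\<lambda>c z. real n * (real (n - 1) * (z - c) ^ (n - 2))"
          and I = "{..n}" and \<alpha> = "\<lambda>i c. real (n choose i) * (- c) ^ (n - i)" and \<eta> = "\<lambda>i z. z ^ i"
          and ?\<eta>1.0 = "\<lambda>i z. real i * z ^ (i - 1)" and ?\<eta>2.0 = "\<lambda>i z. real i * (real (i - 1) * z ^ (i - 2))", OF f _ e])
      show "(z - c) ^ n = (\<Sum>i\<le>n. real (n choose i) * (- c) ^ (n - i) * z ^ i)" for c z :: real
        using binomial_ring[of z "- c" n] by (simp add: mult_ac)
      have pw: "((\<lambda>z. real m * (z - c) ^ (m - 1)) has_real_derivative real m * (real (m - 1) * (z - c) ^ (m - 2))) (at z)" for m :: nat and c z :: real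
        by (rule derivative_eq_intros refl | simp add: numeral_2_eq_2)+
      show "((\<lambda>z. real n * (z - c) ^ (n - 1)) has_real_derivative real n * (real (n - 1) * (z - c) ^ (n - 2))) (at z)" for c z :: real
        by (rule pw)
      show "((\<lambda>z. real i * z ^ (i - 1)) has_real_derivative real i * (real (i - 1) * z ^ (i - 2))) (at z)" for i :: nat and z :: real
        using pw[of i 0 z] by simp
    qed (auto intro!: continuous_intros smooth_on_power derivative_eq_intros)
    have step: "H (s + h) - H s \<le> h * (K * C * t ^ j + \<epsilon>)"
      if s: "0 \<le> s" and h: "0 < h" "h \<le> \<delta>" "s + h \<le> t" for s h
    proof -
      have "(LINT z|J s. real n * jump f z ^ (n - 1) * L f (snd z)
         + real n * (real (n - 1) * jump f z ^ (n - 2)) * \<Gamma> f (snd z))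
         \<le> (LINT z|J s. K * jump f z ^ (2 * j))"
      proof (rule integral_mono)
        fix z
        let ?d = "jump f z"
        have d2: "\<bar>?d\<bar> \<le> 2 * CF" using CF(2)[of "fst z"] CF(2)[of "snd z"] by linarith
        have "?d ^ (n - 1) * L f (snd z) \<le> \<bar>?d\<bar> * \<bar>L f (snd z)\<bar> * ?d ^ (2 * j)"
        proof -
          have "?d ^ (n - 1) * L f (snd z) \<le> \<bar>?d ^ (n - 1) * L f (snd z)\<bar>" by (rule abs_ge_self)
          also have "\<dots> = \<bar>?d\<bar> * \<bar>L f (snd z)\<bar> * ?d ^ (2 * j)"
            by (simp add: n_def abs_mult power_mult)
          finally show ?thesis .
        qed
        also have "\<dots> \<le> (2 * CF) * CL * ?d ^ (2 * j)"
          using d2 CL CF by (intro mult_right_mono mult_mono) (auto simp: power_mult)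
        finally have 1: "real n * (?d ^ (n - 1) * L f (snd z)) \<le> real n * ((2 * CF) * CL * ?d ^ (2 * j))"
          by (intro mult_left_mono) auto
        have "?d ^ (n - 2) * \<Gamma> f (snd z) \<le> ?d ^ (2 * j) * CG"
          using CG(2)[of "snd z"] by (auto simp: n_def power_mult intro!: mult_left_mono)
        then have 2: "real n * real (n - 1) * (?d ^ (n - 2) * \<Gamma> f (snd z)) \<le> real n * real (n - 1) * (?d ^ (2 * j) * CG)"
          by (intro mult_left_mono) auto
        show "real n * ?d ^ (n - 1) * L f (snd z) + real n * (real (n - 1) * ?d ^ (n - 2)) * \<Gamma> f (snd z) \<le> K * ?d ^ (2 * j)"
          using add_mono[OF 1 2] by (simp add: K_def algebra_simps)
      qed (intro J_integrable s bd)+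
      also have "\<dots> = K * (LINT z|J s. jump f z ^ (2 * j))" by simp
      also have "\<dots> \<le> K * (C * s ^ j)"
        by (intro mult_left_mono C K s)
      also have "\<dots> \<le> K * (C * t ^ j)"
        using s h by (intro mult_left_mono C K power_mono) auto
      finally have *: "(LINT z|J s. real n * jump f z ^ (n - 1) * L f (snd z)
         + real n * (real (n - 1) * jump f z ^ (n - 2)) * \<Gamma> f (snd z)) \<le> K * C * t ^ j"
        by (simp add: mult.assoc)
      show ?thesis
        using d(2)[OF s h(1,2), of "\<lambda>_. 1"] mult_left_mono[OF * less_imp_le[OF h(1)]]
        unfolding H_def by (simp add: algebra_simps)
    qed
    show "\<exists>\<delta>>0. \<forall>s h. 0 \<le> s \<longrightarrow> 0 < h \<longrightarrow> h \<le> \<delta> \<longrightarrow> s + h \<le> t \<longrightarrow> H (s + h) - H s \<le> h * (K * C * t ^ j + \<epsilon>)"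
      using d(1) step by blast
  qed
  then have "\<forall>t\<ge>0. H t \<le> K * C * t ^ Suc j"
    using H0 by (simp add: algebra_simps)
  then show ?case
    using K C(1) by (intro exI[of _ "K * C"]) (auto simp: H_def n_def)
qed

text \<open>Cauchy-Schwarz on the second moment. Applied to \<Gamma> f it prices the replacement of
  \<Gamma> f at the end point by \<Gamma> f at the starting point.\<close>

lemma mean_abs_increment:
  assumes g: "g \<in> D"
  shows "\<exists>C\<ge>0. \<forall>t\<ge>0. (LINT z|J t. \<bar>jump g z\<bar>) \<le> C * sqrt t"
proof -
  obtain C where C: "C \<ge> 0" "\<And>t. t \<ge> 0 \<Longrightarrow> (LINT z|J t. (jump g z) ^ (2 * 1)) \<le> C * t ^ 1"
    using moment_bound[OF g, of 1] by blast
  have "(LINT z|J t. \<bar>jump g z\<bar>) \<le> sqrt C * sqrt t" if t: "t \<ge> 0" for t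
  proof -
    interpret prob_space "J t" by (rule J_prob[OF t])
    have b: "bdd_borel (\<lambda>z. jump g z)" by (intro bdd_borel_intros D_bdd_borel g)
    have b': "bdd_borel (\<lambda>z. \<bar>jump g z\<bar>)"
      by (rule bdd_borel_continuous[OF b]) (intro continuous_intros)
    have 1: "(\<lambda>z. 1) \<in> Lp 2 (J t)" by (simp add: Lp2_iff)
    have 2: "(\<lambda>z. \<bar>jump g z\<bar>) \<in> Lp 2 (J t)"
      unfolding Lp2_iff
      using bdd_borel_measurable[OF b'] measurable_cong_sets[OF sets_J[OF t] refl, of borel]
        J_integrable[OF t bdd_borel_power[OF b', of 2]] by auto
    have "(LINT z|J t. \<bar>jump g z\<bar>) \<le> sqrt (LINT z|J t. (jump g z)\<^sup>2)"
      using Lp2_Cauchy_Schwarz[OF 1 2] prob_space by simp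
    also have "\<dots> \<le> sqrt (C * t)" using C(2)[OF t] by simp
    finally show ?thesis by (simp add: real_sqrt_mult)
  qed
  then show ?thesis using C(1) by (intro exI[of _ "sqrt C"]) auto
qed

end

section \<open>The central limit theorem for increments\<close>

context diffusion_on begin

section \<open>Characteristic functions of the normalised increments\<close>

lemma J_abs_integral_le:
  assumes s: "s \<ge> 0" and F: "bdd_borel F" and G: "bdd_borel G" and le: "\<And>z. \<bar>F z\<bar> \<le> G z"
  shows "\<bar>LINT z|J s. F z\<bar> \<le> (LINT z|J s. G z)"
proof -
  have "\<bar>LINT z|J s. F z\<bar> \<le> (LINT z|J s. \<bar>F z\<bar>)" by (rule integral_abs_bound)
  also have "\<dots> \<le> (LINT z|J s. G z)"
    by (rule integral_mono) (use J_integrable[OF s F] J_integrable[OF s G] le in auto)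
  finally show ?thesis .
qed

text \<open>An integrating factor takes the place of a differential equation: the expectation of the
  cosine times exp(-\<lambda>^2 (t - r) \<Gamma> f(x)) is the quantity sought at r = t and the
  Gaussian value at r = 0, and it nearly stays constant in between. The phases \<theta> = 0 and
  \<theta> = - pi/2 give real and imaginary part.\<close>

lemma char_increment_bound:
  assumes f: "f \<in> D"
  shows "\<exists>K\<ge>0. \<forall>t>0. \<bar>(LINT z|J t. cos (\<xi> / sqrt t * (jump f z) + \<theta>))
      - (LINT x|m0. cos \<theta> * exp (- (\<xi>\<^sup>2 * \<Gamma> f x)))\<bar> \<le> K * sqrt t"
proof -
  obtain CL where CL: "CL \<ge> 0" "\<And>x. \<bar>L f x\<bar> \<le> CL" by (rule bdd_borelE[OF D_bdd_borel[OF D_L[OF f]]]) blast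
  obtain CG where CG: "CG \<ge> 0" "\<And>x. \<bar>\<Gamma> f x\<bar> \<le> CG" by (rule bdd_borelE[OF D_bdd_borel[OF D_\<Gamma>[OF f]]]) blast
  obtain CM where CM: "CM \<ge> 0" "\<And>t. t \<ge> 0 \<Longrightarrow> (LINT z|J t. \<bar>jump (\<Gamma> f) z\<bar>) \<le> CM * sqrt t"
    using mean_abs_increment[OF D_\<Gamma>[OF f]] by blast
  define K where "K = \<bar>\<xi>\<bar> * CL + \<xi>\<^sup>2 * CM"
  have K: "K \<ge> 0" using CL CM by (simp add: K_def)
  note bf = D_bdd_borel[OF f] and bL = D_bdd_borel[OF D_L[OF f]] and bG = D_bdd_borel[OF D_\<Gamma>[OF f]]
  have "\<bar>(LINT z|J t. cos (\<xi> / sqrt t * (jump f z) + \<theta>))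
      - (LINT x|m0. cos \<theta> * exp (- (\<xi>\<^sup>2 * \<Gamma> f x)))\<bar> \<le> K * sqrt t" if t: "t > 0" for t
  proof -
    define l where "l = \<xi> / sqrt t"
    have l2: "l\<^sup>2 * t = \<xi>\<^sup>2" using t by (simp add: l_def power_divide)
    have lt: "\<bar>l\<bar> * t = \<bar>\<xi>\<bar> * sqrt t"
      using t by (simp add: l_def abs_divide divide_eq_eq mult.assoc)
    define w where "w r x = exp (- (l\<^sup>2 * (t - r) * \<Gamma> f x))" for r x
    have w1: "\<bar>w r x\<bar> \<le> 1" if "r \<le> t" for r x
      using that \<Gamma>_nonneg[OF f, of x] by (simp add: w_def)
    have bw: "bdd_borel (w r)" for r
      unfolding w_def by (rule bdd_borel_continuous[OF bG]) (intro continuous_intros)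
    define c where "c z = cos (l * (jump f z) + \<theta>)" for z
    define sn where "sn z = sin (l * (jump f z) + \<theta>)" for z
    have bd: "bdd_borel (\<lambda>z. jump f z)" by (intro bdd_borel_intros bf)
    have bc: "bdd_borel c" unfolding c_def by (rule bdd_borel_continuous[OF bd]) (intro continuous_intros)
    have bs: "bdd_borel sn" unfolding sn_def by (rule bdd_borel_continuous[OF bd]) (intro continuous_intros)
    have c1: "\<bar>c z\<bar> \<le> 1" "\<bar>sn z\<bar> \<le> 1" for z by (auto simp: c_def sn_def)
    note bi = bdd_borel_intros bw bc bs bf bL bG
    define H where "H r = (LINT z|J r. w r (fst z) * c z)" for r
    \<comment> \<open>Bound on the rate of change of \<open>H\<close>: \<open>CL\<close> comes from
      the drift, \<open>CM\<close> from freezing \<Gamma> f at the starting point. As l = \<xi> /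
      sqrt t, the total over [0,t] is \<open>K * sqrt t\<close>.\<close>
    define R where "R = \<bar>l\<bar> * CL + l\<^sup>2 * (CM * sqrt t)"
    \<comment> \<open>Coefficient of h^2 in the second-order error of the integrating factor over a
      step h.\<close>
    define Q where "Q = (l\<^sup>2 * CG)\<^sup>2"
    have Q: "Q \<ge> 0" by (simp add: Q_def)
    have step: "\<exists>\<delta>>0. \<forall>s h. 0 \<le> s \<longrightarrow> 0 < h \<longrightarrow> h \<le> \<delta> \<longrightarrow> s + h \<le> t \<longrightarrow> \<bar>H (s + h) - H s\<bar> \<le> h * (R + \<epsilon>)"
      if e: "\<epsilon> > 0" for \<epsilon>
    proof -
      have e2: "\<epsilon> / 2 > 0" using e by simp
      obtain \<delta> where d: "\<delta> > 0"
        "\<And>s h w. 0 \<le> s \<Longrightarrow> 0 < h \<Longrightarrow> h \<le> \<delta> \<Longrightarrow> w \<in> borel_measurable borel \<Longrightarrow> (\<And>x. \<bar>w x\<bar> \<le> 1) \<Longrightarrow>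
          dynkin_error s h (\<lambda>z. w (fst z) * c z) (\<lambda>z. w (fst z) * (- l * sn z * L f (snd z) + - l * (l * c z) * \<Gamma> f (snd z))) \<le> \<epsilon> / 2 * h"
        unfolding c_def sn_def
      \<comment> \<open>The addition formula separates the cosine into two products. The sine in z
        is written as a shifted cosine, so that one smoothness lemma serves both.\<close>
      proof (rule dynkin[where \<Psi> = "\<lambda>c z. cos (l * (z - c) + \<theta>)" and ?\<Psi>1.0 = "\<lambda>c z. - l * sin (l * (z - c) + \<theta>)"
            and ?\<Psi>2.0 = "\<lambda>c z. - l * (l * cos (l * (z - c) + \<theta>))" and I = "UNIV :: bool set"
            and \<alpha> = "\<lambda>b c. if b then cos (\<theta> - l * c) else - sin (\<theta> - l * c)"
            and \<eta> = "\<lambda>b z. cos (l * z + (if b then 0 else - (pi / 2)))"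
            and ?\<eta>1.0 = "\<lambda>b z. - l * sin (l * z + (if b then 0 else - (pi / 2)))"
            and ?\<eta>2.0 = "\<lambda>b z. - l * (l * cos (l * z + (if b then 0 else - (pi / 2))))", OF f _ e2])
        show "cos (l * (z - c) + \<theta>) = (\<Sum>b\<in>UNIV. (if b then cos (\<theta> - l * c) else - sin (\<theta> - l * c)) *
            cos (l * z + (if b then 0 else - (pi / 2))))" for c z
        proof -
          have "cos (l * (z - c) + \<theta>) = cos (l * z + (\<theta> - l * c))" by (simp add: algebra_simps)
          also have "\<dots> = cos (l * z) * cos (\<theta> - l * c) - sin (l * z) * sin (\<theta> - l * c)"
            by (rule cos_add)
          also have "sin (l * z) = cos (l * z + - (pi / 2))"
            by (simp add: cos_diff)
          finally show ?thesis by (simp add: UNIV_bool)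
        qed
        show "continuous_on UNIV (\<lambda>c. if b then cos (\<theta> - l * c) else - sin (\<theta> - l * c))" for b
          by (cases b) (auto intro!: continuous_intros)
        show "smooth_on UNIV (\<lambda>z. cos (l * z + (if b then 0 else - (pi / 2))))" for b
          by (rule smooth_on_cos)
      qed (auto intro!: derivative_eq_intros)
      \<comment> \<open>This makes the quadratic error Q h^2 at most h \<epsilon> / 2.\<close>
      define \<delta>' where "\<delta>' = min \<delta> (\<epsilon> / (2 * (Q + 1)))"
      have d': "\<delta>' > 0" using d(1) e Q by (simp add: \<delta>'_def)
      have "\<bar>H (s + h) - H s\<bar> \<le> h * (R + \<epsilon>)" if s: "0 \<le> s" and h: "0 < h" "h \<le> \<delta>'" "s + h \<le> t" for s h
      proof -
        \<comment> \<open>The weight is frozen at the later time s + h while the law moves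
          (\<open>A1\<close>); then the law is frozen at s while the weight moves
          (\<open>A2\<close>).\<close>
        let ?w = "w (s + h)"
        define X where "X = (LINT z|J s. ?w (fst z) * (- l * sn z * L f (snd z) + - l * (l * c z) * \<Gamma> f (snd z)))"
        define Y where "Y = (LINT z|J s. l\<^sup>2 * \<Gamma> f (fst z) * ?w (fst z) * c z)"
        have A1: "\<bar>H (s + h) - (LINT z|J s. ?w (fst z) * c z) - h * X\<bar> \<le> \<epsilon> / 2 * h"
          unfolding H_def X_def
          by (rule d(2)[OF s h(1) _ bdd_borel_measurable[OF bw] w1[OF h(3)]]) (use h(2) in \<open>simp add: \<delta>'_def\<close>)
        have "\<bar>LINT z|J s. ?w (fst z) * c z - w s (fst z) * c z - h * (l\<^sup>2 * \<Gamma> f (fst z) * ?w (fst z) * c z)\<bar>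
            \<le> (LINT z|J s. Q * h\<^sup>2)"
        proof (rule J_abs_integral_le[OF s])
          fix z :: "'a \<times> 'a"
          define u where "u = l\<^sup>2 * h * \<Gamma> f (fst z)"
          have u: "u \<ge> 0" "u \<le> l\<^sup>2 * h * CG"
            using h(1) \<Gamma>_nonneg[OF f, of "fst z"] CG(2)[of "fst z"] by (auto simp: u_def intro!: mult_left_mono)
          have "w s (fst z) = ?w (fst z) * exp (- u)"
            by (simp add: w_def u_def exp_add[symmetric] algebra_simps)
          then have "?w (fst z) * c z - w s (fst z) * c z - h * (l\<^sup>2 * \<Gamma> f (fst z) * ?w (fst z) * c z) =
              ?w (fst z) * c z * (1 - exp (- u) - u)"
            by (simp add: u_def algebra_simps)
          also have "\<bar>\<dots>\<bar> = \<bar>?w (fst z)\<bar> * \<bar>c z\<bar> * \<bar>1 - exp (- u) - u\<bar>" by (simp add: abs_mult)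
          also have "\<dots> \<le> 1 * 1 * u\<^sup>2"
            using w1[OF h(3)] c1 exp_minus_bounds[OF u(1)] by (intro mult_mono) auto
          also have "\<dots> \<le> (l\<^sup>2 * h * CG)\<^sup>2" using u by (simp add: power_mono)
          also have "\<dots> = Q * h\<^sup>2" by (simp add: Q_def power_mult_distrib algebra_simps)
          finally show "\<bar>?w (fst z) * c z - w s (fst z) * c z - h * (l\<^sup>2 * \<Gamma> f (fst z) * ?w (fst z) * c z)\<bar> \<le> Q * h\<^sup>2" .
        qed (intro bi)+
        also have "\<dots> = Q * h\<^sup>2" by (simp add: prob_space.prob_space[OF J_prob[OF s]])
        also have "(LINT z|J s. ?w (fst z) * c z - w s (fst z) * c z - h * (l\<^sup>2 * \<Gamma> f (fst z) * ?w (fst z) * c z))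
            = (LINT z|J s. ?w (fst z) * c z) - H s - h * Y"
        proof -
          have "integrable (J s) (\<lambda>z. ?w (fst z) * c z)" "integrable (J s) (\<lambda>z. w s (fst z) * c z)"
            "integrable (J s) (\<lambda>z. l\<^sup>2 * \<Gamma> f (fst z) * ?w (fst z) * c z)"
            by (intro J_integrable s bi)+
          then show ?thesis unfolding H_def Y_def by simp
        qed
        finally have A2: "\<bar>(LINT z|J s. ?w (fst z) * c z) - H s - h * Y\<bar> \<le> Q * h\<^sup>2" .
        \<comment> \<open>\<open>X\<close> comes from the generator and \<open>Y\<close> from the
          weight. Their leading terms differ only in evaluating \<Gamma> f at the end point or at
          the starting point, so the sum retains only the drift and the increment of \<Gamma>
          f.\<close>
        have XY: "X + Y = (LINT z|J s. ?w (fst z) * (- l * sn z * L f (snd z) + - l * (l * c z) * \<Gamma> f (snd z))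
            + l\<^sup>2 * \<Gamma> f (fst z) * ?w (fst z) * c z)"
          unfolding X_def Y_def by (intro Bochner_Integration.integral_add[symmetric] J_integrable s bi)
        have "\<bar>X + Y\<bar> \<le> (LINT z|J s. \<bar>l\<bar> * CL + l\<^sup>2 * \<bar>jump (\<Gamma> f) z\<bar>)"
          unfolding XY
        proof (rule J_abs_integral_le[OF s])
          have bdG: "bdd_borel (\<lambda>z. jump (\<Gamma> f) z)" by (intro bi)
          have babs: "bdd_borel (\<lambda>z. \<bar>jump (\<Gamma> f) z\<bar>)"
            by (rule bdd_borel_continuous[OF bdG]) (intro continuous_intros)
          show "bdd_borel (\<lambda>z. \<bar>l\<bar> * CL + l\<^sup>2 * \<bar>jump (\<Gamma> f) z\<bar>)"
            by (intro bi babs)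
          fix z :: "'a \<times> 'a"
          have "?w (fst z) * (- l * sn z * L f (snd z) + - l * (l * c z) * \<Gamma> f (snd z))
            + l\<^sup>2 * \<Gamma> f (fst z) * ?w (fst z) * c z =
            ?w (fst z) * (- (l * L f (snd z)) * sn z - l\<^sup>2 * (jump (\<Gamma> f) z) * c z)"
            by (simp add: power2_eq_square algebra_simps)
          also have "\<bar>\<dots>\<bar> = \<bar>?w (fst z)\<bar> * \<bar>- (l * L f (snd z)) * sn z - l\<^sup>2 * (jump (\<Gamma> f) z) * c z\<bar>"
            by (rule abs_mult)
          also have "\<dots> \<le> 1 * (\<bar>- (l * L f (snd z)) * sn z\<bar> + \<bar>l\<^sup>2 * (jump (\<Gamma> f) z) * c z\<bar>)"
            by (intro mult_mono w1 h abs_triangle_ineq4) auto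
          also have "\<dots> \<le> \<bar>l\<bar> * CL + l\<^sup>2 * \<bar>jump (\<Gamma> f) z\<bar>"
          proof -
            have "\<bar>- (l * L f (snd z)) * sn z\<bar> = (\<bar>l\<bar> * \<bar>L f (snd z)\<bar>) * \<bar>sn z\<bar>" by (simp add: abs_mult)
            also have "\<dots> \<le> (\<bar>l\<bar> * CL) * 1" by (intro mult_mono c1 CL) (auto simp: CL)
            finally have 1: "\<bar>- (l * L f (snd z)) * sn z\<bar> \<le> \<bar>l\<bar> * CL" by simp
            have "\<bar>l\<^sup>2 * (jump (\<Gamma> f) z) * c z\<bar> = l\<^sup>2 * \<bar>jump (\<Gamma> f) z\<bar> * \<bar>c z\<bar>" by (simp add: abs_mult)
            also have "\<dots> \<le> l\<^sup>2 * \<bar>jump (\<Gamma> f) z\<bar> * 1" by (intro mult_left_mono c1) auto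
            finally show ?thesis using 1 by simp
          qed
          finally show "\<bar>?w (fst z) * (- l * sn z * L f (snd z) + - l * (l * c z) * \<Gamma> f (snd z))
            + l\<^sup>2 * \<Gamma> f (fst z) * ?w (fst z) * c z\<bar> \<le> \<bar>l\<bar> * CL + l\<^sup>2 * \<bar>jump (\<Gamma> f) z\<bar>" .
        qed (intro bi)+
        also have "\<dots> = \<bar>l\<bar> * CL + l\<^sup>2 * (LINT z|J s. \<bar>jump (\<Gamma> f) z\<bar>)"
        proof -
          have "integrable (J s) (\<lambda>z. jump (\<Gamma> f) z)"
            by (intro J_integrable s bi)
          then have "integrable (J s) (\<lambda>z. \<bar>jump (\<Gamma> f) z\<bar>)" by (rule integrable_abs)
          moreover have "integrable (J s) (\<lambda>_. \<bar>l\<bar> * CL)" by (intro J_integrable s bi)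
          ultimately show ?thesis
            by (simp add: prob_space.prob_space[OF J_prob[OF s]])
        qed
        also have "\<dots> \<le> R"
        proof -
          have "(LINT z|J s. \<bar>jump (\<Gamma> f) z\<bar>) \<le> CM * sqrt s" by (rule CM(2)[OF s])
          also have "\<dots> \<le> CM * sqrt t" using s h by (intro mult_left_mono CM) auto
          finally show ?thesis unfolding R_def by (intro add_mono mult_left_mono) auto
        qed
        finally have A3: "\<bar>X + Y\<bar> \<le> R" .
        have "Q * h \<le> (Q + 1) * (\<epsilon> / (2 * (Q + 1)))"
          using h Q by (intro mult_mono) (auto simp: \<delta>'_def)
        also have "\<dots> = \<epsilon> / 2"
        proof -
          have "a * (\<epsilon> / (2 * a)) = \<epsilon> / 2" if "a > 0" for a using that by simp
          from this[of "Q + 1"] show ?thesis using Q by linarith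
        qed
        finally have "Q * h \<le> \<epsilon> / 2" .
        then have A4: "Q * h\<^sup>2 \<le> \<epsilon> / 2 * h"
          using mult_right_mono[of "Q * h" "\<epsilon> / 2" h] h by (simp add: power2_eq_square mult.assoc)
        have A5: "\<bar>h * (X + Y)\<bar> \<le> h * R"
          using A3 h by (simp add: abs_mult)
        have "\<bar>H (s + h) - H s\<bar> \<le> \<epsilon> / 2 * h + \<epsilon> / 2 * h + h * R"
          using A1 A2 A4 A5 by (simp only: distrib_left)
        then show ?thesis by (simp add: algebra_simps)
      qed
      then show ?thesis using d' by blast
    qed
    have up: "H t - H 0 \<le> t * R"
    proof (rule telescoping_bound)
      show "\<exists>\<delta>>0. \<forall>s h. 0 \<le> s \<longrightarrow> 0 < h \<longrightarrow> h \<le> \<delta> \<longrightarrow> s + h \<le> t \<longrightarrow> H (s + h) - H s \<le> h * (R + \<epsilon>)" if "\<epsilon> > 0" for \<epsilon>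
        using step[OF that] by (meson abs_le_D1)
    qed (use t in simp)
    have "(\<lambda>r. - H r) t - (\<lambda>r. - H r) 0 \<le> t * R"
    proof (rule telescoping_bound)
      show "\<exists>\<delta>>0. \<forall>s h. 0 \<le> s \<longrightarrow> 0 < h \<longrightarrow> h \<le> \<delta> \<longrightarrow> s + h \<le> t \<longrightarrow> - H (s + h) - (- H s) \<le> h * (R + \<epsilon>)" if e: "\<epsilon> > 0" for \<epsilon>
      proof -
        obtain \<delta> where "\<delta> > 0" "\<And>s h. 0 \<le> s \<Longrightarrow> 0 < h \<Longrightarrow> h \<le> \<delta> \<Longrightarrow> s + h \<le> t \<Longrightarrow> \<bar>H (s + h) - H s\<bar> \<le> h * (R + \<epsilon>)"
          using step[OF e] by meson
        then show ?thesis by (intro exI[of _ \<delta>]) (auto simp: abs_le_iff)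
      qed
    qed (use t in simp)
    with up have "\<bar>H t - H 0\<bar> \<le> t * R" by (simp add: abs_le_iff)
    moreover have "t * R = K * sqrt t"
      unfolding R_def K_def distrib_left distrib_right
      using lt l2 by (simp add: mult_ac)
    moreover have "H t = (LINT z|J t. cos (\<xi> / sqrt t * (jump f z) + \<theta>))"
      unfolding H_def by (simp add: w_def c_def l_def)
    moreover have "H 0 = (LINT x|m0. cos \<theta> * exp (- (\<xi>\<^sup>2 * \<Gamma> f x)))"
      unfolding H_def by (subst J_0) (intro bi, simp add: w_def c_def l2[unfolded mult.commute[of "l\<^sup>2"]] mult.commute)
    ultimately show ?thesis by simp
  qed
  then show ?thesis using K by blast
qed

lemma char_increment_tendsto:
  assumes f: "f \<in> D"
  shows "((\<lambda>t. LINT z|J t. cos (\<xi> / sqrt t * (jump f z) + \<theta>)) \<longlongrightarrow>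
      (LINT x|m0. cos \<theta> * exp (- (\<xi>\<^sup>2 * \<Gamma> f x)))) (at_right 0)"
proof -
  obtain K where K: "\<And>t. t > 0 \<Longrightarrow> \<bar>(LINT z|J t. cos (\<xi> / sqrt t * (jump f z) + \<theta>))
      - (LINT x|m0. cos \<theta> * exp (- (\<xi>\<^sup>2 * \<Gamma> f x)))\<bar> \<le> K * sqrt t"
    using char_increment_bound[OF f] by blast
  have "((\<lambda>t. K * sqrt t) \<longlongrightarrow> 0) (at_right 0)"
    by (auto intro!: tendsto_eq_intros)
  moreover have "eventually (\<lambda>t. norm ((LINT z|J t. cos (\<xi> / sqrt t * (jump f z) + \<theta>))
      - (LINT x|m0. cos \<theta> * exp (- (\<xi>\<^sup>2 * \<Gamma> f x)))) \<le> K * sqrt t) (at_right 0)"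
    by (rule eventually_mono[OF eventually_at_right_less[of 0]]) (use K in \<open>simp only: real_norm_def\<close>)
  ultimately show ?thesis
    by (rule LIM_zero_cancel[OF Lim_null_comparison[rotated]])
qed

lemma bdd_borel_increment:
  assumes "f \<in> D" shows "bdd_borel (\<lambda>z. jump f z / c)"
  using bdd_borel_mult[OF bdd_borel_diff[OF bdd_borel_snd bdd_borel_fst] bdd_borel_const[of "1 / c"]]
    D_bdd_borel[OF assms] by force

text \<open>A real exponent is reduced to an even integer one by |u|^q \<le> 1 + u^(2j) with j \<ge>
  q; the factor t^j cancels against the normalisation.\<close>

lemma powr_moment_bound:
  assumes f: "f \<in> D" and q: "q > 0"
  shows "\<exists>C\<ge>0. \<forall>t>0. (LINT z|J t. \<bar>jump f z / sqrt t\<bar> powr q) \<le> C"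
proof -
  obtain j :: nat where j: "real j \<ge> q" using real_arch_simple by blast
  obtain C where C: "C \<ge> 0" "\<And>t. t \<ge> 0 \<Longrightarrow> (LINT z|J t. jump f z ^ (2 * j)) \<le> C * t ^ j"
    using moment_bound[OF f, of j] by blast
  have bd: "bdd_borel (\<lambda>z. jump f z)" by (intro bdd_borel_intros D_bdd_borel f)
  have le: "\<bar>u\<bar> powr q \<le> 1 + u ^ (2 * j)" for u :: real
  proof (cases "\<bar>u\<bar> \<le> 1")
    case True
    then have "\<bar>u\<bar> powr q \<le> 1 powr q" using q by (intro powr_mono2) auto
    moreover have "u ^ (2 * j) \<ge> 0" by (simp add: power_mult)
    ultimately show ?thesis unfolding powr_one_eq_one by linarith
  next
    case False
    then have "\<bar>u\<bar> powr q \<le> \<bar>u\<bar> powr (real (2 * j))" using j q by (intro powr_mono) auto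
    also have "\<dots> = \<bar>u\<bar> ^ (2 * j)" using False by (intro powr_realpow) auto
    also have "\<dots> = u ^ (2 * j)" by (simp add: power_mult)
    finally show ?thesis by simp
  qed
  have "(LINT z|J t. \<bar>jump f z / sqrt t\<bar> powr q) \<le> 1 + C" if t0: "t > 0" for t
  proof -
    have t: "t \<ge> 0" using t0 by simp
    have "(LINT z|J t. \<bar>jump f z / sqrt t\<bar> powr q)
        \<le> (LINT z|J t. 1 + inverse (t ^ j) * jump f z ^ (2 * j))"
    proof (rule integral_mono)
      fix z
      have "sqrt t ^ (2 * j) = t ^ j" using t by (simp add: power_mult)
      then have "(jump f z / sqrt t) ^ (2 * j) = inverse (t ^ j) * jump f z ^ (2 * j)"
        unfolding power_divide by (simp only: divide_inverse mult.commute)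
      then show "\<bar>jump f z / sqrt t\<bar> powr q \<le> 1 + inverse (t ^ j) * jump f z ^ (2 * j)"
        using le[of "jump f z / sqrt t"] by metis
      show "integrable (J t) (\<lambda>z. \<bar>jump f z / sqrt t\<bar> powr q)"
        by (intro J_integrable t bdd_borel_powr_abs bdd_borel_increment f q)
      show "integrable (J t) (\<lambda>z. 1 + inverse (t ^ j) * jump f z ^ (2 * j))"
        by (intro J_integrable t bdd_borel_intros D_bdd_borel f)
    qed
    also have "\<dots> = 1 + inverse (t ^ j) * (LINT z|J t. jump f z ^ (2 * j))"
      using J_integrable[OF t bdd_borel_power[OF bd]] J_integrable[OF t bdd_borel_const]
      by (simp add: prob_space.prob_space[OF J_prob[OF t]])
    also have "\<dots> \<le> 1 + inverse (t ^ j) * (C * t ^ j)"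
      using t by (intro add_left_mono mult_left_mono C) auto
    also have "inverse (t ^ j) * (C * t ^ j) = C"
      using t0 by simp
    finally show ?thesis .
  qed
  then show ?thesis using C(1) by (intro exI[of _ "1 + C"]) auto
qed

section \<open>Convergence of the absolute moments\<close>

text \<open>Levy's theorem is about sequences, hence the passage to arbitrary \<open>T\<close>
  tending to 0 from the right. The uniform moment of order 2p upgrades weak convergence to
  convergence of the p-th moment.\<close>

lemma moment_tendsto:
  assumes f: "f \<in> D" and p: "p > 0"
  shows "((\<lambda>t. LINT z|J t. \<bar>jump f z / sqrt t\<bar> powr p) \<longlongrightarrow>
    2 powr p * (Gamma ((1 + p) / 2) / sqrt pi) * (LINT x|m0. \<Gamma> f x powr (p / 2))) (at_right 0)"
  unfolding tendsto_at_iff_sequentially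
proof (intro allI impI)
  fix T :: "nat \<Rightarrow> real"
  assume T: "\<forall>i. T i \<in> {0<..} - {0}" and T0: "T \<longlonglongrightarrow> 0"
  have Tp: "T n > 0" for n using T by simp
  have Tr: "filterlim T (at_right 0) sequentially"
    using T0 Tp less_imp_neq[OF Tp] by (auto simp: filterlim_at intro!: always_eventually)
  define Z where "Z t z = jump f z / sqrt t" for t z
  define \<nu> where "\<nu> n = distr (J (T n)) borel (Z (T n))" for n
  let ?N = "std_normal_distribution"
  interpret N: real_distribution ?N by (rule real_dist_normal_dist)
  interpret mN: pair_prob_space m0 ?N ..
  \<comment> \<open>The limit is realised on a product space: a standard normal variable,
    independent of the starting point, scaled to variance 2 \<Gamma> f.\<close>
  define W where "W z = sqrt (2 * \<Gamma> f (fst z)) * snd z" for z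
  define \<nu>' where "\<nu>' = distr (m0 \<Otimes>\<^sub>M ?N) borel W"
  note bi = bdd_borel_intros D_bdd_borel[OF f] D_bdd_borel[OF D_L[OF f]] D_bdd_borel[OF D_\<Gamma>[OF f]]
  have bd: "bdd_borel (\<lambda>z. jump f z)" by (intro bi)
  have bZ: "bdd_borel (Z t)" for t
    unfolding Z_def using bdd_borel_mult[OF bd bdd_borel_const[of "1 / sqrt t"]] by simp
  have mZ: "Z t \<in> borel_measurable (J s)" if "s \<ge> 0" for t s
    using bdd_borel_measurable[OF bZ] measurable_cong_sets[OF sets_J[OF that] refl] by blast
  have m\<Gamma>: "\<Gamma> f \<in> borel_measurable m0"
    using D_measurable[OF D_\<Gamma>[OF f]] by (simp add: measurable_m0)
  have mW: "W \<in> borel_measurable (m0 \<Otimes>\<^sub>M ?N)"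
    unfolding W_def using m\<Gamma> by measurable
  have rd: "real_distribution (\<nu> n)" for n
    unfolding \<nu>_def using Tp[of n] by (intro prob_space.real_distribution_distr J_prob mZ) auto
  have rd': "real_distribution \<nu>'"
    unfolding \<nu>'_def by (intro mN.real_distribution_distr mW)
  have char_\<nu>: "char (\<nu> n) \<xi> = Complex (LINT z|J (T n). cos (\<xi> / sqrt (T n) * (jump f z) + 0))
      (LINT z|J (T n). cos (\<xi> / sqrt (T n) * (jump f z) + - (pi / 2)))" for n \<xi>
  proof -
    have t: "T n \<ge> 0" using Tp[of n] by simp
    interpret prob_space "J (T n)" by (rule J_prob[OF t])
    have "char (\<nu> n) \<xi> = (CLINT z|J (T n). iexp (\<xi> * Z (T n) z))"
      unfolding char_def \<nu>_def by (rule integral_distr[OF mZ[OF t]]) simp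
    moreover have "integrable (J (T n)) (\<lambda>z. iexp (\<xi> * Z (T n) z))"
      using mZ[OF t] by (intro integrable_const_bound[of _ 1]) auto
    ultimately have "Re (char (\<nu> n) \<xi>) = (LINT z|J (T n). Re (iexp (\<xi> * Z (T n) z)))"
      "Im (char (\<nu> n) \<xi>) = (LINT z|J (T n). Im (iexp (\<xi> * Z (T n) z)))"
      by simp_all
    moreover have "Re (iexp (\<xi> * Z (T n) z)) = cos (\<xi> / sqrt (T n) * (jump f z) + 0)"
      "Im (iexp (\<xi> * Z (T n) z)) = cos (\<xi> / sqrt (T n) * (jump f z) + - (pi / 2))" for z
      by (simp_all add: Z_def Re_exp Im_exp cos_diff)
    ultimately show ?thesis
      by (simp only: complex_eq_iff complex.sel)
  qed
  have char_\<nu>': "char \<nu>' \<xi> = complex_of_real (LINT x|m0. exp (- (\<xi>\<^sup>2 * \<Gamma> f x)))" for \<xi>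
  proof -
    have "char \<nu>' \<xi> = (CLINT z|m0 \<Otimes>\<^sub>M ?N. iexp (\<xi> * W z))"
      unfolding char_def \<nu>'_def by (rule integral_distr[OF mW]) simp
    also have "\<dots> = (CLINT x|m0. (CLINT y|?N. iexp (\<xi> * W (x, y))))"
      by (rule mN.integral_fst'[symmetric]) (use mW in \<open>intro mN.integrable_const_bound[of _ 1]; auto\<close>)
    also have "\<dots> = (CLINT x|m0. complex_of_real (exp (- (\<xi>\<^sup>2 * \<Gamma> f x))))"
    proof (rule Bochner_Integration.integral_cong[OF refl])
      fix x
      have "(CLINT y|?N. iexp (\<xi> * W (x, y))) = char ?N (\<xi> * sqrt (2 * \<Gamma> f x))"
        by (simp add: char_def W_def mult.assoc)
      also have "\<dots> = complex_of_real (exp (- ((\<xi> * sqrt (2 * \<Gamma> f x))\<^sup>2) / 2))"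
        by (simp only: char_std_normal_distribution)
      also have "(\<xi> * sqrt (2 * \<Gamma> f x))\<^sup>2 = 2 * (\<xi>\<^sup>2 * \<Gamma> f x)"
        using \<Gamma>_nonneg[OF f, of x] by (simp add: power_mult_distrib)
      finally show "(CLINT y|?N. iexp (\<xi> * W (x, y))) = complex_of_real (exp (- (\<xi>\<^sup>2 * \<Gamma> f x)))" by simp
    qed
    finally show ?thesis by simp
  qed
  have conv: "(\<lambda>n. char (\<nu> n) \<xi>) \<longlonglongrightarrow> char \<nu>' \<xi>" for \<xi>
  proof -
    note lim = filterlim_compose[OF char_increment_tendsto[OF f, of \<xi>] Tr]
    \<comment> \<open>The imaginary part carries the factor cos(- pi/2) = 0, matching the symmetry
      of the limit law.\<close>
    have "(\<lambda>n. char (\<nu> n) \<xi>) \<longlonglongrightarrow> Complex (LINT x|m0. cos 0 * exp (- (\<xi>\<^sup>2 * \<Gamma> f x)))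
        (LINT x|m0. cos (- (pi / 2)) * exp (- (\<xi>\<^sup>2 * \<Gamma> f x)))"
      unfolding char_\<nu> by (intro tendsto_Complex lim)
    then show ?thesis by (simp add: char_\<nu>' complex_of_real_def)
  qed
  have pw: "bdd_borel (\<lambda>z. \<bar>Z t z\<bar> powr q)" if "q > 0" for t q
    by (rule bdd_borel_continuous[OF bZ]) (intro continuous_on_powr' continuous_intros, use that in simp)
  have i: "integrable (\<nu> n) (\<lambda>x. \<bar>x\<bar> powr (2 * p))" for n
    unfolding \<nu>_def using Tp[of n] p
    by (subst integrable_distr_eq[OF mZ]) (auto intro!: J_integrable pw)
  obtain C where C: "\<And>t. t > 0 \<Longrightarrow> (LINT z|J t. \<bar>jump f z / sqrt t\<bar> powr (2 * p)) \<le> C"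
    using powr_moment_bound[OF f, of "2 * p"] p by auto
  have b: "(LINT x|\<nu> n. \<bar>x\<bar> powr (2 * p)) \<le> C" for n
    unfolding \<nu>_def using C[OF Tp[of n]] Tp[of n] by (subst integral_distr[OF mZ]) (auto simp: Z_def)
  have mom: "integrable ?N (\<lambda>y. \<bar>y\<bar> powr q)" "(LINT y|?N. \<bar>y\<bar> powr q) = 2 powr (q / 2) * (Gamma ((1 + q) / 2) / sqrt pi)"
    if "q > 0" for q
    using std_normal_abs_moment[of q] that by (auto simp: has_bochner_integral_iff)
  have Wq: "\<bar>W (x, y)\<bar> powr q = 2 powr (q / 2) * \<Gamma> f x powr (q / 2) * \<bar>y\<bar> powr q" for x y q
    using \<Gamma>_nonneg[OF f, of x]
    by (simp add: W_def abs_mult powr_mult powr_half_sqrt[symmetric] powr_powr)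
  have \<Gamma>q: "integrable m0 (\<lambda>x. \<Gamma> f x powr (q / 2))" if "q > 0" for q
  proof -
    have "bdd_borel (\<lambda>x. \<bar>\<Gamma> f x\<bar> powr (q / 2))"
      by (rule bdd_borel_continuous[OF D_bdd_borel[OF D_\<Gamma>[OF f]]]) (intro continuous_on_powr' continuous_intros, use that in simp)
    then show ?thesis
      using \<Gamma>_nonneg[OF f] by (intro bdd_borel_integrable[OF m0.prob_space_axioms sets_m0]) simp
  qed
  have iW: "integrable (m0 \<Otimes>\<^sub>M ?N) (\<lambda>z. \<bar>W z\<bar> powr q)" if "q > 0" for q
  proof (rule mN.Fubini_integrable)
    show "(\<lambda>z. \<bar>W z\<bar> powr q) \<in> borel_measurable (m0 \<Otimes>\<^sub>M ?N)" using mW by measurable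
    show "integrable m0 (\<lambda>x. LINT y|?N. norm (\<bar>W (x, y)\<bar> powr q))"
      using \<Gamma>q[OF that] by (simp add: Wq abs_mult)
    show "AE x in m0. integrable ?N (\<lambda>y. \<bar>W (x, y)\<bar> powr q)"
      using mom(1)[OF that] by (simp add: Wq)
  qed
  have i': "integrable \<nu>' (\<lambda>x. \<bar>x\<bar> powr (2 * p))"
    unfolding \<nu>'_def using iW[of "2 * p"] p by (subst integrable_distr_eq[OF mW]) auto
  have "(LINT x|\<nu>'. \<bar>x\<bar> powr p) = (LINT z|(m0 \<Otimes>\<^sub>M ?N). \<bar>W z\<bar> powr p)"
    unfolding \<nu>'_def by (rule integral_distr[OF mW]) simp
  also have "\<dots> = (LINT x|m0. (LINT y|?N. \<bar>W (x, y)\<bar> powr p))"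
    by (rule mN.integral_fst'[symmetric, OF iW[OF p]])
  \<comment> \<open>One factor 2^(p/2) stems from the variance 2 \<Gamma> f, the other from the
    normal moment.\<close>
  also have "\<dots> = 2 powr (p / 2) * (2 powr (p / 2) * (Gamma ((1 + p) / 2) / sqrt pi)) * (LINT x|m0. \<Gamma> f x powr (p / 2))"
    unfolding Wq using mom(2)[OF p] by (simp add: mult_ac)
  also have "\<dots> = 2 powr p * (Gamma ((1 + p) / 2) / sqrt pi) * (LINT x|m0. \<Gamma> f x powr (p / 2))"
    by (simp add: mult.assoc[symmetric] powr_add[symmetric])
  finally have "(\<lambda>n. LINT x|\<nu> n. \<bar>x\<bar> powr p) \<longlonglongrightarrow> 2 powr p * (Gamma ((1 + p) / 2) / sqrt pi) * (LINT x|m0. \<Gamma> f x powr (p / 2))"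
    using abs_moment_tendsto[OF rd rd' conv p i b i'] by simp
  moreover have "(LINT x|\<nu> n. \<bar>x\<bar> powr p) = (LINT z|J (T n). \<bar>Z (T n) z\<bar> powr p)" for n
    unfolding \<nu>_def using Tp[of n] by (intro integral_distr[OF mZ]) auto
  ultimately show "((\<lambda>t. LINT z|J t. \<bar>jump f z / sqrt t\<bar> powr p) \<circ> T) \<longlonglongrightarrow>
    2 powr p * (Gamma ((1 + p) / 2) / sqrt pi) * (LINT x|m0. \<Gamma> f x powr (p / 2))"
    by (simp add: o_def Z_def)
qed

end

section \<open>Increments over Borel sets\<close>

context diffusion_semigroup begin

section \<open>Unnormalised increments and symmetry of the kernel\<close>

lemma kernel_nn_integral_measurable:
  assumes "s \<ge> 0" "F \<in> borel_measurable borel"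
  shows "(\<lambda>x. \<integral>\<^sup>+y. F (x, y) \<partial>\<kappa> s x) \<in> borel_measurable borel"
proof (rule nn_integral_measurable_subprob_algebra2)
  show "(\<lambda>(x, y). F (x, y)) \<in> borel_measurable (borel \<Otimes>\<^sub>M borel)"
    using assms(2) by (simp add: borel_prod split_beta)
  show "\<kappa> s \<in> borel \<rightarrow>\<^sub>M subprob_algebra borel"
    by (rule measurable_prob_algebraD[OF \<kappa>_measurable[OF assms(1)]])
qed

text \<open>The p-th power of \<open>heat_increment\<close>, before the root is taken, with the end
  point also confined to a set C; the case of a complement isolates the contribution of leaving a
  set.\<close>

definition increment :: "real \<Rightarrow> ('a \<Rightarrow> real) \<Rightarrow> real \<Rightarrow> 'a set \<Rightarrow> 'a set \<Rightarrow> ennreal" where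
  "increment p f t A C = (\<integral>\<^sup>+x\<in>A. (\<integral>\<^sup>+y\<in>C. ennreal (\<bar>f y - f x\<bar> powr p) \<partial>k t x) \<partial>M)"

lemma \<kappa>_pos: "t > 0 \<Longrightarrow> \<kappa> t = k t"
  by (auto simp: \<kappa>_def)

lemma diff_powr_measurable:
  assumes "f \<in> D"
  shows "(\<lambda>z. \<bar>jump f z\<bar> powr p) \<in> borel_measurable borel"
proof -
  have "(\<lambda>z. \<bar>jump f z\<bar> powr p) \<in> borel_measurable (borel \<Otimes>\<^sub>M borel)"
    using D_measurable[OF assms] by simp
  then show ?thesis by (simp add: borel_prod)
qed

lemma indicator_snd_measurable:
  assumes "C \<in> sets borel"
  shows "(\<lambda>z::'a \<times> 'a. indicator C (snd z) :: 'b::{real_normed_algebra_1,second_countable_topology}) \<in> borel_measurable borel"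
proof -
  have "(\<lambda>z::'a \<times> 'a. indicator C (snd z) :: 'b) \<in> borel_measurable (borel \<Otimes>\<^sub>M borel)"
    using assms by (intro measurable_compose[OF measurable_snd borel_measurable_indicator])
  then show ?thesis by (simp add: borel_prod)
qed

lemma inner_increment_measurable:
  assumes "t > 0" "f \<in> D" "C \<in> sets borel"
  shows "(\<lambda>x. \<integral>\<^sup>+y\<in>C. ennreal (\<bar>f y - f x\<bar> powr p) \<partial>k t x) \<in> borel_measurable borel"
proof -
  have "(\<lambda>z::'a \<times> 'a. ennreal (\<bar>jump f z\<bar> powr p * indicator C (snd z))) \<in> borel_measurable borel"
    using diff_powr_measurable[OF assms(2), of p] indicator_snd_measurable[OF assms(3), where 'b = real] by simp
  from kernel_nn_integral_measurable[OF less_imp_le[OF assms(1)] this] show ?thesis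
    by (simp add: \<kappa>_pos[OF assms(1)] ennreal_mult'' ennreal_indicator)
qed

lemma increment_Un:
  assumes "t > 0" "f \<in> D" "A \<in> sets borel" "B \<in> sets borel" "A \<inter> B = {}" "C \<in> sets borel"
  shows "increment p f t (A \<union> B) C = increment p f t A C + increment p f t B C"
proof -
  have "increment p f t (A \<union> B) C = (\<integral>\<^sup>+x. (\<integral>\<^sup>+y\<in>C. ennreal (\<bar>f y - f x\<bar> powr p) \<partial>k t x) * indicator A x
      + (\<integral>\<^sup>+y\<in>C. ennreal (\<bar>f y - f x\<bar> powr p) \<partial>k t x) * indicator B x \<partial>M)"
    unfolding increment_def using assms(5) by (intro nn_integral_cong) (auto split: split_indicator)
  also have "\<dots> = increment p f t A C + increment p f t B C"
    unfolding increment_def using inner_increment_measurable[OF assms(1,2,6)] assms(3,4)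
    by (intro nn_integral_add) (auto simp: sets_M)
  finally show ?thesis .
qed

lemma increment_mono: "A \<subseteq> A' \<Longrightarrow> increment p f t A C \<le> increment p f t A' C"
  unfolding increment_def by (intro nn_integral_mono) (auto split: split_indicator)

text \<open>Symmetry of the semigroup extends from sets of finite measure to arbitrary Borel sets by exhaustion.\<close>

lemma kernel_symmetric:
  assumes t: "t > 0" and g: "g \<in> Lp 2 M" "\<And>x. g x \<ge> 0" and B: "B \<in> sets borel"
  shows "(\<integral>\<^sup>+x\<in>B. (\<integral>\<^sup>+y. ennreal (g y) \<partial>k t x) \<partial>M) = (\<integral>\<^sup>+x. ennreal (g x) * emeasure (k t x) B \<partial>M)"
proof -
  have t0: "t \<ge> 0" using t by simp
  have gm: "g \<in> borel_measurable borel" using g(1) by (simp add: Lp2_iff)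
  have ks: "sets (k t x) = sets borel" "prob_space (k t x)" for x
    using \<kappa>_sets[OF t0, of x] \<kappa>_prob[OF t0, of x] by (simp_all add: \<kappa>_pos[OF t])
  have kint: "AE x in M. integrable (k t x) h \<and> P t h x = (LINT y|k t x. h y)" if "h \<in> Lp 2 M" for h
    using kernel that t unfolding heat_kernel_def by simp
  \<comment> \<open>For finite measure the indicator of B is in L^2, and the identity is the
    symmetry of \<open>P t\<close> written through kernels.\<close>
  have fin: "(\<integral>\<^sup>+x\<in>B. (\<integral>\<^sup>+y. ennreal (g y) \<partial>k t x) \<partial>M) = (\<integral>\<^sup>+x. ennreal (g x) * emeasure (k t x) B \<partial>M)"
    if B: "B \<in> sets borel" "emeasure M B < \<infinity>" for B
  proof -
    have iB: "indicator B \<in> Lp 2 M"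
      using B by (intro Lp2_bounded_support[of _ _ 1 B]) (auto simp: sets_M split: split_indicator)
    have "(\<integral>\<^sup>+x\<in>B. (\<integral>\<^sup>+y. ennreal (g y) \<partial>k t x) \<partial>M) = (\<integral>\<^sup>+x. ennreal (indicator B x * P t g x) \<partial>M)"
    proof (rule nn_integral_cong_AE, rule AE_mp[OF kint[OF g(1)] AE_I2], rule impI)
      fix x assume "integrable (k t x) g \<and> P t g x = (LINT y|k t x. g y)"
      then show "(\<integral>\<^sup>+y. ennreal (g y) \<partial>k t x) * indicator B x = ennreal (indicator B x * P t g x)"
        using g(2) by (simp add: nn_integral_eq_integral split: split_indicator)
    qed
    also have "\<dots> = ennreal (LINT x|M. indicator B x * P t g x)"
    proof (rule nn_integral_eq_integral)
      show "integrable M (\<lambda>x. indicator B x * P t g x)"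
        by (rule Lp2_integrable_mult[OF iB P_Lp2[OF t0 g(1)]])
      show "AE x in M. 0 \<le> indicator B x * P t g x"
        by (rule AE_mp[OF kint[OF g(1)] AE_I2]) (use g(2) in \<open>simp add: integral_nonneg_AE\<close>)
    qed
    also have "(LINT x|M. indicator B x * P t g x) = (LINT x|M. g x * P t (indicator B) x)"
      using P_symmetric[OF t0 iB g(1)] by (simp add: mult.commute)
    also have "ennreal \<dots> = (\<integral>\<^sup>+x. ennreal (g x * P t (indicator B) x) \<partial>M)"
    proof (rule nn_integral_eq_integral[symmetric])
      show "integrable M (\<lambda>x. g x * P t (indicator B) x)"
        by (rule Lp2_integrable_mult[OF g(1) P_Lp2[OF t0 iB]])
      show "AE x in M. 0 \<le> g x * P t (indicator B) x"
        by (rule AE_mp[OF kint[OF iB] AE_I2]) (use g(2) in \<open>simp add: integral_nonneg_AE\<close>)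
    qed
    also have "\<dots> = (\<integral>\<^sup>+x. ennreal (g x) * emeasure (k t x) B \<partial>M)"
    proof (rule nn_integral_cong_AE, rule AE_mp[OF kint[OF iB] AE_I2], rule impI)
      fix x assume *: "integrable (k t x) (indicator B :: 'a \<Rightarrow> real) \<and> P t (indicator B) x = (LINT y|k t x. indicator B y)"
      interpret prob_space "k t x" by (rule ks)
      have "P t (indicator B) x = measure (k t x) B"
        using * B sets_eq_imp_space_eq[OF ks(1), of x] by simp
      then show "ennreal (g x * P t (indicator B) x) = ennreal (g x) * emeasure (k t x) B"
        using g(2)[of x] by (simp add: ennreal_mult emeasure_eq_measure)
    qed
    finally show ?thesis .
  qed
  obtain E :: "nat \<Rightarrow> 'a set" where E: "range E \<subseteq> sets M" "(\<Union>i. E i) = space M" "\<And>i. emeasure M (E i) \<noteq> \<infinity>" "incseq E"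
    by (rule sigma_finite_measure.sigma_finite_incseq[OF sigma_finite]) blast
  define B' where "B' i = B \<inter> E i" for i
  have B'm: "B' i \<in> sets borel" for i using E(1) B by (auto simp: B'_def sets_M)
  have B'f: "emeasure M (B' i) < \<infinity>" for i
  proof -
    have "emeasure M (B' i) \<le> emeasure M (E i)"
      using E(1) by (intro emeasure_mono) (auto simp: B'_def)
    then show ?thesis using E(3)[of i] by (simp add: less_top le_less_trans top.not_eq_extremum)
  qed
  have inc: "incseq B'" using E(4) by (auto simp: incseq_def B'_def)
  have un: "(\<Union>i. B' i) = B" using E(2) by (auto simp: B'_def space_M)
  have m1: "(\<lambda>x. \<integral>\<^sup>+y. ennreal (g y) \<partial>k t x) \<in> borel_measurable borel"
  proof -
    have "(\<lambda>z::'a \<times> 'a. ennreal (g (snd z))) \<in> borel_measurable (borel \<Otimes>\<^sub>M borel)" using gm by simp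
    then have "(\<lambda>z::'a \<times> 'a. ennreal (g (snd z))) \<in> borel_measurable borel" by (simp add: borel_prod)
    from kernel_nn_integral_measurable[OF t0 this] show ?thesis by (simp add: \<kappa>_pos[OF t])
  qed
  have m2: "(\<lambda>x. emeasure (k t x) C) \<in> borel_measurable borel" if "C \<in> sets borel" for C
    using measurable_emeasure_kernel[OF measurable_prob_algebraD[OF \<kappa>_measurable[OF t0]] that] by (simp add: \<kappa>_pos[OF t])
  have indS: "(SUP i. c * indicator (B' i) x) = c * indicator B x" for c :: ennreal and x
  proof -
    have "(SUP i. c * indicator (B' i) x) = c * (SUP i. indicator (B' i) x)"
      by (rule SUP_mult_left_ennreal[symmetric])
    \<comment> \<open>This is continuity from below of the Dirac measure at x.\<close>
    also have "(SUP i. indicator (B' i) x) = (indicator B x :: ennreal)"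
      using SUP_emeasure_incseq[of B' "return borel x"] B'm inc un B by (simp add: image_subset_iff)
    finally show ?thesis .
  qed
  have "(\<integral>\<^sup>+x\<in>B. (\<integral>\<^sup>+y. ennreal (g y) \<partial>k t x) \<partial>M) = (\<integral>\<^sup>+x. (SUP i. (\<integral>\<^sup>+y. ennreal (g y) \<partial>k t x) * indicator (B' i) x) \<partial>M)"
    by (simp only: indS)
  also have "\<dots> = (SUP i. \<integral>\<^sup>+x\<in>B' i. (\<integral>\<^sup>+y. ennreal (g y) \<partial>k t x) \<partial>M)"
  proof (rule nn_integral_monotone_convergence_SUP)
    show "incseq (\<lambda>i x. (\<integral>\<^sup>+y. ennreal (g y) \<partial>k t x) * indicator (B' i) x)"
      using inc by (auto simp: incseq_def le_fun_def split: split_indicator)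
    show "(\<lambda>x. (\<integral>\<^sup>+y. ennreal (g y) \<partial>k t x) * indicator (B' i) x) \<in> borel_measurable M" for i
      using m1 B'm[of i] by (simp add: sets_M)
  qed
  also have "\<dots> = (SUP i. \<integral>\<^sup>+x. ennreal (g x) * emeasure (k t x) (B' i) \<partial>M)"
    by (simp only: fin[OF B'm B'f])
  also have "\<dots> = (\<integral>\<^sup>+x. (SUP i. ennreal (g x) * emeasure (k t x) (B' i)) \<partial>M)"
  proof (rule nn_integral_monotone_convergence_SUP[symmetric])
    show "incseq (\<lambda>i x. ennreal (g x) * emeasure (k t x) (B' i))"
      using inc B'm ks(1) by (auto simp: incseq_def le_fun_def intro!: mult_left_mono emeasure_mono)
    show "(\<lambda>x. ennreal (g x) * emeasure (k t x) (B' i)) \<in> borel_measurable M" for i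
      using gm m2[OF B'm[of i]] by simp
  qed
  also have "\<dots> = (\<integral>\<^sup>+x. ennreal (g x) * emeasure (k t x) B \<partial>M)"
  proof (rule nn_integral_cong)
    fix x
    have "(SUP i. emeasure (k t x) (B' i)) = emeasure (k t x) B"
      using SUP_emeasure_incseq[of B' "k t x"] B'm inc un ks(1)[of x] by (simp add: image_subset_iff)
    then show "(SUP i. ennreal (g x) * emeasure (k t x) (B' i)) = ennreal (g x) * emeasure (k t x) B"
      by (simp add: SUP_mult_left_ennreal[symmetric])
  qed
  finally show ?thesis .
qed

end

context diffusion_on begin

section \<open>Increments started in a set of finite measure\<close>

text \<open>Dictionary between the double integral and the expectation: \<open>measure M B\<close>
  undoes the normalisation of the starting law, t^(p/2) that of the increment.\<close>

lemma increment_eq: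
  assumes f: "f \<in> D" and p: "p > 0" and t: "t > 0" and C: "C \<in> sets borel"
  shows "increment p f t B C = ennreal (t powr (p / 2) * (measure M B *
    (LINT z|J t. indicator C (snd z) * \<bar>jump f z / sqrt t\<bar> powr p)))"
proof -
  have t0: "t \<ge> 0" using t by simp
  let ?F = "\<lambda>z. \<bar>jump f z\<bar> powr p * indicator C (snd z)"
  have bF: "bdd_borel ?F"
  proof (rule bdd_borel_mult)
    show "bdd_borel (\<lambda>z. \<bar>jump f z\<bar> powr p)"
      using bdd_borel_powr_abs[OF bdd_borel_increment[OF f, of 1] p] by simp
    show "bdd_borel (\<lambda>z::'a \<times> 'a. indicator C (snd z))"
      by (rule bdd_borelI[of _ 1, OF indicator_snd_measurable[OF C]]) (auto split: split_indicator)
  qed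
  have e: "?F z = t powr (p / 2) * (indicator C (snd z) * \<bar>jump f z / sqrt t\<bar> powr p)" for z
  proof -
    have "sqrt t powr p = t powr (p / 2)" using t by (simp add: powr_half_sqrt[symmetric] powr_powr)
    then show ?thesis using t by (simp add: powr_divide abs_divide)
  qed
  have "(\<integral>\<^sup>+z. ennreal (?F z) \<partial>J t) = ennreal (LINT z|J t. ?F z)"
    by (rule nn_integral_eq_integral[OF J_integrable[OF t0 bF]]) simp
  moreover have "(\<integral>\<^sup>+z. ennreal (?F z) \<partial>J t) = ennreal (1 / measure M B) * increment p f t B C"
  proof -
    have "(\<integral>\<^sup>+z. ennreal (?F z) \<partial>J t) = (\<integral>\<^sup>+x. (\<integral>\<^sup>+y\<in>C. ennreal (\<bar>f y - f x\<bar> powr p) \<partial>k t x) \<partial>m0)"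
      by (subst J_nn_integral[OF t0 measurable_compose[OF bdd_borel_measurable[OF bF] measurable_ennreal]])
        (simp add: \<kappa>_pos[OF t] ennreal_mult'' ennreal_indicator)
    then show ?thesis
      unfolding increment_def by (simp add: m0_nn_integral[OF inner_increment_measurable[OF t f C]])
  qed
  ultimately have "ennreal (1 / measure M B) * increment p f t B C = ennreal (LINT z|J t. ?F z)" by simp
  then have "ennreal (measure M B) * (ennreal (1 / measure M B) * increment p f t B C)
      = ennreal (measure M B * (LINT z|J t. ?F z))"
    using B_measure(2) by (simp add: ennreal_mult)
  moreover have "ennreal (measure M B) * (ennreal (1 / measure M B) * increment p f t B C) = increment p f t B C"
    using B_measure(2) by (simp add: mult.assoc[symmetric] ennreal_mult[symmetric])
  moreover have "(LINT z|J t. ?F z) = t powr (p / 2) *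
      (LINT z|J t. indicator C (snd z) * \<bar>jump f z / sqrt t\<bar> powr p)"
    unfolding e by (rule integral_mult_right_zero)
  ultimately show ?thesis by (simp only: mult.left_commute)
qed

text \<open>As the kernels have mass 1, the probability of ending outside \<open>B\<close> is 1
  minus the pairing of the indicator of \<open>B\<close> with its image under \<open>P t\<close>,
  divided by the measure of \<open>B\<close>. It tends to 0 by strong continuity; no regularity of
  \<open>B\<close> is involved.\<close>

lemma exit_tendsto: "((\<lambda>t. LINT z|J t. indicat_real (- B) (snd z)) \<longlongrightarrow> 0) (at_right 0)"
proof -
  define b where "b = measure M B"
  have b: "b > 0" using B_measure by (simp add: b_def)
  have iB: "indicator B \<in> Lp 2 M"
    using B_sets B_finite by (intro Lp2_bounded_support[of _ _ 1 B]) (auto simp: sets_M less_top split: split_indicator)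
  have bB: "bdd_borel (indicator B :: 'a \<Rightarrow> real)"
    using B_sets by (intro bdd_borelI[of _ 1]) (auto split: split_indicator)
  have nB: "(LINT x|M. (indicator B x)\<^sup>2) = b"
  proof -
    have "(\<lambda>x. (indicator B x)\<^sup>2) = (indicator B :: 'a \<Rightarrow> real)" by (auto split: split_indicator)
    then show ?thesis using B_sets by (simp add: b_def sets_M space_M)
  qed
  let ?r = "\<lambda>t. sqrt b * sqrt (LINT x|M. (P t (indicator B) x - indicator B x)\<^sup>2) / b"
  have "(?r \<longlongrightarrow> sqrt b * sqrt 0 / b) (at_right 0)"
    using P_continuous[OF iB] b unfolding L2_tendsto_def by (intro tendsto_intros) auto
  then have "(?r \<longlongrightarrow> 0) (at_right 0)" by simp
  moreover have "norm (LINT z|J t. indicat_real (- B) (snd z)) \<le> ?r t" if t: "t > 0" for t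
  proof -
    have t0: "t \<ge> 0" using t by simp
    have PB: "P t (indicator B) \<in> Lp 2 M" by (rule P_Lp2[OF t0 iB])
    have "(LINT z|J t. indicat_real (- B) (snd z)) = (LINT z|J t. 1 - 1 * indicat_real B (snd z))"
      by (intro Bochner_Integration.integral_cong) (auto split: split_indicator)
    also have "\<dots> = 1 - (LINT z|J t. 1 * indicat_real B (snd z))"
      using J_integrable[OF t0 bdd_borel_const] J_integrable[OF t0 bdd_borel_snd[OF bB]]
      by (simp add: prob_space.prob_space[OF J_prob[OF t0]])
    also have "(LINT z|J t. 1 * indicat_real B (snd z)) = (LINT x|M. (indicator B x * 1) * P t (indicator B) x) / b"
      unfolding b_def by (rule J_product[OF t0 bdd_borel_const iB bB])
    also have "1 - \<dots> = - ((LINT x|M. indicator B x * P t (indicator B) x) - b) / b"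
      using b by (simp add: field_simps)
    also have "(LINT x|M. indicator B x * P t (indicator B) x) - b =
        (LINT x|M. indicator B x * P t (indicator B) x - indicator B x * indicator B x)"
      using Lp2_integrable_mult[OF iB PB] Lp2_integrable_mult[OF iB iB]
      unfolding nB[symmetric] by (simp add: power2_eq_square)
    also have "\<dots> = (LINT x|M. indicator B x * (P t (indicator B) x - indicator B x))"
      by (simp add: right_diff_distrib)
    finally have "norm (LINT z|J t. indicat_real (- B) (snd z)) = \<bar>LINT x|M. indicator B x * (P t (indicator B) x - indicator B x)\<bar> / b"
      using b by (simp add: abs_divide)
    also have "\<dots> \<le> ?r t"
      using Lp2_Cauchy_Schwarz[OF iB Lp2_diff[OF PB iB]] b unfolding nB by (intro divide_right_mono) auto
    finally show ?thesis .
  qed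
  then have "eventually (\<lambda>t. norm (LINT z|J t. indicat_real (- B) (snd z)) \<le> ?r t) (at_right 0)"
    by (rule eventually_mono[OF eventually_at_right_less[of 0]])
  ultimately show ?thesis by (rule Lim_null_comparison[rotated])
qed

text \<open>Cauchy-Schwarz: a bounded moment of order 2p against the square root of a vanishing
  probability.\<close>

lemma exit_moment_tendsto:
  assumes f: "f \<in> D" and p: "p > 0"
  shows "((\<lambda>t. LINT z|J t. indicator (- B) (snd z) * \<bar>jump f z / sqrt t\<bar> powr p) \<longlongrightarrow> 0) (at_right 0)"
proof -
  obtain C where C: "C \<ge> 0" "\<And>t. t > 0 \<Longrightarrow> (LINT z|J t. \<bar>jump f z / sqrt t\<bar> powr (2 * p)) \<le> C"
    using powr_moment_bound[OF f, of "2 * p"] p by auto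
  let ?r = "\<lambda>t. sqrt (LINT z|J t. indicator (- B) (snd z)) * sqrt C"
  have "(?r \<longlongrightarrow> sqrt 0 * sqrt C) (at_right 0)"
    by (intro tendsto_intros exit_tendsto)
  then have "(?r \<longlongrightarrow> 0) (at_right 0)" by simp
  moreover have "norm (LINT z|J t. indicator (- B) (snd z) * \<bar>jump f z / sqrt t\<bar> powr p) \<le> ?r t" if t: "t > 0" for t
  proof -
    have t0: "t \<ge> 0" using t by simp
    let ?i = "\<lambda>z::'a \<times> 'a. indicator (- B) (snd z) :: real"
    let ?g = "\<lambda>z. \<bar>jump f z / sqrt t\<bar> powr p"
    have bi: "bdd_borel ?i"
      using B_sets by (intro bdd_borelI[of _ 1, OF indicator_snd_measurable]) (auto split: split_indicator)
    have bg: "bdd_borel ?g" by (intro bdd_borel_powr_abs bdd_borel_increment f p)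
    have L: "h \<in> Lp 2 (J t)" if "bdd_borel h" for h
    proof -
      have "h \<in> borel_measurable (J t)"
        using bdd_borel_measurable[OF that] measurable_cong_sets[OF sets_J[OF t0] refl, of borel] by blast
      then show ?thesis
        using J_integrable[OF t0 bdd_borel_power[OF that, of 2]] by (simp add: Lp2_iff)
    qed
    have "norm (LINT z|J t. ?i z * ?g z) \<le> sqrt (LINT z|J t. (?i z)\<^sup>2) * sqrt (LINT z|J t. (?g z)\<^sup>2)"
      using Lp2_Cauchy_Schwarz[OF L[OF bi] L[OF bg]] by simp
    also have "(LINT z|J t. (?i z)\<^sup>2) = (LINT z|J t. ?i z)"
      by (intro Bochner_Integration.integral_cong) (auto split: split_indicator)
    also have "(LINT z|J t. (?g z)\<^sup>2) = (LINT z|J t. \<bar>jump f z / sqrt t\<bar> powr (2 * p))"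
      by (simp add: power2_eq_square flip: powr_add)
    also have "sqrt (LINT z|J t. ?i z) * sqrt \<dots> \<le> ?r t"
      by (intro mult_left_mono real_sqrt_le_mono C t) (simp add: integral_nonneg_AE)
    finally show ?thesis .
  qed
  then have "eventually (\<lambda>t. norm (LINT z|J t. indicator (- B) (snd z) * \<bar>jump f z / sqrt t\<bar> powr p) \<le> ?r t) (at_right 0)"
    by (rule eventually_mono[OF eventually_at_right_less[of 0]])
  ultimately show ?thesis by (rule Lim_null_comparison[rotated])
qed

text \<open>The rescaled quantity \<sigma> is bounded for all t > 0, which the Besov seminorm asks
  for, and convergent at 0, which the asymptotics ask for.\<close>

lemma increment_limit:
  assumes f: "f \<in> D" and p: "p > 0"
  shows "\<exists>\<sigma> C. (\<forall>t>0. increment p f t B UNIV = ennreal (t powr (p / 2) * \<sigma> t) \<and> 0 \<le> \<sigma> t \<and> \<sigma> t \<le> C) \<and>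
    (\<sigma> \<longlongrightarrow> 2 powr p * (Gamma ((1 + p) / 2) / sqrt pi) * (LINT x|M. indicator B x * \<Gamma> f x powr (p / 2))) (at_right 0)"
proof -
  obtain C where C: "\<And>t. t > 0 \<Longrightarrow> (LINT z|J t. \<bar>jump f z / sqrt t\<bar> powr p) \<le> C"
    using powr_moment_bound[OF f p] by auto
  define \<sigma> where "\<sigma> t = measure M B * (LINT z|J t. \<bar>jump f z / sqrt t\<bar> powr p)" for t
  have "increment p f t B UNIV = ennreal (t powr (p / 2) * \<sigma> t) \<and> 0 \<le> \<sigma> t \<and> \<sigma> t \<le> measure M B * C" if "t > 0" for t
    using increment_eq[OF f p that, of UNIV] C[OF that] B_measure(2)
    by (simp add: \<sigma>_def integral_nonneg_AE)
  moreover have "(\<sigma> \<longlongrightarrow> 2 powr p * (Gamma ((1 + p) / 2) / sqrt pi) * (LINT x|M. indicator B x * \<Gamma> f x powr (p / 2))) (at_right 0)"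
  proof -
    have "(\<sigma> \<longlongrightarrow> measure M B * (2 powr p * (Gamma ((1 + p) / 2) / sqrt pi) * (LINT x|m0. \<Gamma> f x powr (p / 2)))) (at_right 0)"
      unfolding \<sigma>_def by (intro tendsto_intros moment_tendsto f p)
    moreover have "(LINT x|m0. \<Gamma> f x powr (p / 2)) = (LINT x|M. indicator B x * \<Gamma> f x powr (p / 2)) / measure M B"
      using D_measurable[OF D_\<Gamma>[OF f]] by (intro m0_integral) simp
    ultimately show ?thesis using B_measure(2) by simp
  qed
  ultimately show ?thesis by blast
qed

lemma exit_limit:
  assumes f: "f \<in> D" and p: "p > 0"
  shows "\<exists>\<tau>. (\<forall>t>0. increment p f t B (- B) = ennreal (t powr (p / 2) * \<tau> t) \<and> 0 \<le> \<tau> t) \<and> (\<tau> \<longlongrightarrow> 0) (at_right 0)"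
proof -
  define \<tau> where "\<tau> t = measure M B * (LINT z|J t. indicator (- B) (snd z) * \<bar>jump f z / sqrt t\<bar> powr p)" for t
  have "increment p f t B (- B) = ennreal (t powr (p / 2) * \<tau> t) \<and> 0 \<le> \<tau> t" if "t > 0" for t
    using increment_eq[OF f p that, of "- B"] B_sets B_measure(2)
    by (simp add: \<tau>_def integral_nonneg_AE)
  moreover have "(\<tau> \<longlongrightarrow> measure M B * 0) (at_right 0)"
    unfolding \<tau>_def by (intro tendsto_intros exit_moment_tendsto f p)
  ultimately show ?thesis by auto
qed

end

context diffusion_semigroup begin

section \<open>From finite measure to arbitrary Borel sets\<close>

lemma increment_null:
  assumes "B \<in> sets borel" "emeasure M B = 0"
  shows "increment p f t B C = 0"
proof -
  have "AE x in M. x \<notin> B" using assms by (intro AE_not_in) (simp add: null_sets_def sets_M)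
  then have "increment p f t B C = (\<integral>\<^sup>+x. 0 \<partial>M)"
    unfolding increment_def by (intro nn_integral_cong_AE) (auto elim!: eventually_mono)
  then show ?thesis by simp
qed

text \<open>Null sets are split off because no uniform law exists on them; there both sides
  vanish.\<close>

lemma increment_limit_finite:
  assumes f: "f \<in> D" and p: "p > 0" and B: "B \<in> sets borel" "emeasure M B < \<infinity>"
  shows "\<exists>\<sigma> C. (\<forall>t>0. increment p f t B UNIV = ennreal (t powr (p / 2) * \<sigma> t) \<and> 0 \<le> \<sigma> t \<and> \<sigma> t \<le> C) \<and>
    (\<sigma> \<longlongrightarrow> 2 powr p * (Gamma ((1 + p) / 2) / sqrt pi) * (LINT x|M. indicator B x * \<Gamma> f x powr (p / 2))) (at_right 0)"
proof (cases "emeasure M B = 0")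
  case True
  have "AE x in M. x \<notin> B" using B True by (intro AE_not_in) (simp add: null_sets_def sets_M)
  then have "(LINT x|M. indicator B x * \<Gamma> f x powr (p / 2)) = (LINT x|M. 0)"
    using D_measurable[OF D_\<Gamma>[OF f]] B by (intro integral_cong_AE) (auto elim!: eventually_mono)
  then show ?thesis
    using increment_null[OF B(1) True] by (intro exI[of _ "\<lambda>_. 0"] exI[of _ 0]) simp
next
  case False
  interpret diffusion_on M D L \<Gamma> P k B
    using B False by unfold_locales auto
  show ?thesis by (rule increment_limit[OF f p])
qed

lemma exit_limit_finite:
  assumes f: "f \<in> D" and p: "p > 0" and B: "B \<in> sets borel" "emeasure M B < \<infinity>"
  shows "\<exists>\<tau>. (\<forall>t>0. increment p f t B (- B) = ennreal (t powr (p / 2) * \<tau> t) \<and> 0 \<le> \<tau> t) \<and> (\<tau> \<longlongrightarrow> 0) (at_right 0)"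
proof (cases "emeasure M B = 0")
  case True
  then show ?thesis
    using increment_null[OF B(1) True] by (intro exI[of _ "\<lambda>_. 0"]) simp
next
  case False
  interpret diffusion_on M D L \<Gamma> P k B
    using B False by unfold_locales auto
  show ?thesis by (rule exit_limit[OF f p])
qed

text \<open>Off K the increment is just |f(y)|^p. Symmetry exchanges start and end, so a start
  outside with weight at the end becomes a start in K with an end outside, where the increment is
  again |f(x)|^p.\<close>

lemma increment_outside_support:
  assumes f: "f \<in> D" and p: "p > 0" and t: "t > 0"
    and K: "K \<in> sets borel" "emeasure M K < \<infinity>" "\<And>x. x \<notin> K \<Longrightarrow> f x = 0"
  shows "increment p f t (- K) UNIV = increment p f t K (- K)"
proof -
  define g where "g x = \<bar>f x\<bar> powr p" for x
  have bg: "bdd_borel g"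
    unfolding g_def by (rule bdd_borel_powr_abs[OF D_bdd_borel[OF f] p])
  obtain C where C: "\<And>x. \<bar>g x\<bar> \<le> C" by (rule bdd_borelE[OF bg]) blast
  have g0: "g x = 0" if "x \<notin> K" for x using K(3)[OF that] by (simp add: g_def)
  have gL: "g \<in> Lp 2 M"
    using bdd_borel_measurable[OF bg] C K g0 by (intro Lp2_bounded_support[of g M C K]) (auto simp: sets_M)
  have Km: "- K \<in> sets borel" using K(1) by auto
  have "increment p f t (- K) UNIV = (\<integral>\<^sup>+x\<in>- K. (\<integral>\<^sup>+y. ennreal (g y) \<partial>k t x) \<partial>M)"
    unfolding increment_def g_def using K(3) by (intro nn_integral_cong) (auto split: split_indicator)
  also have "\<dots> = (\<integral>\<^sup>+x. ennreal (g x) * emeasure (k t x) (- K) \<partial>M)"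
    by (rule kernel_symmetric[OF t gL _ Km]) (simp add: g_def)
  also have "\<dots> = increment p f t K (- K)"
    unfolding increment_def
  proof (rule nn_integral_cong)
    fix x
    have s: "- K \<in> sets (k t x)" using Km \<kappa>_sets[of t x] t by (simp add: \<kappa>_pos)
    have "(\<integral>\<^sup>+y\<in>- K. ennreal (\<bar>f y - f x\<bar> powr p) \<partial>k t x) = (\<integral>\<^sup>+y. ennreal (g x) * indicator (- K) y \<partial>k t x)"
      using K(3) by (intro nn_integral_cong) (auto simp: g_def split: split_indicator)
    also have "\<dots> = ennreal (g x) * emeasure (k t x) (- K)"
      by (rule nn_integral_cmult_indicator[OF s])
    finally show "ennreal (g x) * emeasure (k t x) (- K) =
        (\<integral>\<^sup>+y\<in>- K. ennreal (\<bar>f y - f x\<bar> powr p) \<partial>k t x) * indicator K x"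
      using g0[of x] by (auto split: split_indicator)
  qed
  finally show ?thesis .
qed

text \<open>A is split along a set K of finite measure carrying f and \<Gamma> f. The part inside K
  has the limit; the part outside is dominated by the exit term of K and vanishes.\<close>

lemma increment_limit_borel:
  assumes f: "f \<in> D" and p: "p > 0" and A: "A \<in> sets borel"
  shows "\<exists>\<sigma> C I. (\<forall>t>0. increment p f t A UNIV = ennreal (t powr (p / 2) * \<sigma> t) \<and> 0 \<le> \<sigma> t \<and> \<sigma> t \<le> C) \<and>
    0 \<le> I \<and> (\<integral>\<^sup>+x\<in>A. ennreal (\<Gamma> f x powr (p / 2)) \<partial>M) = ennreal I \<and>
    (\<sigma> \<longlongrightarrow> 2 powr p * (Gamma ((1 + p) / 2) / sqrt pi) * I) (at_right 0)"
proof -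
  obtain K where K: "K \<in> sets borel" "emeasure M K < \<infinity>" "\<And>x. x \<notin> K \<Longrightarrow> f x = 0" "\<And>x. x \<notin> K \<Longrightarrow> \<Gamma> f x = 0"
    using D_support[OF f] by blast
  define B where "B = A \<inter> K"
  have B: "B \<in> sets borel" using A K(1) by (simp add: B_def)
  have "emeasure M B \<le> emeasure M K" using K(1) by (intro emeasure_mono) (auto simp: B_def sets_M)
  then have Bf: "emeasure M B < \<infinity>" using K(2) by (rule le_less_trans)
  obtain \<sigma>1 C1 where 1: "\<And>t. t > 0 \<Longrightarrow> increment p f t B UNIV = ennreal (t powr (p / 2) * \<sigma>1 t) \<and> 0 \<le> \<sigma>1 t \<and> \<sigma>1 t \<le> C1"
    "(\<sigma>1 \<longlongrightarrow> 2 powr p * (Gamma ((1 + p) / 2) / sqrt pi) * (LINT x|M. indicator B x * \<Gamma> f x powr (p / 2))) (at_right 0)"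
    using increment_limit_finite[OF f p B Bf] by blast
  obtain \<sigma>K CK where K': "\<And>t. t > 0 \<Longrightarrow> increment p f t K UNIV = ennreal (t powr (p / 2) * \<sigma>K t) \<and> 0 \<le> \<sigma>K t \<and> \<sigma>K t \<le> CK"
    using increment_limit_finite[OF f p K(1,2)] by blast
  obtain \<tau> where \<tau>: "\<And>t. t > 0 \<Longrightarrow> increment p f t K (- K) = ennreal (t powr (p / 2) * \<tau> t) \<and> 0 \<le> \<tau> t" "(\<tau> \<longlongrightarrow> 0) (at_right 0)"
    using exit_limit_finite[OF f p K(1,2)] by blast
  define \<sigma>2 where "\<sigma>2 t = enn2real (increment p f t (A - K) UNIV) / t powr (p / 2)" for t
  have 2: "increment p f t (A - K) UNIV = ennreal (t powr (p / 2) * \<sigma>2 t) \<and> 0 \<le> \<sigma>2 t \<and> \<sigma>2 t \<le> \<tau> t \<and> \<sigma>2 t \<le> CK" if t: "t > 0" for t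
  proof -
    have tp: "t powr (p / 2) > 0" using t by simp
    have le: "increment p f t (A - K) UNIV \<le> ennreal (t powr (p / 2) * \<tau> t)"
      using increment_mono[of "A - K" "- K" p f t UNIV] increment_outside_support[OF f p t K(1-3)] \<tau>(1)[OF t] by auto
    \<comment> \<open>This bounds \<tau> for all t > 0 and not only near 0, as the supremum in the
      Besov seminorm runs over all positive times.\<close>
    have "increment p f t K (- K) \<le> increment p f t K UNIV"
      unfolding increment_def by (intro nn_integral_mono mult_right_mono) (auto split: split_indicator)
    then have "ennreal (t powr (p / 2) * \<tau> t) \<le> ennreal (t powr (p / 2) * \<sigma>K t)"
      using \<tau>(1)[OF t] K'[OF t] by simp
    then have tK: "\<tau> t \<le> CK" using tp K'[OF t] by (simp add: ennreal_le_iff)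
    have fin: "increment p f t (A - K) UNIV < top" using le by (rule le_less_trans) simp
    have e: "t powr (p / 2) * \<sigma>2 t = enn2real (increment p f t (A - K) UNIV)" using tp by (simp add: \<sigma>2_def)
    have "enn2real (increment p f t (A - K) UNIV) \<le> t powr (p / 2) * \<tau> t"
      using le \<tau>(1)[OF t] tp by (intro enn2real_leI) auto
    then have "\<sigma>2 t \<le> \<tau> t" using tp unfolding e[symmetric] by simp
    moreover have "\<sigma>2 t \<ge> 0" by (simp add: \<sigma>2_def)
    ultimately show ?thesis using tK fin unfolding e by simp
  qed
  have "(\<sigma>2 \<longlongrightarrow> 0) (at_right 0)"
  proof (rule tendsto_sandwich[OF _ _ tendsto_const \<tau>(2)])
    show "eventually (\<lambda>t. 0 \<le> \<sigma>2 t) (at_right 0)" "eventually (\<lambda>t. \<sigma>2 t \<le> \<tau> t) (at_right 0)"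
      by (rule eventually_mono[OF eventually_at_right_less[of 0]], use 2 in simp)+
  qed
  from tendsto_add[OF 1(2) this]
  have lim: "((\<lambda>t. \<sigma>1 t + \<sigma>2 t) \<longlongrightarrow> 2 powr p * (Gamma ((1 + p) / 2) / sqrt pi) * (LINT x|M. indicator B x * \<Gamma> f x powr (p / 2))) (at_right 0)"
    by simp
  have sum: "increment p f t A UNIV = ennreal (t powr (p / 2) * (\<sigma>1 t + \<sigma>2 t)) \<and> 0 \<le> \<sigma>1 t + \<sigma>2 t \<and> \<sigma>1 t + \<sigma>2 t \<le> C1 + CK" if t: "t > 0" for t
  proof -
    have "A = B \<union> (A - K)" "B \<inter> (A - K) = {}" by (auto simp: B_def)
    then have "increment p f t A UNIV = increment p f t B UNIV + increment p f t (A - K) UNIV"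
      using increment_Un[OF t f B, of "A - K" UNIV p] A K(1) by simp
    then show ?thesis
      using 1(1)[OF t] 2[OF t] by (simp add: distrib_left ennreal_plus[symmetric] del: ennreal_plus)
  qed
  have bG: "bdd_borel (\<lambda>x. \<Gamma> f x powr (p / 2))"
    using bdd_borel_powr_abs[OF D_bdd_borel[OF D_\<Gamma>[OF f]], of "p / 2"] p \<Gamma>_nonneg[OF f] by simp
  obtain CG where CG: "\<And>x. \<bar>\<Gamma> f x powr (p / 2)\<bar> \<le> CG" by (rule bdd_borelE[OF bG]) blast
  have "(\<integral>\<^sup>+x\<in>A. ennreal (\<Gamma> f x powr (p / 2)) \<partial>M) = (\<integral>\<^sup>+x. ennreal (indicator B x * \<Gamma> f x powr (p / 2)) \<partial>M)"
    using K(4) by (intro nn_integral_cong) (auto simp: B_def split: split_indicator)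
  also have "\<dots> = ennreal (LINT x|M. indicator B x * \<Gamma> f x powr (p / 2))"
  proof (rule nn_integral_eq_integral)
    have "integrable M (\<lambda>x. indicator B x * CG)" using B Bf by (simp add: sets_M)
    then show "integrable M (\<lambda>x. indicator B x * \<Gamma> f x powr (p / 2))"
      by (rule Bochner_Integration.integrable_bound)
        (use CG bdd_borel_measurable[OF bG] B in \<open>auto split: split_indicator intro: order_trans[OF _ abs_ge_self]\<close>)
  qed simp
  finally have I: "(\<integral>\<^sup>+x\<in>A. ennreal (\<Gamma> f x powr (p / 2)) \<partial>M) = ennreal (LINT x|M. indicator B x * \<Gamma> f x powr (p / 2))" .
  show ?thesis
    using sum I lim
    by (intro exI[of _ "\<lambda>t. \<sigma>1 t + \<sigma>2 t"] exI[of _ "C1 + CK"]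
          exI[of _ "LINT x|M. indicator B x * \<Gamma> f x powr (p / 2)"]) (simp add: integral_nonneg_AE)
qed

end

section \<open>Hormander operators\<close>

locale hormander_manifold =
  fixes \<A> :: "('a::{t2_space,second_countable_topology}, 'e::euclidean_space) chart set"
    and d :: nat and V :: "nat \<Rightarrow> ('a \<Rightarrow> real) \<Rightarrow> 'a \<Rightarrow> real"
  assumes atlas: "smooth_atlas \<A>"
    and fields: "\<And>i. i \<le> d \<Longrightarrow> smooth_vector_field \<A> (V i)"
begin

abbreviation "D \<equiv> test_functions \<A>"
abbreviation "L \<equiv> hormander_operator d V"

lemma smooth_fun_sum:
  assumes "finite I" "\<And>i. i \<in> I \<Longrightarrow> smooth_fun \<A> (f i)"
  shows "smooth_fun \<A> (\<lambda>x. \<Sum>i\<in>I. f i x)"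
  using assms by (induction I rule: finite_induct) (auto intro: smooth_fun_const smooth_fun_add[OF atlas])

lemma smooth_V: "i \<le> d \<Longrightarrow> smooth_fun \<A> f \<Longrightarrow> smooth_fun \<A> (V i f)"
  by (rule smooth_fun_vector_field[OF atlas fields])

lemma smooth_L: assumes "smooth_fun \<A> f" shows "smooth_fun \<A> (L f)"
  unfolding hormander_operator_def
  by (intro smooth_fun_add[OF atlas] smooth_fun_sum smooth_V assms) auto

lemma Gamma_eq: "smooth_fun \<A> f \<Longrightarrow> smooth_fun \<A> g \<Longrightarrow>
    carre_du_champ L f g = (\<lambda>x. \<Sum>i\<in>{1..d}. V i f x * V i g x)"
  by (rule ext, rule carre_du_champ_hormander_operator[OF atlas fields])

lemma V_local: "i \<le> d \<Longrightarrow> smooth_fun \<A> f \<Longrightarrow> x \<notin> closure {x. f x \<noteq> 0} \<Longrightarrow> V i f x = 0"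
  by (rule vector_field_local[OF atlas fields])

lemma VV_local:
  assumes i: "i \<le> d" and f: "smooth_fun \<A> f" and x: "x \<notin> closure {x. f x \<noteq> 0}"
  shows "V i (V i f) x = 0"
proof (rule V_local[OF i smooth_V[OF i f]])
  have "{x. V i f x \<noteq> 0} \<subseteq> closure {x. f x \<noteq> 0}" using V_local[OF i f] by blast
  then have "closure {x. V i f x \<noteq> 0} \<subseteq> closure {x. f x \<noteq> 0}" by (rule closure_minimal) simp
  then show "x \<notin> closure {x. V i f x \<noteq> 0}" using x by blast
qed

lemma L_local: "smooth_fun \<A> f \<Longrightarrow> x \<notin> closure {x. f x \<noteq> 0} \<Longrightarrow> L f x = 0"
  by (simp add: hormander_operator_def V_local VV_local)

lemma Gamma_local: "smooth_fun \<A> f \<Longrightarrow> smooth_fun \<A> g \<Longrightarrow> x \<notin> closure {x. f x \<noteq> 0} \<Longrightarrow> carre_du_champ L f g x = 0"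
  by (simp add: Gamma_eq V_local)

lemma L_test: "f \<in> D \<Longrightarrow> L f \<in> D"
  using test_functionsD[of f] by (intro test_functionsI[OF smooth_L, of _ "closure {x. f x \<noteq> 0}"]) (auto intro: L_local)

lemma Gamma_test:
  assumes "f \<in> D" "g \<in> D" shows "carre_du_champ L f g \<in> D"
proof (rule test_functionsI)
  note f = test_functionsD[OF assms(1)] and g = test_functionsD[OF assms(2)]
  show "smooth_fun \<A> (carre_du_champ L f g)"
    unfolding Gamma_eq[OF f(1) g(1)] by (intro smooth_fun_sum smooth_fun_mult[OF atlas] smooth_V f(1) g(1)) auto
  show "compact (closure {x. f x \<noteq> 0})" by (rule f(2))
  show "carre_du_champ L f g x = 0" if "x \<notin> closure {x. f x \<noteq> 0}" for x
    by (rule Gamma_local[OF f(1) g(1) that])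
qed

text \<open>V_0 obeys a first-order chain rule. Each square V_i V_i adds \<psi>''(f) (V_i f)^2, and
  these terms sum to \<psi>''(f) \<Gamma>(f,f).\<close>

lemma L_chain:
  assumes f: "smooth_fun \<A> f" and s: "smooth_on UNIV \<psi>"
    and d1: "\<And>z. (\<psi> has_real_derivative \<psi>' z) (at z)" and d2: "\<And>z. (\<psi>' has_real_derivative \<psi>'' z) (at z)"
  shows "L (\<lambda>x. \<psi> (f x)) = (\<lambda>x. \<psi>' (f x) * L f x + \<psi>'' (f x) * carre_du_champ L f f x)"
proof
  fix x
  have s': "smooth_on UNIV \<psi>'" by (rule smooth_on_real_deriv[OF s d1])
  have V1: "V i (\<lambda>x. \<psi> (f x)) = (\<lambda>x. \<psi>' (f x) * V i f x)" if "i \<le> d" for i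
    using vector_field_chain[OF atlas fields[OF that] f s d1] by blast
  have V2: "V i (V i (\<lambda>x. \<psi> (f x))) x = \<psi>' (f x) * V i (V i f) x + \<psi>'' (f x) * (V i f x * V i f x)" if "i \<le> d" for i
    unfolding V1[OF that] vector_field_mult[OF atlas fields[OF that] smooth_fun_compose[OF atlas f s'] smooth_V[OF that f]]
      vector_field_chain[OF atlas fields[OF that] f s' d2]
    by simp
  have "(\<Sum>i\<in>{1..d}. V i (V i (\<lambda>x. \<psi> (f x))) x) =
      (\<Sum>i\<in>{1..d}. \<psi>' (f x) * V i (V i f) x + \<psi>'' (f x) * (V i f x * V i f x))"
    by (rule sum.cong[OF refl]) (simp add: V2)
  then show "L (\<lambda>x. \<psi> (f x)) x = \<psi>' (f x) * L f x + \<psi>'' (f x) * carre_du_champ L f f x"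
    unfolding Gamma_eq[OF f f] hormander_operator_def V1[OF le0]
    by (simp add: sum.distrib sum_distrib_left distrib_left)
qed

lemma test_functions_diff: "f \<in> D \<Longrightarrow> g \<in> D \<Longrightarrow> (\<lambda>x. f x - g x) \<in> D"
  using test_functions_add[OF atlas _ test_functions_cmult[OF atlas, of g "- 1"], of f] by simp

text \<open>The cutoff is \<theta>(S) with \<theta>(0) = 0 and \<theta> = 1 on all s \<ge> c, so
  both derivatives vanish wherever S \<ge> c, and the chain rule gives the vanishing of
  \<open>L\<close> pointwise on K. No neighbourhood of K on which the cutoff equals 1 is
  needed.\<close>

lemma exists_flat_cutoff:
  assumes K: "compact K"
  obtains \<eta> where "\<eta> \<in> D" "\<And>x. x \<in> K \<Longrightarrow> \<eta> x = 1" "\<And>x. x \<in> K \<Longrightarrow> L \<eta> x = 0"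
proof -
  obtain S c where S: "S \<in> D" "c > 0" "\<And>x. x \<in> K \<Longrightarrow> S x \<ge> c"
    using exists_cutoff[OF atlas K] by metis
  define \<theta> where "\<theta> s = 1 - flat_exp 0 (c - s) / flat_exp 0 c" for s
  \<comment> \<open>The first and second derivatives of \<theta>, read off the derivative rule of
    \<open>flat_exp\<close> at m = 0 and m = 2.\<close>
  define \<theta>1 where "\<theta>1 s = flat_exp 2 (c - s) / flat_exp 0 c" for s
  define \<theta>2 where "\<theta>2 s = - (flat_exp 4 (c - s) - 2 * flat_exp 3 (c - s)) / flat_exp 0 c" for s
  have nz: "flat_exp 0 c > 0" using S(2) by (simp add: flat_exp_def)
  have fd: "((\<lambda>s. flat_exp m (c - s)) has_real_derivative - (flat_exp (m + 2) (c - s) - real m * flat_exp (m + 1) (c - s))) (at s)" for m s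
  proof -
    have "((\<lambda>s. c - s) has_real_derivative - 1) (at s)" by (auto intro!: derivative_eq_intros)
    then show ?thesis by (rule DERIV_cong[OF DERIV_chain2[OF flat_exp_has_derivative]]) simp
  qed
  have d1: "(\<theta> has_real_derivative \<theta>1 s) (at s)" for s
    unfolding \<theta>_def \<theta>1_def using DERIV_diff[OF DERIV_const[of 1] DERIV_cdivide[OF fd[of 0 s], of "flat_exp 0 c"]]
    by (simp add: numeral_2_eq_2)
  have d2: "(\<theta>1 has_real_derivative \<theta>2 s) (at s)" for s
    unfolding \<theta>1_def \<theta>2_def using DERIV_cdivide[OF fd[of 2 s], of "flat_exp 0 c"]
    by (simp add: numeral_eq_Suc)
  have s: "smooth_on UNIV \<theta>"
  proof -
    have "smooth_on UNIV (\<lambda>s. c + (- 1) * s)"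
      by (intro smooth_on_add smooth_on_mult smooth_on_const smooth_on_id open_UNIV)
    then have "Ck_on k UNIV (\<lambda>s. flat_exp 0 (c + (- 1) * s))" for k
      unfolding smooth_on_def using Ck_on_compose[OF open_UNIV smooth_on_flat_exp] by blast
    then have "smooth_on UNIV (\<lambda>s. 1 + (- 1 / flat_exp 0 c) * flat_exp 0 (c + (- 1) * s))"
      by (intro smooth_on_add smooth_on_mult smooth_on_const open_UNIV) (simp add: smooth_on_def)
    then show ?thesis by (simp add: \<theta>_def[abs_def])
  qed
  let ?\<eta> = "\<lambda>x. \<theta> (S x)"
  have z: "flat_exp m (c - S x) = 0" if "x \<in> K" for x m using S(3)[OF that] by (simp add: flat_exp_def)
  show ?thesis
  proof (rule that)
    show "?\<eta> \<in> D" using nz by (intro test_functions_compose[OF atlas S(1) s]) (simp add: \<theta>_def)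
    show "?\<eta> x = 1" if "x \<in> K" for x using z[OF that] by (simp add: \<theta>_def)
    show "L ?\<eta> x = 0" if "x \<in> K" for x
      unfolding L_chain[OF test_functionsD(1)[OF S(1)] s d1 d2] using z[OF that] by (simp add: \<theta>1_def \<theta>2_def)
  qed
qed

end

section \<open>Integration by parts, closability and the generator\<close>

locale hormander_self_adjoint = hormander_manifold \<A> d V
  for \<A> :: "('a::{t2_space,second_countable_topology}, 'e::euclidean_space) chart set"
    and d :: nat and V :: "nat \<Rightarrow> ('a \<Rightarrow> real) \<Rightarrow> 'a \<Rightarrow> real" +
  fixes \<mu> :: "'a measure"
  assumes radon: "radon_measure \<mu>"
    and esa: "essentially_self_adjoint \<mu> D L"
begin

abbreviation "E \<equiv> pre_dirichlet_form \<mu> L"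

lemma sets_\<mu>: "sets \<mu> = sets borel"
  using radon by (simp add: radon_measure_def)

lemma space_\<mu>: "space \<mu> = UNIV"
  using sets_eq_imp_space_eq[OF sets_\<mu>] by simp

lemma \<mu>_compact: "compact K \<Longrightarrow> emeasure \<mu> K < \<infinity>"
  using radon by (simp add: radon_measure_def)

lemma D_Lp2: "f \<in> D \<Longrightarrow> f \<in> Lp 2 \<mu>"
  using esa by (auto simp: essentially_self_adjoint_def)

text \<open>The graph of \<open>L\<close> lies in its closure, which equals its own adjoint; testing
  (f, L f), as an adjoint element, against (g, L g) gives symmetry.\<close>

lemma L_symmetric:
  assumes f: "f \<in> D" and g: "g \<in> D"
  shows "(LINT x|\<mu>. f x * L g x) = (LINT x|\<mu>. L f x * g x)"
proof -
  have c: "(h, L h) \<in> closure_graph \<mu> (op_graph D L)" if "h \<in> D" for h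
    unfolding closure_graph_def using D_Lp2[OF that] D_Lp2[OF L_test[OF that]] that
    by (auto intro!: exI[of _ "\<lambda>_. (h, L h)"] simp: op_graph_def L2_tendsto_def)
  have "(f, L f) \<in> adjoint_graph \<mu> (closure_graph \<mu> (op_graph D L))"
    using c[OF f] esa by (simp add: essentially_self_adjoint_def)
  then show ?thesis
    using c[OF g] unfolding adjoint_graph_def by fast
qed

text \<open>With a cutoff equal to 1 on the support, f is a product of two L^2 functions.\<close>

lemma test_integrable: assumes f: "f \<in> D" shows "integrable \<mu> f"
proof -
  obtain \<eta> where \<eta>: "\<eta> \<in> D" "\<And>x. x \<in> closure {x. f x \<noteq> 0} \<Longrightarrow> \<eta> x = 1"
    by (rule exists_flat_cutoff[OF test_functionsD(2)[OF f]]) blast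
  have "f x * \<eta> x = f x" for x
    using \<eta>(2) test_functions_support[of f x] by (cases "f x = 0") auto
  then have "(\<lambda>x. f x * \<eta> x) = f" by (rule ext)
  then show ?thesis
    using Lp2_integrable_mult[OF D_Lp2[OF f] D_Lp2[OF \<eta>(1)]] by (simp only:)
qed

text \<open>Formally \<open>L\<close> is paired with the constant 1, which need not lie in L^2. A
  flat cutoff replaces it: on the support of h it equals 1 and is annihilated by
  \<open>L\<close>.\<close>

lemma integral_L: assumes h: "h \<in> D" shows "(LINT x|\<mu>. L h x) = 0"
proof -
  let ?K = "closure {x. h x \<noteq> 0}"
  obtain \<eta> where \<eta>: "\<eta> \<in> D" "\<And>x. x \<in> ?K \<Longrightarrow> \<eta> x = 1" "\<And>x. x \<in> ?K \<Longrightarrow> L \<eta> x = 0"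
    by (rule exists_flat_cutoff[OF test_functionsD(2)[OF h]]) blast
  have 1: "L h x = L h x * \<eta> x" for x
    using \<eta>(2) L_local[OF test_functionsD(1)[OF h], of x] by (cases "x \<in> ?K") auto
  have 2: "h x * L \<eta> x = 0" for x
    using \<eta>(3)[of x] test_functions_support[of h x] by (cases "h x = 0") auto
  have "(LINT x|\<mu>. L h x) = (LINT x|\<mu>. L h x * \<eta> x)"
    by (rule Bochner_Integration.integral_cong[OF refl 1])
  also have "\<dots> = (LINT x|\<mu>. h x * L \<eta> x)" by (rule L_symmetric[OF h \<eta>(1), symmetric])
  finally show ?thesis by (simp add: 2)
qed

text \<open>In the definition of \<Gamma> the term L(fg) has integral 0, and the other two agree by
  symmetry. All algebraic properties of the form are derived from this identity.\<close>

lemma form_by_parts: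
  assumes f: "f \<in> D" and g: "g \<in> D"
  shows "E f g = - (LINT x|\<mu>. f x * L g x)"
proof -
  have fg: "(\<lambda>x. f x * g x) \<in> D" by (rule test_functions_mult[OF atlas f test_functionsD(1)[OF g]])
  have i: "integrable \<mu> (L (\<lambda>x. f x * g x))" by (rule test_integrable[OF L_test[OF fg]])
  have i1: "integrable \<mu> (\<lambda>x. f x * L g x)" "integrable \<mu> (\<lambda>x. L f x * g x)"
    by (rule Lp2_integrable_mult[OF D_Lp2 D_Lp2]; intro f g L_test)+
  have "E f g = (LINT x|\<mu>. (L (\<lambda>y. f y * g y) x - f x * L g x - L f x * g x) / 2)"
    by (simp add: pre_dirichlet_form_def carre_du_champ_def mult.commute)
  also have "\<dots> = ((LINT x|\<mu>. L (\<lambda>y. f y * g y) x) - (LINT x|\<mu>. f x * L g x) - (LINT x|\<mu>. L f x * g x)) / 2"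
    using i i1 by simp
  also have "\<dots> = - (LINT x|\<mu>. f x * L g x)"
    using L_symmetric[OF f g] integral_L[OF fg] by simp
  finally show ?thesis .
qed

lemma form_symmetric: "f \<in> D \<Longrightarrow> g \<in> D \<Longrightarrow> E f g = E g f"
  using form_by_parts[of f g] form_by_parts[of g f] L_symmetric[of f g] by (simp add: mult.commute)

lemma form_nonneg: "f \<in> D \<Longrightarrow> E f f \<ge> 0"
  unfolding pre_dirichlet_form_def
  by (intro integral_nonneg_AE AE_I2) (simp add: Gamma_eq[OF test_functionsD(1) test_functionsD(1)] sum_nonneg)

lemma form_linear:
  assumes f: "f \<in> D" and g: "g \<in> D" and h: "h \<in> D"
  shows "E (\<lambda>x. f x + c * g x) h = E f h + c * E g h"
proof -
  have fg: "(\<lambda>x. f x + c * g x) \<in> D" by (intro test_functions_add[OF atlas] test_functions_cmult[OF atlas] f g)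
  have i: "integrable \<mu> (\<lambda>x. f x * L h x)" "integrable \<mu> (\<lambda>x. g x * L h x)"
    by (rule Lp2_integrable_mult[OF D_Lp2 D_Lp2]; intro f g h L_test)+
  have "(LINT x|\<mu>. (f x + c * g x) * L h x) = (LINT x|\<mu>. f x * L h x + c * (g x * L h x))"
    by (simp add: algebra_simps)
  then show ?thesis
    using i by (simp add: form_by_parts[OF fg h] form_by_parts[OF f h] form_by_parts[OF g h])
qed

lemma form_square:
  assumes f: "f \<in> D" and g: "g \<in> D"
  shows "E (\<lambda>x. f x + c * g x) (\<lambda>x. f x + c * g x) = E f f + 2 * c * E f g + c\<^sup>2 * E g g"
proof -
  have fg: "(\<lambda>x. f x + c * g x) \<in> D" by (intro test_functions_add[OF atlas] test_functions_cmult[OF atlas] f g)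
  show ?thesis
    using form_linear[OF f g fg, of c] form_linear[OF f g f, of c] form_linear[OF f g g, of c]
      form_symmetric[OF f fg] form_symmetric[OF g fg] form_symmetric[OF f g]
    by (simp add: power2_eq_square algebra_simps)
qed

lemma form_Cauchy_Schwarz:
  assumes f: "f \<in> D" and g: "g \<in> D"
  shows "\<bar>E f g\<bar> \<le> sqrt (E f f) * sqrt (E g g)"
proof -
  have "(E f g)\<^sup>2 \<le> E f f * E g g"
  proof (rule quadratic_discriminant)
    fix c
    have "0 \<le> E (\<lambda>x. f x + c * g x) (\<lambda>x. f x + c * g x)"
      by (intro form_nonneg test_functions_add[OF atlas] test_functions_cmult[OF atlas] f g)
    then show "0 \<le> E f f + 2 * E f g * c + E g g * c\<^sup>2"
      unfolding form_square[OF f g] by (simp add: mult_ac)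
  qed
  from real_sqrt_le_mono[OF this] show ?thesis by (simp add: real_sqrt_mult)
qed

lemma L2_tendsto_integral:
  assumes u: "\<And>n. u n \<in> Lp 2 \<mu>" "v \<in> Lp 2 \<mu>" "h \<in> Lp 2 \<mu>" and lim: "L2_tendsto \<mu> u v sequentially"
  shows "(\<lambda>n. LINT x|\<mu>. u n x * h x) \<longlonglongrightarrow> (LINT x|\<mu>. v x * h x)"
proof -
  let ?r = "\<lambda>n. sqrt (LINT x|\<mu>. (u n x - v x)\<^sup>2) * sqrt (LINT x|\<mu>. (h x)\<^sup>2)"
  have "?r \<longlonglongrightarrow> sqrt 0 * sqrt (LINT x|\<mu>. (h x)\<^sup>2)"
    using lim unfolding L2_tendsto_def by (intro tendsto_intros)
  then have r0: "?r \<longlonglongrightarrow> 0" by simp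
  have le: "norm ((LINT x|\<mu>. u n x * h x) - (LINT x|\<mu>. v x * h x)) \<le> ?r n" for n
  proof -
    have "(LINT x|\<mu>. u n x * h x) - (LINT x|\<mu>. v x * h x) = (LINT x|\<mu>. (u n x - v x) * h x)"
      using Lp2_integrable_mult[OF u(1) u(3)] Lp2_integrable_mult[OF u(2,3)] by (simp add: left_diff_distrib)
    then show ?thesis
      using Lp2_Cauchy_Schwarz[OF Lp2_diff[OF u(1,2)] u(3)] by simp
  qed
  show ?thesis
    by (rule LIM_zero_cancel[OF Lim_null_comparison[OF always_eventually r0]]) (use le in blast)
qed

text \<open>Closability of the form, in the shape needed to identify the closed form on test functions.\<close>

lemma form_null_sequence:
  assumes w: "\<And>n. w n \<in> D" and lim: "L2_tendsto \<mu> w (\<lambda>_. 0) sequentially"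
    and cauchy: "\<And>e. e > 0 \<Longrightarrow> \<exists>N. \<forall>m\<ge>N. \<forall>n\<ge>N. E (\<lambda>x. w m x - w n x) (\<lambda>x. w m x - w n x) < e"
  shows "(\<lambda>n. E (w n) (w n)) \<longlonglongrightarrow> 0"
proof (rule LIMSEQ_I)
  fix e :: real assume e: "e > 0"
  obtain N where N: "\<And>m n. m \<ge> N \<Longrightarrow> n \<ge> N \<Longrightarrow> E (\<lambda>x. w m x - w n x) (\<lambda>x. w m x - w n x) < e / 2"
    using cauchy[of "e / 2"] e by auto
  have "norm (E (w n) (w n) - 0) < e" if n: "n \<ge> N" for n
  proof -
    have "(\<lambda>m. LINT x|\<mu>. w m x * L (w n) x) \<longlonglongrightarrow> (LINT x|\<mu>. 0 * L (w n) x)"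
      using D_Lp2[OF w] D_Lp2[OF L_test[OF w]] lim D_Lp2[OF test_functions_zero]
      by (intro L2_tendsto_integral) auto
    then have l: "(\<lambda>m. E (w m) (w n)) \<longlonglongrightarrow> 0"
      using tendsto_minus[of "\<lambda>m. LINT x|\<mu>. w m x * L (w n) x" 0 sequentially] by (simp add: form_by_parts[OF w w])
    \<comment> \<open>The energy of w_n is split as E(w_n - w_m, w_n) + E(w_m, w_n). The first term
      is small by the Cauchy property, the second tends to 0 in m because \<open>L\<close> can be
      moved onto the fixed w_n.\<close>
    have "eventually (\<lambda>m. E (w n) (w n) \<le> sqrt (E (w n) (w n)) * sqrt (e / 2) + E (w m) (w n)) sequentially"
      using eventually_ge_at_top[of N]
    proof eventually_elim
      case (elim m)
      have wd: "(\<lambda>x. w n x - w m x) \<in> D" by (rule test_functions_diff[OF w w])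
      have "E (w n) (w n) = E (\<lambda>x. w n x - w m x) (w n) + E (w m) (w n)"
        using form_linear[OF w w w, of n "- 1" m n] by simp
      also have "E (\<lambda>x. w n x - w m x) (w n) \<le> sqrt (E (\<lambda>x. w n x - w m x) (\<lambda>x. w n x - w m x)) * sqrt (E (w n) (w n))"
        using form_Cauchy_Schwarz[OF wd w] by (rule order_trans[OF abs_ge_self])
      also have "\<dots> \<le> sqrt (e / 2) * sqrt (E (w n) (w n))"
        using N[OF n elim] form_nonneg[OF w] by (intro mult_right_mono real_sqrt_le_mono) auto
      finally show ?case by (simp add: mult.commute)
    qed
    moreover have "(\<lambda>m. sqrt (E (w n) (w n)) * sqrt (e / 2) + E (w m) (w n)) \<longlonglongrightarrow> sqrt (E (w n) (w n)) * sqrt (e / 2) + 0"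
      by (intro tendsto_intros l)
    ultimately have le: "E (w n) (w n) \<le> sqrt (E (w n) (w n)) * sqrt (e / 2)"
      using tendsto_lowerbound[of _ _ sequentially "E (w n) (w n)"] by fastforce
    have "E (w n) (w n) \<le> e / 2"
    proof (rule ccontr)
      assume "\<not> E (w n) (w n) \<le> e / 2"
      then have "sqrt (e / 2) < sqrt (E (w n) (w n))" "0 < sqrt (E (w n) (w n))" using e by (auto intro: less_trans[of 0 "e / 2"])
      then have "sqrt (E (w n) (w n)) * sqrt (e / 2) < sqrt (E (w n) (w n)) * sqrt (E (w n) (w n))"
        by (rule mult_strict_left_mono)
      with le form_nonneg[OF w, of n] show False by simp
    qed
    then show ?thesis using e form_nonneg[OF w, of n] by simp
  qed
  then show "\<exists>no. \<forall>n\<ge>no. norm (E (w n) (w n) - 0) < e" by blast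
qed

text \<open>The difference of s_n and f is null in energy by closability, and the energies of r_n
  are bounded, so s_n may be replaced by f. Then \<open>L\<close> acts on f, and only L^2
  convergence of r_n is used.\<close>

lemma form_tendsto:
  assumes f: "f \<in> D" and s: "form_approximates \<mu> D E s f" and r: "form_approximates \<mu> D E r v" and v: "v \<in> Lp 2 \<mu>"
  shows "(\<lambda>n. E (s n) (r n)) \<longlonglongrightarrow> - (LINT x|\<mu>. L f x * v x)"
proof -
  have sD: "s n \<in> D" and rD: "r n \<in> D" for n using s r by (auto simp: form_approximates_def)
  define w where "w n x = s n x - f x" for n x
  have w: "w n \<in> D" for n unfolding w_def by (rule test_functions_diff[OF sD f])
  have "(\<lambda>n. E (w n) (w n)) \<longlonglongrightarrow> 0"
  proof (rule form_null_sequence[OF w])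
    show "L2_tendsto \<mu> w (\<lambda>_. 0) sequentially"
      using s by (simp add: form_approximates_def L2_tendsto_def w_def)
    show "\<exists>N. \<forall>m\<ge>N. \<forall>n\<ge>N. E (\<lambda>x. w m x - w n x) (\<lambda>x. w m x - w n x) < e" if "e > 0" for e
      using s that by (simp add: form_approximates_def w_def)
  qed
  then have sw: "(\<lambda>n. sqrt (E (w n) (w n))) \<longlonglongrightarrow> 0" using tendsto_real_sqrt by fastforce
  obtain N where N: "\<And>m n. m \<ge> N \<Longrightarrow> n \<ge> N \<Longrightarrow> E (\<lambda>x. r m x - r n x) (\<lambda>x. r m x - r n x) < 1"
    using r zero_less_one unfolding form_approximates_def by blast
  \<comment> \<open>Parallelogram law: the energy of r_n is at most twice that of r_n - r_N plus
    twice that of r_N.\<close>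
  define b where "b = 2 + 2 * E (r N) (r N)"
  have rb: "E (r n) (r n) \<le> b" if "n \<ge> N" for n
  proof -
    have dD: "(\<lambda>x. r n x - r N x) \<in> D" by (rule test_functions_diff[OF rD rD])
    have "E (\<lambda>x. (r n x - r N x) + 1 * r N x) (\<lambda>x. (r n x - r N x) + 1 * r N x) +
        E (\<lambda>x. (r n x - r N x) + (- 1) * r N x) (\<lambda>x. (r n x - r N x) + (- 1) * r N x) =
        2 * E (\<lambda>x. r n x - r N x) (\<lambda>x. r n x - r N x) + 2 * E (r N) (r N)"
      unfolding form_square[OF dD rD] by simp
    moreover have "E (\<lambda>x. (r n x - r N x) + (- 1) * r N x) (\<lambda>x. (r n x - r N x) + (- 1) * r N x) \<ge> 0"
      by (intro form_nonneg test_functions_add[OF atlas] test_functions_cmult[OF atlas] dD rD)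
    moreover have "E (\<lambda>x. (r n x - r N x) + 1 * r N x) (\<lambda>x. (r n x - r N x) + 1 * r N x) = E (r n) (r n)" by simp
    ultimately show ?thesis using N[OF that order_refl] by (simp add: b_def)
  qed
  have "(\<lambda>n. E (w n) (r n)) \<longlonglongrightarrow> 0"
  proof (rule Lim_null_comparison)
    show "eventually (\<lambda>n. norm (E (w n) (r n)) \<le> sqrt (E (w n) (w n)) * sqrt b) sequentially"
      using eventually_ge_at_top[of N]
    proof eventually_elim
      case (elim n)
      have "norm (E (w n) (r n)) \<le> sqrt (E (w n) (w n)) * sqrt (E (r n) (r n))"
        using form_Cauchy_Schwarz[OF w rD] by simp
      also have "\<dots> \<le> sqrt (E (w n) (w n)) * sqrt b"
        using rb[OF elim] form_nonneg[OF w] by (intro mult_left_mono real_sqrt_le_mono) auto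
      finally show ?case .
    qed
    show "(\<lambda>n. sqrt (E (w n) (w n)) * sqrt b) \<longlonglongrightarrow> 0"
      using tendsto_mult_right[OF sw, of "sqrt b"] by simp
  qed
  moreover have "(\<lambda>n. E f (r n)) \<longlonglongrightarrow> - (LINT x|\<mu>. L f x * v x)"
  proof -
    have "(\<lambda>n. LINT x|\<mu>. r n x * L f x) \<longlonglongrightarrow> (LINT x|\<mu>. v x * L f x)"
      using r by (intro L2_tendsto_integral D_Lp2 rD v L_test f) (simp add: form_approximates_def)
    from tendsto_minus[OF this] show ?thesis
      by (simp add: form_symmetric[OF f rD] form_by_parts[OF rD f] mult.commute)
  qed
  moreover have "E (s n) (r n) = E (w n) (r n) + E f (r n)" for n
    using form_linear[OF w f rD, of n 1 n] by (simp add: w_def)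
  ultimately show ?thesis using tendsto_add by fastforce
qed

text \<open>The point is that the definite description in \<open>closed_form\<close> is well defined
  here: \<open>form_tendsto\<close> shows that every choice of sequences has the same limit, and the
  constant sequence f together with one approximation of v excludes any other value.\<close>

lemma L_form_generator:
  assumes f: "f \<in> D"
  shows "(f, L f) \<in> form_generator \<mu> D E"
proof -
  have z: "E (\<lambda>_. 0) (\<lambda>_. 0) = 0"
    using form_by_parts[OF test_functions_zero test_functions_zero] by simp
  have sf: "form_approximates \<mu> D E (\<lambda>_. f) f"
    using f by (simp add: form_approximates_def L2_tendsto_def z)
  have "closed_form \<mu> D E f v = - (LINT x|\<mu>. L f x * v x)" if v: "v \<in> closed_form_domain \<mu> D E" for v
    unfolding closed_form_def
  proof (rule the_equality)
    obtain r where r: "form_approximates \<mu> D E r v" and vL: "v \<in> Lp 2 \<mu>"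
      using v by (auto simp: closed_form_domain_def)
    show "\<forall>s r. form_approximates \<mu> D E s f \<longrightarrow> form_approximates \<mu> D E r v \<longrightarrow>
        (\<lambda>n. E (s n) (r n)) \<longlonglongrightarrow> - (LINT x|\<mu>. L f x * v x)"
      using form_tendsto[OF f _ _ vL] by blast
    show "e = - (LINT x|\<mu>. L f x * v x)"
      if "\<forall>s r. form_approximates \<mu> D E s f \<longrightarrow> form_approximates \<mu> D E r v \<longrightarrow> (\<lambda>n. E (s n) (r n)) \<longlonglongrightarrow> e" for e
      using that sf r form_tendsto[OF f sf r vL] LIMSEQ_unique by blast
  qed
  then show ?thesis
    using sf D_Lp2[OF f] D_Lp2[OF L_test[OF f]] by (auto simp: form_generator_def closed_form_domain_def)
qed

text \<open>Positivity sets of bumps are open and lie in compact sets, hence have finite measure; by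
  the Lindelof property countably many of them cover.\<close>

lemma sigma_finite_\<mu>: "sigma_finite_measure \<mu>"
proof
  have "\<exists>b. b \<in> D \<and> b x > 0" for x using exists_bump[OF atlas, of x] by metis
  then obtain b where b: "\<And>x. b x \<in> D" "\<And>x. b x x > 0" by metis
  let ?U = "\<lambda>x. {y. b x y > 0}"
  have cont: "continuous_on UNIV (b x)" for x
    by (rule smooth_fun_continuous[OF atlas test_functionsD(1)[OF b(1)]])
  have o: "open (?U x)" for x
    using open_Collect_less[OF continuous_on_const cont] by simp
  obtain F where F: "F \<subseteq> range ?U" "countable F" "\<Union>F = \<Union>(range ?U)"
    using Lindelof[of "range ?U"] o by blast
  have "emeasure \<mu> (?U x) < \<infinity>" for x
  proof -
    have "?U x \<subseteq> closure {y. b x y \<noteq> 0}" using closure_subset[of "{y. b x y \<noteq> 0}"] by auto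
    then have "emeasure \<mu> (?U x) \<le> emeasure \<mu> (closure {y. b x y \<noteq> 0})"
      by (intro emeasure_mono) (auto simp: sets_\<mu>)
    also have "\<dots> < \<infinity>" by (rule \<mu>_compact[OF test_functionsD(2)[OF b(1)]])
    finally show ?thesis .
  qed
  then have fin: "emeasure \<mu> (?U x) \<noteq> \<infinity>" for x by (simp add: less_top)
  show "\<exists>F. countable F \<and> F \<subseteq> sets \<mu> \<and> \<Union>F = space \<mu> \<and> (\<forall>a\<in>F. emeasure \<mu> a \<noteq> \<infinity>)"
  proof (intro exI[of _ F] conjI ballI)
    show "countable F" by (rule F(2))
    have "\<And>a. a \<in> range ?U \<Longrightarrow> open a" using o by blast
    then show "F \<subseteq> sets \<mu>" using F(1) unfolding sets_\<mu> by (meson borel_open subset_iff)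
    show "\<Union>F = space \<mu>" unfolding F(3) space_\<mu> using b(2) by blast
    show "emeasure \<mu> a \<noteq> \<infinity>" if "a \<in> F" for a
    proof -
      obtain x where "a = ?U x" using F(1) \<open>a \<in> F\<close> by blast
      then show ?thesis using fin by metis
    qed
  qed
qed

lemma test_bounded: assumes "f \<in> D" shows "\<exists>C. \<forall>x. \<bar>f x\<bar> \<le> C"
proof -
  have "compact (f ` closure {x. f x \<noteq> 0})"
    by (rule compact_continuous_image[OF continuous_on_subset[OF smooth_fun_continuous[OF atlas test_functionsD(1)[OF assms]]] test_functionsD(2)[OF assms]]) simp
  then obtain C where C: "\<And>y. y \<in> f ` closure {x. f x \<noteq> 0} \<Longrightarrow> norm y \<le> C"
    using compact_imp_bounded bounded_iff by metis
  have "\<bar>f x\<bar> \<le> \<bar>C\<bar>" for x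
    using C[of "f x"] test_functions_support[of f x] by (cases "f x = 0") force+
  then show ?thesis by blast
qed

lemma diffusion_semigroup:
  assumes "heat_semigroup \<mu> D E P" "heat_kernel \<mu> P k"
  shows "diffusion_semigroup \<mu> D L (\<lambda>f. carre_du_champ L f f) P k"
proof (rule diffusion_semigroup.intro)
  show "\<exists>A\<in>sets borel. emeasure \<mu> A < \<infinity> \<and> (\<forall>x. x \<notin> A \<longrightarrow> f x = 0 \<and> carre_du_champ L f f x = 0)" if "f \<in> D" for f
    using \<mu>_compact[OF test_functionsD(2)[OF that]] test_functions_support[of f]
      Gamma_local[OF test_functionsD(1)[OF that] test_functionsD(1)[OF that]]
    by (intro bexI[of _ "closure {x. f x \<noteq> 0}"]) auto
  show "continuous_on UNIV f" if "f \<in> D" for f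
    by (rule smooth_fun_continuous[OF atlas test_functionsD(1)[OF that]])
  show "carre_du_champ L f f x \<ge> 0" if "f \<in> D" for f x
    using test_functionsD[OF that] by (auto simp: Gamma_eq intro!: sum_nonneg)
  show "L (\<lambda>x. \<psi> (f x)) = (\<lambda>x. \<psi>' (f x) * L f x + \<psi>'' (f x) * carre_du_champ L f f x)"
    if "f \<in> D" "smooth_on UNIV \<psi>" "\<psi> 0 = 0" "\<And>z. (\<psi> has_real_derivative \<psi>' z) (at z)"
      "\<And>z. (\<psi>' has_real_derivative \<psi>'' z) (at z)" for f \<psi> \<psi>' \<psi>''
    by (rule L_chain[OF test_functionsD(1)[OF that(1)] that(2,4,5)])
  \<comment> \<open>The generator of the form and that of the semigroup coincide, so the inclusion
    of \<open>L\<close> passes to the semigroup.\<close>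
  show "(f, L f) \<in> semigroup_generator \<mu> P" if "f \<in> D" for f
    using L_form_generator[OF that] assms(1) by (simp add: heat_semigroup_def)
  show "symmetric_markov_semigroup \<mu> P" using assms(1) by (simp add: heat_semigroup_def)
  show "carre_du_champ L f f \<in> D" if "f \<in> D" for f by (rule Gamma_test[OF that that])
  show "(\<lambda>x. \<psi> (f x)) \<in> D" if "f \<in> D" "smooth_on UNIV \<psi>" "\<psi> 0 = 0" for f \<psi>
    by (rule test_functions_compose[OF atlas that])
qed (fact sets_\<mu> sigma_finite_\<mu> assms(2) | erule test_bounded | erule L_test)+

end

section \<open>The Besov bound and the limit for open sets\<close>

lemma ennreal_root_ennreal: "a \<ge> 0 \<Longrightarrow> ennreal_root p (ennreal a) = ennreal (a powr (1 / p))"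
  by (simp add: ennreal_root_def)

theorem proposition4p2:
  fixes \<A> :: "('a::{t2_space, second_countable_topology}, 'e::euclidean_space) chart set"
    and d :: nat
    and V :: "nat \<Rightarrow> ('a \<Rightarrow> real) \<Rightarrow> 'a \<Rightarrow> real"
    and L :: "('a \<Rightarrow> real) \<Rightarrow> 'a \<Rightarrow> real"
    and \<mu> :: "'a measure"
    and P :: "real \<Rightarrow> ('a \<Rightarrow> real) \<Rightarrow> 'a \<Rightarrow> real"
    and k :: "real \<Rightarrow> 'a \<Rightarrow> 'a measure"
    and p :: real
  assumes manifold: "smooth_atlas \<A>"
    and dim: "d \<le> DIM('e)"
    and fields: "\<And>i. i \<le> d \<Longrightarrow> smooth_vector_field \<A> (V i)"
    and L: "L = hormander_operator d V"
    and radon: "radon_measure \<mu>"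
    and esa: "essentially_self_adjoint \<mu> (test_functions \<A>) L"
    and semigroup: "heat_semigroup \<mu> (test_functions \<A>) (pre_dirichlet_form \<mu> L) P"
    and conservative: "conservative \<mu> P"
    and kernel: "heat_kernel \<mu> P k"
    and p: "p \<ge> 1"
  shows "test_functions \<A> \<subseteq> besov_space \<mu> k p (1/2) \<and>
    (\<forall>f\<in>test_functions \<A>. \<forall>A. open A \<longrightarrow>
      ((\<lambda>t. ennreal (t powr (-1/2)) * heat_increment \<mu> k p t A f) \<longlongrightarrow>
         ennreal (2 * (Gamma ((1 + p) / 2) / sqrt pi) powr (1 / p)) *
         ennreal_root p (\<integral>\<^sup>+x\<in>A. ennreal (carre_du_champ L f f x powr (p / 2)) \<partial>\<mu>))
      (at_right 0))"
proof -
  interpret H: hormander_self_adjoint \<A> d V \<mu>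
    using manifold fields radon esa L by unfold_locales auto
  interpret S: diffusion_semigroup \<mu> "test_functions \<A>" L "\<lambda>f. carre_du_champ L f f" P k
    unfolding L using semigroup kernel by (intro H.diffusion_semigroup) (simp_all add: L)
  have hi: "heat_increment \<mu> k p t A f = ennreal_root p (S.increment p f t A UNIV)" for t A f
    by (simp add: heat_increment_def S.increment_def)
  have p0: "p > 0" using p by simp
  \<comment> \<open>The p-th root of t^(p/2) cancels t^(-1/2), which leaves the p-th root of the
    rescaled increment.\<close>
  have scaled: "ennreal (t powr (-1/2)) * ennreal_root p (ennreal (t powr (p / 2) * s)) = ennreal (s powr (1 / p))"
    if "t > 0" "s \<ge> 0" for t s
  proof -
    have "(t powr (p / 2) * s) powr (1 / p) = t powr (1 / 2) * s powr (1 / p)"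
      using that p0 by (simp add: powr_mult powr_powr)
    moreover have "t powr (-1/2) * t powr (1 / 2) = 1" using that by (simp add: powr_add[symmetric])
    ultimately show ?thesis
      using that by (simp add: ennreal_root_ennreal ennreal_mult[symmetric] mult.assoc[symmetric])
  qed
  have "f \<in> besov_space \<mu> k p (1/2)" if f: "f \<in> test_functions \<A>" for f
  proof -
    obtain \<sigma> C where \<sigma>: "\<And>t. t > 0 \<Longrightarrow> S.increment p f t UNIV UNIV = ennreal (t powr (p / 2) * \<sigma> t) \<and> 0 \<le> \<sigma> t \<and> \<sigma> t \<le> C"
      using S.increment_limit_borel[OF f p0, of UNIV] by auto
    have "ennreal (t powr - (1/2)) * heat_increment \<mu> k p t UNIV f \<le> ennreal (C powr (1 / p))" if "t > 0" for t
      using scaled[OF that, of "\<sigma> t"] \<sigma>[OF that] p0 unfolding hi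
      by (auto intro!: ennreal_leI powr_mono2)
    then have "besov_seminorm \<mu> k p (1/2) f \<le> ennreal (C powr (1 / p))"
      unfolding besov_seminorm_def by (intro SUP_least) auto
    then have "besov_seminorm \<mu> k p (1/2) f < \<infinity>" by (rule le_less_trans) simp
    moreover have "f \<in> Lp p \<mu>"
    proof -
      have b: "bdd_borel (\<lambda>x. \<bar>f x\<bar> powr p)" by (rule bdd_borel_powr_abs[OF S.D_bdd_borel[OF f] p0])
      obtain C where C: "\<And>x. \<bar>\<bar>f x\<bar> powr p\<bar> \<le> C" by (rule bdd_borelE[OF b]) blast
      obtain K where K: "K \<in> sets borel" "emeasure \<mu> K < \<infinity>" "\<And>x. x \<notin> K \<Longrightarrow> f x = 0"
        using S.D_support[OF f] by blast
      have "integrable \<mu> (\<lambda>x. indicator K x * C)" using K by (simp add: H.sets_\<mu>)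
      then have "integrable \<mu> (\<lambda>x. \<bar>f x\<bar> powr p)"
        by (rule Bochner_Integration.integrable_bound)
          (use bdd_borel_measurable[OF b] K(3) C in \<open>auto split: split_indicator intro: order_trans[OF _ abs_ge_self]\<close>)
      then show ?thesis using S.D_measurable[OF f] by (simp add: Lp_def)
    qed
    ultimately show ?thesis by (simp add: besov_space_def)
  qed
  moreover have "((\<lambda>t. ennreal (t powr (-1/2)) * heat_increment \<mu> k p t A f) \<longlongrightarrow>
         ennreal (2 * (Gamma ((1 + p) / 2) / sqrt pi) powr (1 / p)) *
         ennreal_root p (\<integral>\<^sup>+x\<in>A. ennreal (carre_du_champ L f f x powr (p / 2)) \<partial>\<mu>)) (at_right 0)"
    if f: "f \<in> test_functions \<A>" and A: "open A" for f A
  proof -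
    define c where "c = Gamma ((1 + p) / 2) / sqrt pi"
    have c: "c > 0" using p0 by (simp add: c_def Gamma_real_pos)
    obtain \<sigma> C I where \<sigma>: "\<And>t. t > 0 \<Longrightarrow> S.increment p f t A UNIV = ennreal (t powr (p / 2) * \<sigma> t) \<and> 0 \<le> \<sigma> t \<and> \<sigma> t \<le> C"
      and I: "0 \<le> I" "(\<integral>\<^sup>+x\<in>A. ennreal (carre_du_champ L f f x powr (p / 2)) \<partial>\<mu>) = ennreal I"
      and lim: "(\<sigma> \<longlongrightarrow> 2 powr p * c * I) (at_right 0)"
      using S.increment_limit_borel[OF f p0 borel_open[OF A]] unfolding c_def by blast
    have ev: "eventually (\<lambda>t. 0 \<le> \<sigma> t) (at_right 0)"
      by (rule eventually_mono[OF eventually_at_right_less[of 0]]) (use \<sigma> in simp)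
    have "((\<lambda>t. \<sigma> t powr (1 / p)) \<longlongrightarrow> (2 powr p * c * I) powr (1 / p)) (at_right 0)"
      by (rule tendsto_powr2[OF lim tendsto_const ev]) (use p0 in simp)
    then have lim1: "((\<lambda>t. ennreal (\<sigma> t powr (1 / p))) \<longlongrightarrow> ennreal ((2 powr p * c * I) powr (1 / p))) (at_right 0)"
      by (rule tendsto_ennrealI)
    have ev1: "eventually (\<lambda>t. ennreal (\<sigma> t powr (1 / p)) = ennreal (t powr (-1/2)) * heat_increment \<mu> k p t A f) (at_right 0)"
      by (rule eventually_mono[OF eventually_at_right_less[of 0]]) (use scaled \<sigma> hi in simp)
    \<comment> \<open>The p-th root of 2^p is the factor 2 in front.\<close>
    have eq: "ennreal ((2 powr p * c * I) powr (1 / p)) = ennreal (2 * c powr (1 / p)) *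
         ennreal_root p (\<integral>\<^sup>+x\<in>A. ennreal (carre_du_champ L f f x powr (p / 2)) \<partial>\<mu>)"
      unfolding I(2) using I(1) c p0
      by (simp add: ennreal_root_ennreal powr_mult powr_powr ennreal_mult[symmetric])
    show ?thesis
      unfolding c_def[symmetric] by (rule Lim_transform_eventually[OF lim1[unfolded eq] ev1])
  qed
  ultimately show ?thesis by blast
qed

end
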